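(* Let $X$ be a Banach space, let $\mathcal{A}$ be an area functional, and let $\gamma:(S^1,d_{S^1})\to X$ be a $1$-Lipschitz map which is not an isometric embedding. Then there exists a $1$-Lipschitz map $m:H^2\to X$ with $m|_{S^1}=\gamma$ and $\mathcal{A}(m)<2\pi$. In particular $\mathrm{Fill}^{\mathcal{A}}(\gamma)<2\pi$.
   Context: $d_{S^1}$ is the angular metric on the unit circle $S^1$ (total length $2\pi$). $H^2$ is the closed upper hemisphere of the round unit sphere $S^2$ with its spherical metric; its boundary is the equator, identified isometrically with $(S^1,d_{S^1})$; the area of $H^2$ is $2\pi$. Let $\Sigma$ be the set of seminorms on $\mathbb{R}^2$. A Jacobian is a map $\mathbf{J}:\Sigma\to[0,\infty)$ with (1) $\mathbf{J}(|\cdot|)=1$ for the Euclidean norm, (2) $\mathbf{J}(s)\ge\mathbf{J}(s')$ whenever $s\ge s'$, (3) $\mathbf{J}(s\circ T)=|\det T|\,\mathbf{J}(s)$ for every linear $T:\mathbb{R}^2\to\mathbb{R}^2$. For a Lipschitz map $f:U\to X$, $U\subset\mathbb{R}^2$ open, into a metric space, the metric differential $(\mathrm{md}_pf)(v):=\lim_{t\to0}d(f(p+tv),f(p))/|t|$ exists for a.e. $p$, and the area functional associated with $\mathbf{J}$ is $\mathcal{A}(f):=\int_U\mathbf{J}(\mathrm{md}_pf)\,d\mathcal{L}^2(p)$; it is invariant under bi-Lipschitz changes of coordinates and hence defines areas of Lipschitz maps from surfaces such as $H^2$ or the closed disc. For a closed Lipschitz curve $\gamma:S^1\to X$, $\mathrm{Fill}^{\mathcal{A}}(\gamma):=\inf\{\mathcal{A}(f):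 f:\bar D^2\to X \text{ Lipschitz}, f|_{S^1}=\gamma\}$. *)

theory Defs
  imports "HOL-Analysis.Analysis"
begin

definition seminorm2 :: "(real^2 \<Rightarrow> real) \<Rightarrow> bool" where
  "seminorm2 s \<longleftrightarrow> (\<forall>x y. s (x + y) \<le> s x + s y) \<and> (\<forall>c x. s (c *\<^sub>R x) = \<bar>c\<bar> * s x)"

text \<open>A Jacobian: a map from seminorms on R^2 to [0,inf) with normalisation,
  monotonicity and the transformation rule. Values on non-seminorms are irrelevant.\<close>
definition jacobian :: "((real^2 \<Rightarrow> real) \<Rightarrow> real) \<Rightarrow> bool" where
  "jacobian J \<longleftrightarrow>
     (\<forall>s. seminorm2 s \<longrightarrow> J s \<ge> 0) \<and>
     J norm = 1 \<and>
     (\<forall>s s'. seminorm2 s \<and> seminorm2 s' \<and> (\<forall>v. s' v \<le> s v) \<longrightarrow> J s' \<le> J s) \<and>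
     (\<forall>s T. seminorm2 s \<and> linear T \<longrightarrow> J (s \<circ> T) = \<bar>det (matrix T)\<bar> * J s)"

definition md :: "(real^2 \<Rightarrow> 'a::metric_space) \<Rightarrow> real^2 \<Rightarrow> real^2 \<Rightarrow> real" where
  "md f p v = Lim (at (0::real)) (\<lambda>t. dist (f (p + t *\<^sub>R v)) (f p) / \<bar>t\<bar>)"

definition area :: "((real^2 \<Rightarrow> real) \<Rightarrow> real) \<Rightarrow> (real^2 \<Rightarrow> 'a::metric_space) \<Rightarrow> (real^2) set \<Rightarrow> ennreal" where
  "area J f U = (\<integral>\<^sup>+ p \<in> U. ennreal (J (md f p)) \<partial>lborel)"

definition S1 :: "(real^2) set" where
  "S1 = sphere 0 1"

definition dS1 :: "real^2 \<Rightarrow> real^2 \<Rightarrow> real" where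
  "dS1 p q = arccos (p \<bullet> q)"

definition H2 :: "(real^3) set" where
  "H2 = {p. norm p = 1 \<and> p $ 3 \<ge> 0}"

definition dH2 :: "real^3 \<Rightarrow> real^3 \<Rightarrow> real" where
  "dH2 p q = arccos (p \<bullet> q)"

definition equator :: "real^2 \<Rightarrow> real^3" where
  "equator x = vector [x $ 1, x $ 2, 0]"

text \<open>Inverse stereographic projection from the south pole: a bi-Lipschitz
  homeomorphism of the closed unit disc onto H2 extending equator on S1.\<close>
definition stereo_inv :: "real^2 \<Rightarrow> real^3" where
  "stereo_inv u = vector [2 * u $ 1 / (1 + (norm u)\<^sup>2), 2 * u $ 2 / (1 + (norm u)\<^sup>2),
                          (1 - (norm u)\<^sup>2) / (1 + (norm u)\<^sup>2)]"

definition lipschitz_wrt :: "('b \<Rightarrow> 'b \<Rightarrow> real) \<Rightarrow> real \<Rightarrow> 'b set \<Rightarrow> ('b \<Rightarrow> 'a::metric_space) \<Rightarrow> bool" where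
  "lipschitz_wrt d C U f \<longleftrightarrow> (\<forall>x\<in>U. \<forall>y\<in>U. dist (f x) (f y) \<le> C * d x y)"

definition isometric_embedding_S1 :: "(real^2 \<Rightarrow> 'a::metric_space) \<Rightarrow> bool" where
  "isometric_embedding_S1 g \<longleftrightarrow> (\<forall>x\<in>S1. \<forall>y\<in>S1. dist (g x) (g y) = dS1 x y)"

definition area_H2 :: "((real^2 \<Rightarrow> real) \<Rightarrow> real) \<Rightarrow> (real^3 \<Rightarrow> 'a::metric_space) \<Rightarrow> ennreal" where
  "area_H2 J m = area J (m \<circ> stereo_inv) (ball 0 1)"

definition fill_area :: "((real^2 \<Rightarrow> real) \<Rightarrow> real) \<Rightarrow> (real^2 \<Rightarrow> 'a::metric_space) \<Rightarrow> ennreal" where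
  "fill_area J g = Inf {area J f (ball 0 1) | f. (\<exists>C. lipschitz_on C (cball 0 1) f) \<and> (\<forall>x\<in>S1. f x = g x)}"

end

theory Submission
  imports Defs
begin

text \<open>The extension is \<open>m(p) = \<integral> \<gamma> d\<mu>\<^sub>p\<close> for explicit probability measures \<open>\<mu>\<^sub>p\<close> on the equator, built from
  Crofton's measure on the great circles through \<open>p\<close>. If \<open>p\<close> moves along a half great circle from an
  equatorial point \<open>a\<close> to its antipode, then on each of the two arcs from \<open>a\<close> to \<open>-a\<close> the mass of \<open>\<mu>\<^sub>p\<close> is moved
  monotonically away from \<open>a\<close>. Hence the transport cost between \<open>\<mu>\<^sub>p\<close> and \<open>\<mu>\<^sub>q\<close> is the difference of their mean
  distances to \<open>a\<close>, and the mean distance of \<open>\<mu>\<^sub>p\<close> to \<open>a\<close> is exactly the spherical distance of \<open>p\<close>; so \<open>m\<close> is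
  1-Lipschitz. If \<open>\<gamma>\<close> is not isometric, it shortens the distance of some antipodal pair \<open>\<plusminus>a\<close>, and then \<open>m\<close>
  strictly contracts all great circles meeting the equator near \<open>a\<close>. Through a point close to \<open>a\<close> almost all
  directions are of this kind, which forces the Jacobian of \<open>m\<close> below one on an open set.\<close>

section \<open>The kernel\<close>

text \<open>Let \<open>d\<close> be the distance from \<open>p\<close> to the equatorial point at
  angle \<theta>. The first summand of the density is half the positive part of the second
  derivative of \<open>d\<close> in \<theta>. Since antipodal distances add up to \<open>pi\<close>,
  that derivative is odd under the antipodal map, so the densities at \<theta> and at its antipode
  differ by half of it. This relation and total mass one already force the masses
  \<open>(1 + k) / 2\<close> and \<open>(1 - k) / 2\<close> of the two arcs, independent of
  \<open>s\<close>, and the mean distance \<open>s\<close>: no mass has to cross \<open>a\<close> or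
  its antipode, and the cost is computed arc by arc. What has to be fought for is monotonicity. As
  \<open>p\<close> rises, the uniform summand grows and pushes mass towards \<open>a\<close>,
  against the motion of the first summand; Jordan's inequality for \<open>sin\<close> decides
  between them. The other obstacle is that Lipschitz curves in a Banach space need not be
  differentiable anywhere. Every derivative is therefore moved to the scalar densities or to
  averages of the curve, and limits are taken by scalar dominated convergence.\<close>

text \<open>Polar coordinates around an equatorial point \<open>a\<close>: the point \<open>p\<close> at distance \<open>s\<close> from \<open>a\<close> on the great
  circle leaving the equator at the angle \<open>arccos k\<close> has squared height \<open>height_sq k s\<close>, and \<open>eq_cos k s \<theta>\<close> is
  the cosine of its distance to the equatorial point at angle \<open>\<theta>\<close> from \<open>a\<close>.\<close>

definition eq_cos :: "real \<Rightarrow> real \<Rightarrow> real \<Rightarrow> real" where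
  "eq_cos k s \<theta> = cos s * cos \<theta> + k * sin s * sin \<theta>"

definition eq_sin :: "real \<Rightarrow> real \<Rightarrow> real \<Rightarrow> real" where
  "eq_sin k s \<theta> = cos s * sin \<theta> - k * sin s * cos \<theta>"

definition height_sq :: "real \<Rightarrow> real \<Rightarrow> real" where
  "height_sq k s = (1 - k\<^sup>2) * (sin s)\<^sup>2"

text \<open>The first summand is the density of the equatorial points at which a random great circle through
  \<open>p\<close> (in Crofton's measure) meets the equator on the side of \<open>p\<close>; its mass is the Euclidean distance of
  \<open>p\<close> to the axis. The second summand completes it to mass one.\<close>

definition kernel :: "real \<Rightarrow> real \<Rightarrow> real" where
  "kernel c y = max 0 c * y / (2 * sqrt (1 - c\<^sup>2) ^ 3) + (1 - sqrt (1 - y)) / (2 * pi)"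

text \<open>Up to sign, the two numbers are the coordinates of the projection of \<open>p\<close> to
  the equatorial plane, in the frame turned by \<theta>; the right side is its squared
  length.\<close>

lemma eq_cos_eq_sin: "(eq_cos k s \<theta>)\<^sup>2 + (eq_sin k s \<theta>)\<^sup>2 = 1 - height_sq k s"
proof -
  have "(eq_cos k s \<theta>)\<^sup>2 + (eq_sin k s \<theta>)\<^sup>2 = ((cos s)\<^sup>2 + k\<^sup>2 * (sin s)\<^sup>2) * ((sin \<theta>)\<^sup>2 + (cos \<theta>)\<^sup>2)"
    unfolding eq_cos_def eq_sin_def by algebra
  then show ?thesis
    unfolding height_sq_def sin_cos_squared_add cos_squared_eq[of s] by (simp add: algebra_simps)
qed

lemma height_sq_pos: "\<bar>k\<bar> < 1 \<Longrightarrow> 0 < s \<Longrightarrow> s < pi \<Longrightarrow> 0 < height_sq k s"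
  unfolding height_sq_def using abs_square_less_1[of k] sin_gt_zero[of s] by simp

lemma eq_cos_sq_less:
  assumes "\<bar>k\<bar> < 1" "0 < s" "s < pi"
  shows "(eq_cos k s \<theta>)\<^sup>2 < 1"
  using eq_cos_eq_sin[of k s \<theta>] height_sq_pos[OF assms] zero_le_power2[of "eq_sin k s \<theta>"] by linarith

lemma height_sq_le_1: "height_sq k s \<le> 1"
  using eq_cos_eq_sin[of k s 0] zero_le_power2[of "eq_sin k s 0"] zero_le_power2[of "eq_cos k s 0"] by linarith

text \<open>The quotient is the \<theta>-derivative of the distance from \<open>p\<close> to the
  equatorial point at \<theta> (see \<open>arccos_eq_cos_deriv\<close>), so this is the second
  derivative of the distance; half its positive part is the first summand of
  \<open>kernel\<close>.\<close>

lemma eq_sin_over_deriv: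
  assumes "\<bar>k\<bar> < 1" "0 < s" "s < pi"
  shows "((\<lambda>t. eq_sin k s t / sqrt (1 - (eq_cos k s t)\<^sup>2)) has_real_derivative
            eq_cos k s \<theta> * height_sq k s / sqrt (1 - (eq_cos k s \<theta>)\<^sup>2) ^ 3) (at \<theta>)"
proof -
  let ?c = "eq_cos k s \<theta>" and ?d = "eq_sin k s \<theta>"
  let ?r = "sqrt (1 - ?c\<^sup>2)"
  have r: "1 - ?c\<^sup>2 > 0" using eq_cos_sq_less[OF assms, of \<theta>] by simp
  then have r0: "?r > 0" and rr: "?r\<^sup>2 = 1 - ?c\<^sup>2" by auto
  have c': "(eq_cos k s has_real_derivative - ?d) (at \<theta>)"
    unfolding eq_cos_def eq_sin_def by (auto intro!: derivative_eq_intros)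
  have d': "(eq_sin k s has_real_derivative ?c) (at \<theta>)"
    unfolding eq_cos_def eq_sin_def by (auto intro!: derivative_eq_intros)
  have r': "((\<lambda>t. sqrt (1 - (eq_cos k s t)\<^sup>2)) has_real_derivative ?c * ?d / ?r) (at \<theta>)"
    using r by (auto intro!: derivative_eq_intros c' simp: field_simps)
  have y: "height_sq k s = ?r\<^sup>2 - ?d\<^sup>2" unfolding rr using eq_cos_eq_sin[of k s \<theta>] by simp
  have "((\<lambda>t. eq_sin k s t / sqrt (1 - (eq_cos k s t)\<^sup>2)) has_real_derivative
          (?c * ?r - ?d * (?c * ?d / ?r)) / (?r * ?r)) (at \<theta>)"
    by (rule DERIV_divide[OF d' r']) (use r0 in auto)
  also have "(?c * ?r - ?d * (?c * ?d / ?r)) / (?r * ?r) = ?c * height_sq k s / ?r ^ 3"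
    unfolding y using r0 by (simp add: field_simps power2_eq_square power3_eq_cube)
  finally show ?thesis .
qed

lemma eq_sin_over_deriv_s:
  assumes "\<bar>k\<bar> < 1" "0 < s" "s < pi"
  shows "((\<lambda>t. eq_sin k t \<theta> / sqrt (1 - (eq_cos k t \<theta>)\<^sup>2)) has_real_derivative
            - ((1 - k\<^sup>2) * sin s * sin \<theta> / sqrt (1 - (eq_cos k s \<theta>)\<^sup>2) ^ 3)) (at s)"
proof -
  let ?c = "eq_cos k s \<theta>" and ?d = "eq_sin k s \<theta>"
  let ?r = "sqrt (1 - ?c\<^sup>2)"
  define c' where "c' = - sin s * cos \<theta> + k * cos s * sin \<theta>"
  define d' where "d' = - sin s * sin \<theta> - k * cos s * cos \<theta>"
  have r: "1 - ?c\<^sup>2 > 0" using eq_cos_sq_less[OF assms, of \<theta>] by simp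
  then have r0: "?r > 0" and rr: "?r\<^sup>2 = 1 - ?c\<^sup>2" by auto
  have c': "((\<lambda>t. eq_cos k t \<theta>) has_real_derivative c') (at s)"
    unfolding eq_cos_def c'_def by (auto intro!: derivative_eq_intros)
  have d': "((\<lambda>t. eq_sin k t \<theta>) has_real_derivative d') (at s)"
    unfolding eq_sin_def d'_def by (auto intro!: derivative_eq_intros)
  have r': "((\<lambda>t. sqrt (1 - (eq_cos k t \<theta>)\<^sup>2)) has_real_derivative - (?c * c') / ?r) (at s)"
    using r by (auto intro!: derivative_eq_intros c' simp: field_simps)
  have e1: "(sin s)\<^sup>2 + (cos s)\<^sup>2 = 1" "(sin \<theta>)\<^sup>2 + (cos \<theta>)\<^sup>2 = 1" by simp_all
  have key: "d' * (1 - ?c\<^sup>2) + ?d * (?c * c') = - ((1 - k\<^sup>2) * sin s * sin \<theta>)"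
    using e1 unfolding eq_cos_def eq_sin_def c'_def d'_def by algebra
  have "((\<lambda>t. eq_sin k t \<theta> / sqrt (1 - (eq_cos k t \<theta>)\<^sup>2)) has_real_derivative
          (d' * ?r - ?d * (- (?c * c') / ?r)) / (?r * ?r)) (at s)"
    by (rule DERIV_divide[OF d' r']) (use r0 in auto)
  also have "(d' * ?r - ?d * (- (?c * c') / ?r)) / (?r * ?r) = (d' * ?r\<^sup>2 + ?d * (?c * c')) / ?r ^ 3"
    using r0 by (simp add: field_simps power2_eq_square power3_eq_cube)
  finally show ?thesis unfolding rr key by simp
qed

lemma arccos_eq_cos_deriv:
  assumes "\<bar>k\<bar> < 1" "0 < s" "s < pi"
  shows "((\<lambda>t. arccos (eq_cos k s t)) has_real_derivative eq_sin k s \<theta> / sqrt (1 - (eq_cos k s \<theta>)\<^sup>2)) (at \<theta>)"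
proof -
  have c: "(eq_cos k s \<theta>)\<^sup>2 < 1" by (rule eq_cos_sq_less[OF assms])
  then have "\<bar>eq_cos k s \<theta>\<bar> < 1" by (simp add: abs_square_less_1)
  then have b: "-1 < eq_cos k s \<theta>" "eq_cos k s \<theta> < 1" by auto
  have c': "(eq_cos k s has_real_derivative - eq_sin k s \<theta>) (at \<theta>)"
    unfolding eq_cos_def eq_sin_def by (auto intro!: derivative_eq_intros)
  show ?thesis
    using DERIV_chain2[OF DERIV_arccos[OF b] c'] by (simp add: divide_inverse mult.commute)
qed

lemma continuous_on_kernel:
  assumes "continuous_on S c" "\<And>t. t \<in> S \<Longrightarrow> (c t)\<^sup>2 < 1"
  shows "continuous_on S (\<lambda>t. kernel (c t) y)"
  unfolding kernel_def
  by (intro continuous_intros assms(1)) (use assms(2) in force)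

lemma continuous_on_eq_cos [continuous_intros]: "continuous_on S (eq_cos k s)"
  unfolding eq_cos_def by (intro continuous_intros)

lemma continuous_on_kernel_eq_cos:
  assumes "\<bar>k\<bar> < 1" "0 < s" "s < pi"
  shows "continuous_on S (\<lambda>t. kernel (eq_cos k s t) (height_sq k s))"
  by (intro continuous_on_kernel continuous_on_eq_cos eq_cos_sq_less assms)

text \<open>The mass of the arc from \<open>0\<close> to \<open>\<theta>\<close>, valid for \<open>eq_cos k s \<theta> \<ge> 0\<close> and for \<open>eq_cos k s \<theta> \<le> 0\<close>,
  respectively.\<close>

definition cdf_near :: "real \<Rightarrow> real \<Rightarrow> real \<Rightarrow> real" where
  "cdf_near k s \<theta> = (eq_sin k s \<theta> / sqrt (1 - (eq_cos k s \<theta>)\<^sup>2) + k) / 2 + (1 - sqrt (1 - height_sq k s)) * \<theta> / (2 * pi)"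

definition cdf_far :: "real \<Rightarrow> real \<Rightarrow> real \<Rightarrow> real" where
  "cdf_far k s \<theta> = (1 + k) / 2 - (1 - sqrt (1 - height_sq k s)) * (pi - \<theta>) / (2 * pi)"

lemma cdf_near_0:
  assumes "0 < s" "s < pi" shows "cdf_near k s 0 = 0"
proof -
  have "1 - (cos s)\<^sup>2 = (sin s)\<^sup>2" by (simp add: sin_squared_eq)
  moreover have "sin s > 0" using assms by (simp add: sin_gt_zero)
  ultimately show ?thesis unfolding cdf_near_def eq_sin_def eq_cos_def by simp
qed

lemma cdf_far_pi [simp]: "cdf_far k s pi = (1 + k) / 2"
  by (simp add: cdf_far_def)

text \<open>At a zero of \<open>eq_cos\<close>, \<open>eq_sin\<close> is the full length
  \<open>sqrt (1 - height_sq k s)\<close> of the projection. What its half lacks to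
  \<open>1 / 2\<close> is exactly the mass of the uniform summand on a half circle, so the two
  formulas join continuously.\<close>

lemma cdf_near_eq_cdf_far:
  assumes "eq_cos k s \<theta> = 0" "eq_sin k s \<theta> \<ge> 0"
  shows "cdf_near k s \<theta> = cdf_far k s \<theta>"
proof -
  have "eq_sin k s \<theta> = sqrt (1 - height_sq k s)"
    using eq_cos_eq_sin[of k s \<theta>] assms by (simp add: real_sqrt_unique)
  then show ?thesis unfolding cdf_near_def cdf_far_def assms by (simp add: field_simps)
qed

lemma cdf_near_deriv:
  assumes "\<bar>k\<bar> < 1" "0 < s" "s < pi" "eq_cos k s \<theta> \<ge> 0"
  shows "(cdf_near k s has_real_derivative kernel (eq_cos k s \<theta>) (height_sq k s)) (at \<theta>)"
proof -
  note h = DERIV_add[OF DERIV_cdivide[OF DERIV_add[OF eq_sin_over_deriv[OF assms(1-3), of \<theta>] DERIV_const[of k]], of 2]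
      DERIV_cdivide[OF DERIV_cmult[OF DERIV_ident, of "1 - sqrt (1 - height_sq k s)"], of "2 * pi"]]
  show ?thesis unfolding cdf_near_def[abs_def] kernel_def
    by (rule DERIV_cong[OF h]) (use assms(4) in \<open>simp add: max_def\<close>)
qed

lemma cdf_far_deriv:
  assumes "eq_cos k s \<theta> \<le> 0"
  shows "(cdf_far k s has_real_derivative kernel (eq_cos k s \<theta>) (height_sq k s)) (at \<theta>)"
proof -
  have "((\<lambda>\<theta>. (1 + k) / 2 - C * (pi - \<theta>) / (2 * pi)) has_real_derivative C / (2 * pi)) (at \<theta>)" for C
    by (auto intro!: derivative_eq_intros)
  then show ?thesis unfolding cdf_far_def[abs_def] kernel_def
    using assms by (simp add: max_def)
qed

definition geo_cdf :: "real \<Rightarrow> real \<Rightarrow> real \<Rightarrow> real" where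
  "geo_cdf k s \<theta> = (if eq_cos k s \<theta> \<ge> 0 then cdf_near k s \<theta> else cdf_far k s \<theta>)"

lemma cdf_near_eq_cdf_far':
  assumes "0 < s" "s < pi / 2" "0 \<le> \<theta>" "\<theta> \<le> pi" "eq_cos k s \<theta> = 0"
  shows "cdf_near k s \<theta> = cdf_far k s \<theta>"
proof (rule cdf_near_eq_cdf_far[OF assms(5)])
  have cs: "cos s > 0" using assms by (simp add: cos_gt_zero_pi)
  \<comment> \<open>This combination eliminates \<open>k\<close>, so the sign of
    \<open>eq_sin\<close> follows from \<open>cos s > 0\<close> alone.\<close>
  have "eq_sin k s \<theta> * sin \<theta> = cos s - eq_cos k s \<theta> * cos \<theta>"
    unfolding eq_sin_def eq_cos_def using sin_cos_squared_add[of \<theta>] by algebra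
  then have "eq_sin k s \<theta> * sin \<theta> > 0" using assms(5) cs by simp
  moreover have "sin \<theta> \<ge> 0" using assms by (simp add: sin_ge_zero)
  ultimately show "eq_sin k s \<theta> \<ge> 0" by (simp add: zero_less_mult_iff)
qed

text \<open>As a function of \<theta>, \<open>eq_cos\<close> is a positive multiple of
  \<open>cos (\<theta> - \<alpha>)\<close> with \<open>tan \<alpha> = k * tan s\<close>. Since
  \<alpha> lies strictly between \<open>- pi / 2\<close> and \<open>pi / 2\<close>, there is exactly
  one change of sign on the half circle.\<close>

lemma eq_cos_zero:
  assumes "0 < s" "s < pi/2"
  obtains \<theta>0 where "0 < \<theta>0" "\<theta>0 < pi" "eq_cos k s \<theta>0 = 0" "eq_sin k s \<theta>0 \<ge> 0"
    "\<And>\<theta>. 0 \<le> \<theta> \<Longrightarrow> \<theta> \<le> \<theta>0 \<Longrightarrow> eq_cos k s \<theta> \<ge> 0" "\<And>\<theta>. \<theta>0 \<le> \<theta> \<Longrightarrow> \<theta> \<le> pi \<Longrightarrow> eq_cos k s \<theta> \<le> 0"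
proof -
  have cs: "cos s > 0" using assms by (simp add: cos_gt_zero_pi)
  define \<alpha> where "\<alpha> = arctan (k * tan s)"
  have a: "- (pi/2) < \<alpha>" "\<alpha> < pi/2" unfolding \<alpha>_def by (rule arctan_lbound arctan_ubound)+
  then have ca: "cos \<alpha> > 0" by (simp add: cos_gt_zero_pi)
  have "tan \<alpha> = k * tan s" unfolding \<alpha>_def by (rule tan_arctan)
  then have sa: "k * sin s * cos \<alpha> = sin \<alpha> * cos s"
    using cs ca unfolding tan_def by (simp add: field_simps)
  have c: "eq_cos k s \<theta> * cos \<alpha> = cos s * cos (\<theta> - \<alpha>)" for \<theta>
    unfolding eq_cos_def cos_diff using sa by algebra
  have d: "eq_sin k s \<theta> * cos \<alpha> = cos s * sin (\<theta> - \<alpha>)" for \<theta>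
    unfolding eq_sin_def sin_diff using sa by algebra
  show ?thesis
  proof (rule that[of "\<alpha> + pi/2"])
    show "0 < \<alpha> + pi/2" "\<alpha> + pi/2 < pi" using a by auto
    show "eq_cos k s (\<alpha> + pi/2) = 0" using c[of "\<alpha> + pi/2"] ca by simp
    have "eq_sin k s (\<alpha> + pi/2) * cos \<alpha> \<ge> 0" using d[of "\<alpha> + pi/2"] cs by simp
    then show "eq_sin k s (\<alpha> + pi/2) \<ge> 0" using ca by (simp add: zero_le_mult_iff)
  next
    fix \<theta> assume "0 \<le> \<theta>" "\<theta> \<le> \<alpha> + pi/2"
    then have "cos (\<theta> - \<alpha>) \<ge> 0" using a by (intro cos_ge_zero) auto
    then have "eq_cos k s \<theta> * cos \<alpha> \<ge> 0" unfolding c using cs by simp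
    then show "eq_cos k s \<theta> \<ge> 0" using ca by (simp add: zero_le_mult_iff)
  next
    fix \<theta> assume t: "\<alpha> + pi/2 \<le> \<theta>" "\<theta> \<le> pi"
    have "cos (\<theta> - \<alpha> - pi) \<ge> 0" using a t by (intro cos_ge_zero) auto
    then have "cos (\<theta> - \<alpha>) \<le> 0" by (simp add: cos_diff)
    then have "eq_cos k s \<theta> * cos \<alpha> \<le> 0" unfolding c using cs by (simp add: mult_le_0_iff)
    then show "eq_cos k s \<theta> \<le> 0" using ca by (simp add: mult_le_0_iff)
  qed
qed

lemma has_integral_kernel:
  assumes k: "\<bar>k\<bar> < 1" and s: "0 < s" "s < pi/2" and t: "0 \<le> \<theta>" "\<theta> \<le> pi"
  shows "((\<lambda>t. kernel (eq_cos k s t) (height_sq k s)) has_integral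
           geo_cdf k s \<theta>) {0..\<theta>}"
proof -
  have sp: "s < pi" using s by simp
  obtain \<theta>0 where z: "0 < \<theta>0" "\<theta>0 < pi" "eq_cos k s \<theta>0 = 0" "eq_sin k s \<theta>0 \<ge> 0"
    and pos: "\<And>\<theta>. 0 \<le> \<theta> \<Longrightarrow> \<theta> \<le> \<theta>0 \<Longrightarrow> eq_cos k s \<theta> \<ge> 0"
    and neg: "\<And>\<theta>. \<theta>0 \<le> \<theta> \<Longrightarrow> \<theta> \<le> pi \<Longrightarrow> eq_cos k s \<theta> \<le> 0"
    using eq_cos_zero[OF s] by metis
  have I1: "((\<lambda>t. kernel (eq_cos k s t) (height_sq k s)) has_integral cdf_near k s x) {0..x}" if "0 \<le> x" "x \<le> \<theta>0" for x
  proof -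
    have "((\<lambda>t. kernel (eq_cos k s t) (height_sq k s)) has_integral cdf_near k s x - cdf_near k s 0) {0..x}"
    proof (rule fundamental_theorem_of_calculus[OF that(1)])
      fix y assume "y \<in> {0..x}"
      then show "(cdf_near k s has_vector_derivative kernel (eq_cos k s y) (height_sq k s)) (at y within {0..x})"
        using cdf_near_deriv[OF k s(1) sp pos] that
        by (auto simp flip: has_real_derivative_iff_has_vector_derivative intro: has_field_derivative_at_within)
    qed
    then show ?thesis using cdf_near_0[OF s(1) sp] by simp
  qed
  show ?thesis
  proof (cases "\<theta> \<le> \<theta>0")
    case True
    then show ?thesis using I1[OF t(1)] pos t by (simp add: geo_cdf_def)
  next
    case False
    have "((\<lambda>t. kernel (eq_cos k s t) (height_sq k s)) has_integral cdf_far k s \<theta> - cdf_far k s \<theta>0) {\<theta>0..\<theta>}"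
    proof (rule fundamental_theorem_of_calculus)
      show "\<theta>0 \<le> \<theta>" using False by simp
      fix y assume "y \<in> {\<theta>0..\<theta>}"
      then show "(cdf_far k s has_vector_derivative kernel (eq_cos k s y) (height_sq k s)) (at y within {\<theta>0..\<theta>})"
        using cdf_far_deriv[OF neg] t
        by (auto simp flip: has_real_derivative_iff_has_vector_derivative intro: has_field_derivative_at_within)
    qed
    from has_integral_combine[OF _ _ I1[of \<theta>0] this] have
      I: "((\<lambda>t. kernel (eq_cos k s t) (height_sq k s)) has_integral cdf_far k s \<theta>) {0..\<theta>}"
      using z False cdf_near_eq_cdf_far[OF z(3,4)] by simp
    show ?thesis
    proof (cases "eq_cos k s \<theta> \<ge> 0")
      case True
      then have c0: "eq_cos k s \<theta> = 0" using neg[of \<theta>] False t by simp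
      have "cdf_near k s \<theta> = cdf_far k s \<theta>" by (rule cdf_near_eq_cdf_far'[OF s t c0])
      then show ?thesis using I c0 by (simp add: geo_cdf_def)
    qed (use I in \<open>simp add: geo_cdf_def\<close>)
  qed
qed

section \<open>Monotonicity along great circles\<close>

lemma concave_on_sin: "concave_on {0..pi} sin"
  by (rule f''_le0_imp_concave[where f' = cos and f'' = "\<lambda>x. - sin x"])
    (auto intro!: derivative_eq_intros sin_ge_zero)

lemma jordan_sin:
  assumes "0 \<le> x" "x \<le> pi / 2"
  shows "2 * x \<le> pi * sin x"
proof -
  have "sin ((1 - 2 * x / pi) *\<^sub>R 0 + (2 * x / pi) *\<^sub>R (pi / 2)) \<ge>
      (1 - 2 * x / pi) * sin 0 + (2 * x / pi) * sin (pi / 2)"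
    by (rule concave_onD[OF concave_on_sin]) (use assms in \<open>auto simp: field_simps\<close>)
  then show ?thesis by (simp add: field_simps)
qed

text \<open>Here \<open>a\<close> stands for \<open>cos t / sqrt (1 - height_sq k t)\<close>. Up to
  \<open>pi / 2\<close> Jordan's inequality leaves a slack of at least \<theta>. Beyond,
  \<open>pi * sin \<theta>\<close> tends to zero and \<open>a \<le> 1\<close> no longer suffices;
  \<open>a \<le> sin \<theta>\<close> leaves \<open>(pi - \<theta>) * sin \<theta>\<close>.\<close>

lemma sin_slack:
  assumes h: "0 \<le> h" "h \<le> \<theta>" "\<theta> \<le> pi - h" and a: "0 \<le> a" "a \<le> 1" "\<theta> > pi / 2 \<Longrightarrow> a \<le> sin \<theta>"
  shows "h * sin h \<le> pi * sin \<theta> - \<theta> * a"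
proof (cases "\<theta> \<le> pi / 2")
  case True
  have "h * sin h \<le> h * 1" using h by (intro mult_left_mono) auto
  moreover have "\<theta> * a \<le> \<theta> * 1" using a h by (intro mult_left_mono) auto
  moreover have "2 * \<theta> \<le> pi * sin \<theta>" using True h by (intro jordan_sin) auto
  ultimately show ?thesis using h by linarith
next
  case False
  have "sin h \<le> sin (pi - \<theta>)"
    using h False by (intro sin_monotone_2pi_le) auto
  then have "h * sin h \<le> (pi - \<theta>) * sin \<theta>"
    using h by (intro mult_mono) (auto intro: sin_ge_zero)
  also have "\<dots> = pi * sin \<theta> - \<theta> * sin \<theta>" by (simp add: algebra_simps)
  also have "\<dots> \<le> pi * sin \<theta> - \<theta> * a"
    using a(3) False h by (intro diff_left_mono mult_left_mono) auto
  finally show ?thesis .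
qed

lemma one_minus_height_sq: "1 - height_sq k s = (cos s)\<^sup>2 + k\<^sup>2 * (sin s)\<^sup>2"
  unfolding height_sq_def cos_squared_eq by (simp add: algebra_simps)

lemma sqrt_height_sq_deriv:
  assumes "cos t > 0"
  shows "((\<lambda>t. sqrt (1 - height_sq k t)) has_real_derivative - ((1 - k\<^sup>2) * sin t * cos t / sqrt (1 - height_sq k t))) (at t)"
proof -
  have w: "1 - height_sq k t > 0" unfolding one_minus_height_sq using assms by (simp add: add_pos_nonneg)
  show ?thesis
    using w unfolding height_sq_def
    by (auto intro!: derivative_eq_intros simp: field_simps)
qed

text \<open>The two terms have opposite signs: the uniform summand gains mass as \<open>p\<close>
  rises, while the first summand moves away from \<open>a\<close>. The estimates below show that the
  second effect wins.\<close>

lemma cdf_near_deriv_s: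
  assumes k: "\<bar>k\<bar> < 1" and s: "0 < t" "t < pi / 2"
  shows "((\<lambda>t. cdf_near k t \<theta>) has_real_derivative
     (1 - k\<^sup>2) * sin t / (2 * pi) * (\<theta> * (cos t / sqrt (1 - height_sq k t)) - pi * sin \<theta> / sqrt (1 - (eq_cos k t \<theta>)\<^sup>2) ^ 3)) (at t)"
proof -
  have c: "cos t > 0" using s by (simp add: cos_gt_zero_pi)
  have t: "t < pi" using s by simp
  note h = DERIV_add[OF DERIV_cdivide[OF DERIV_add[OF eq_sin_over_deriv_s[OF k s(1) t, of \<theta>] DERIV_const[of k]], of 2]
      DERIV_cdivide[OF DERIV_cmult_right[OF DERIV_diff[OF DERIV_const[of 1] sqrt_height_sq_deriv[OF c, of k]], of \<theta>], of "2 * pi"]]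
  show ?thesis unfolding cdf_near_def[abs_def]
    by (rule DERIV_cong[OF h]) (simp add: algebra_simps add_divide_distrib diff_divide_distrib)
qed

lemma cdf_far_deriv_s:
  assumes "cos t > 0"
  shows "((\<lambda>t. cdf_far k t \<theta>) has_real_derivative
     - ((1 - k\<^sup>2) * sin t / (2 * pi) * ((pi - \<theta>) * (cos t / sqrt (1 - height_sq k t))))) (at t)"
proof -
  note h = DERIV_diff[OF DERIV_const[of "(1 + k) / 2"]
      DERIV_cdivide[OF DERIV_cmult_right[OF DERIV_diff[OF DERIV_const[of 1] sqrt_height_sq_deriv[OF assms, of k]], of "pi - \<theta>"], of "2 * pi"]]
  show ?thesis unfolding cdf_far_def[abs_def]
    by (rule DERIV_cong[OF h]) (simp add: field_simps)
qed

lemma cos_over_sqrt_height_sq: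
  assumes "cos t > 0" "k\<^sup>2 \<le> 1"
  shows "cos t \<le> cos t / sqrt (1 - height_sq k t)" "cos t / sqrt (1 - height_sq k t) \<le> 1" "0 \<le> cos t / sqrt (1 - height_sq k t)"
proof -
  have w: "1 - height_sq k t > 0" unfolding one_minus_height_sq using assms(1) by (simp add: add_pos_nonneg)
  show "cos t / sqrt (1 - height_sq k t) \<le> 1"
    using assms(1) w by (simp add: one_minus_height_sq real_le_rsqrt)
  show "0 \<le> cos t / sqrt (1 - height_sq k t)" using assms(1) w by simp
  have "height_sq k t \<ge> 0" unfolding height_sq_def using assms(2) by simp
  then have "sqrt (1 - height_sq k t) \<le> 1" by simp
  then show "cos t \<le> cos t / sqrt (1 - height_sq k t)" using w assms(1) by (simp add: field_simps mult_left_le)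
qed

text \<open>Beyond \<open>pi / 2\<close> the condition on \<open>eq_cos\<close> reads
  \<open>- cos \<theta> * cos t \<le> k * sin t * sin \<theta>\<close>. Squaring and adding
  \<open>(sin \<theta> * cos t)\<^sup>2\<close> to both sides gives the claim. It provides the third
  hypothesis on \<open>a\<close> in \<open>sin_slack\<close>.\<close>

lemma cos_over_sqrt_height_sq_le_sin:
  assumes "cos t > 0" "0 \<le> \<theta>" "\<theta> \<le> pi" "\<theta> > pi / 2" and c: "eq_cos k t \<theta> \<ge> 0"
  shows "cos t / sqrt (1 - height_sq k t) \<le> sin \<theta>"
proof -
  have w: "1 - height_sq k t > 0" unfolding one_minus_height_sq using assms(1) by (simp add: add_pos_nonneg)
  have sn: "sin \<theta> \<ge> 0" using assms by (simp add: sin_ge_zero)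
  have "cos (pi - \<theta>) \<ge> 0" using assms by (intro cos_ge_zero) auto
  then have "0 \<le> cos (pi - \<theta>) * cos t" using assms(1) by (intro mult_nonneg_nonneg) auto
  then have "(cos (pi - \<theta>) * cos t)\<^sup>2 \<le> (k * sin t * sin \<theta>)\<^sup>2"
    using c by (intro power_mono) (auto simp: eq_cos_def algebra_simps)
  then have "(cos \<theta>)\<^sup>2 * (cos t)\<^sup>2 \<le> (sin \<theta>)\<^sup>2 * (k\<^sup>2 * (sin t)\<^sup>2)"
    by (simp add: power_mult_distrib mult_ac)
  then have "(cos \<theta>)\<^sup>2 * (cos t)\<^sup>2 + (sin \<theta>)\<^sup>2 * (cos t)\<^sup>2 \<le> (sin \<theta>)\<^sup>2 * (1 - height_sq k t)"
    unfolding one_minus_height_sq distrib_left by simp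
  moreover have "(cos \<theta>)\<^sup>2 * (cos t)\<^sup>2 + (sin \<theta>)\<^sup>2 * (cos t)\<^sup>2 = (cos t)\<^sup>2"
    using sin_cos_squared_add[of \<theta>] by algebra
  ultimately have "(cos t)\<^sup>2 \<le> (sin \<theta> * sqrt (1 - height_sq k t))\<^sup>2"
    using w by (simp add: power_mult_distrib)
  then have "cos t \<le> sin \<theta> * sqrt (1 - height_sq k t)"
    by (rule power2_le_imp_le) (use sn w in simp)
  then show ?thesis using w by (simp add: field_simps)
qed

text \<open>\<kappa> is a rate at which the mass of the arc up to \<theta> decreases, uniform for
  \<open>t\<close> between \<open>s\<close> and \<open>s'\<close> and for \<theta> at distance at
  least \<open>h\<close> from both ends. For \<open>h = 0\<close> it is zero and the results are
  plain monotonicity; a positive \<open>h\<close> later yields strict contraction.\<close>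

context
  fixes k s s' h \<theta> \<kappa> :: real
  assumes k: "\<bar>k\<bar> < 1" and s: "0 < s" "s' < pi / 2"
    and h: "0 \<le> h" "h \<le> \<theta>" "\<theta> \<le> pi - h"
  defines "\<kappa> \<equiv> (1 - k\<^sup>2) * sin s / (2 * pi) * (cos s' * (h * sin h))"
begin

lemma one_minus_sq: "k\<^sup>2 \<le> 1" "0 < 1 - k\<^sup>2"
  using k abs_square_less_1[of k] by auto

lemma coeff_mono:
  assumes "s \<le> t" "t \<le> s'" "cos s' * (h * sin h) \<le> b"
  shows "\<kappa> \<le> (1 - k\<^sup>2) * sin t / (2 * pi) * b"
proof -
  have "sin s \<le> sin t" "cos s' \<ge> 0" "sin h \<ge> 0"
    using assms s h by (auto intro!: sin_monotone_2pi_le cos_ge_zero sin_ge_zero)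
  moreover have "sin s \<ge> 0" using assms s by (intro sin_ge_zero) auto
  ultimately show ?thesis unfolding \<kappa>_def
    using assms one_minus_sq h by (intro mult_mono divide_right_mono mult_left_mono) auto
qed

lemma cdf_near_mono_s:
  assumes a: "s \<le> a" "a \<le> b" "b \<le> s'" and c: "\<And>t. a \<le> t \<Longrightarrow> t \<le> b \<Longrightarrow> eq_cos k t \<theta> \<ge> 0"
  shows "cdf_near k b \<theta> + \<kappa> * (b - a) \<le> cdf_near k a \<theta>"
proof -
  have "cdf_near k b \<theta> + \<kappa> * b \<le> cdf_near k a \<theta> + \<kappa> * a"
  proof (rule DERIV_nonpos_imp_nonincreasing[OF a(2), where f = "\<lambda>t. cdf_near k t \<theta> + \<kappa> * t"])
    fix t assume t: "a \<le> t" "t \<le> b"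
    then have t': "0 < t" "t < pi / 2" using a s by auto
    then have ct: "cos t > 0" by (simp add: cos_gt_zero_pi)
    let ?A = "cos t / sqrt (1 - height_sq k t)" and ?r = "sqrt (1 - (eq_cos k t \<theta>)\<^sup>2)"
    have r: "?r > 0" "?r \<le> 1" using eq_cos_sq_less[OF k, of t \<theta>] t' by auto
    then have r3: "?r ^ 3 \<le> 1" "?r ^ 3 > 0" by (auto simp: power_le_one)
    have sn: "sin \<theta> \<ge> 0" "sin h \<ge> 0" using h by (auto intro!: sin_ge_zero)
    have "cos s' * (h * sin h) \<le> 1 * (h * sin h)"
      using h sn by (intro mult_right_mono) auto
    also have "1 * (h * sin h) \<le> pi * sin \<theta> - \<theta> * ?A"
      unfolding mult_1
      by (rule sin_slack[OF h])
        (use cos_over_sqrt_height_sq[OF ct one_minus_sq(1)] cos_over_sqrt_height_sq_le_sin[OF ct _ _ _ c[OF t]] h in auto)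
    also have "\<dots> \<le> pi * sin \<theta> / ?r ^ 3 - \<theta> * ?A"
      using r3 sn by (simp add: field_simps mult_left_le)
    finally have "\<kappa> \<le> (1 - k\<^sup>2) * sin t / (2 * pi) * (pi * sin \<theta> / ?r ^ 3 - \<theta> * ?A)"
      using t a by (intro coeff_mono) auto
    then have le: "(1 - k\<^sup>2) * sin t / (2 * pi) * (\<theta> * ?A - pi * sin \<theta> / ?r ^ 3) + \<kappa> * 1 \<le> 0"
      unfolding right_diff_distrib by linarith
    have "((\<lambda>t. cdf_near k t \<theta> + \<kappa> * t) has_real_derivative
        (1 - k\<^sup>2) * sin t / (2 * pi) * (\<theta> * ?A - pi * sin \<theta> / ?r ^ 3) + \<kappa> * 1) (at t)"
      by (rule DERIV_add[OF cdf_near_deriv_s[OF k t'] DERIV_cmult[OF DERIV_ident]])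
    with le show "\<exists>y. ((\<lambda>t. cdf_near k t \<theta> + \<kappa> * t) has_real_derivative y) (at t) \<and> y \<le> 0" by blast
  qed
  then show ?thesis by (simp add: algebra_simps)
qed

lemma cdf_far_mono_s:
  assumes a: "s \<le> a" "a \<le> b" "b \<le> s'"
  shows "cdf_far k b \<theta> + \<kappa> * (b - a) \<le> cdf_far k a \<theta>"
proof -
  have "cdf_far k b \<theta> + \<kappa> * b \<le> cdf_far k a \<theta> + \<kappa> * a"
  proof (rule DERIV_nonpos_imp_nonincreasing[OF a(2), where f = "\<lambda>t. cdf_far k t \<theta> + \<kappa> * t"])
    fix t assume t: "a \<le> t" "t \<le> b"
    then have t': "0 < t" "t < pi / 2" using a s by auto
    then have ct: "cos t > 0" by (simp add: cos_gt_zero_pi)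
    let ?A = "cos t / sqrt (1 - height_sq k t)"
    have sn: "sin h \<ge> 0" using h by (auto intro!: sin_ge_zero)
    have cs: "cos s' \<ge> 0" "cos s' \<le> cos t" using t a t' s by (auto intro!: cos_ge_zero cos_monotone_0_pi_le)
    have "cos s' * (h * sin h) \<le> ?A * (h * 1)"
      using cos_over_sqrt_height_sq[OF ct one_minus_sq(1)] cs h sn by (intro mult_mono) auto
    also have "\<dots> \<le> (pi - \<theta>) * ?A"
      using mult_right_mono[OF _ cos_over_sqrt_height_sq(3)[OF ct one_minus_sq(1)], of h "pi - \<theta>"] h by (simp add: mult.commute)
    finally have "\<kappa> \<le> (1 - k\<^sup>2) * sin t / (2 * pi) * ((pi - \<theta>) * ?A)"
      using t a by (intro coeff_mono) auto
    then have le: "- ((1 - k\<^sup>2) * sin t / (2 * pi) * ((pi - \<theta>) * ?A)) + \<kappa> * 1 \<le> 0" by simp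
    have "((\<lambda>t. cdf_far k t \<theta> + \<kappa> * t) has_real_derivative
        - ((1 - k\<^sup>2) * sin t / (2 * pi) * ((pi - \<theta>) * ?A)) + \<kappa> * 1) (at t)"
      by (rule DERIV_add[OF cdf_far_deriv_s[OF ct] DERIV_cmult[OF DERIV_ident]])
    with le show "\<exists>y. ((\<lambda>t. cdf_far k t \<theta> + \<kappa> * t) has_real_derivative y) (at t) \<and> y \<le> 0" by blast
  qed
  then show ?thesis by (simp add: algebra_simps)
qed

end

text \<open>In \<open>s\<close>, \<open>eq_cos\<close> is a sinusoid of period
  \<open>2 * pi\<close>, so its value at \<open>t\<close> is a combination of the values at
  \<open>a\<close> and \<open>b\<close> with coefficients \<open>sin (b - t)\<close> and
  \<open>sin (t - a)\<close>, up to the factor \<open>sin (b - a)\<close>.\<close>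

lemma eq_cos_between:
  assumes "eq_cos k a \<theta> \<ge> 0" "eq_cos k b \<theta> \<ge> 0" "a \<le> t" "t \<le> b" "b - a < pi"
  shows "eq_cos k t \<theta> \<ge> 0"
proof (cases "a = b")
  case False
  then have ab: "sin (b - a) > 0" using assms by (intro sin_gt_zero) auto
  have "eq_cos k t \<theta> * sin (b - a) = eq_cos k a \<theta> * sin (b - t) + eq_cos k b \<theta> * sin (t - a)"
    unfolding eq_cos_def sin_diff by (simp add: algebra_simps)
  also have "\<dots> \<ge> 0" using assms by (intro add_nonneg_nonneg mult_nonneg_nonneg sin_ge_zero) auto
  finally show ?thesis using ab by (simp add: zero_le_mult_iff)
qed (use assms in simp)

text \<open>For fixed \<theta> the sign of \<open>eq_cos\<close> may change in either direction as
  \<open>s\<close> grows. At a zero the two formulas for the mass agree, so the decrements before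
  and after it add up. The estimate for \<open>cdf_far\<close> holds whatever the sign; only the
  \<open>cdf_near\<close> part needs \<open>eq_cos_between\<close>.\<close>

lemma geo_cdf_mono_s:
  assumes k: "\<bar>k\<bar> < 1" and s: "0 < s" "s \<le> s'" "s' < pi / 2" and h: "0 \<le> h" "h \<le> \<theta>" "\<theta> \<le> pi - h"
  shows "geo_cdf k s' \<theta> + (1 - k\<^sup>2) * sin s / (2 * pi) * (cos s' * (h * sin h)) * (s' - s) \<le> geo_cdf k s \<theta>"
proof -
  define K where "K = (1 - k\<^sup>2) * sin s / (2 * pi) * (cos s' * (h * sin h))"
  note m1 = cdf_near_mono_s[OF k s(1,3) h, folded K_def] and m2 = cdf_far_mono_s[OF k s(1,3) h, folded K_def]
  have cont: "continuous_on S (\<lambda>t. eq_cos k t \<theta>)" for S unfolding eq_cos_def by (intro continuous_intros)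
  have eq: "cdf_near k t \<theta> = cdf_far k t \<theta>" if "s \<le> t" "t \<le> s'" "eq_cos k t \<theta> = 0" for t
    by (rule cdf_near_eq_cdf_far') (use that s h in auto)
  consider (pp) "eq_cos k s \<theta> \<ge> 0" "eq_cos k s' \<theta> \<ge> 0" | (nn) "eq_cos k s \<theta> < 0" "eq_cos k s' \<theta> < 0"
    | (pn) "eq_cos k s \<theta> \<ge> 0" "eq_cos k s' \<theta> < 0" | (np) "eq_cos k s \<theta> < 0" "eq_cos k s' \<theta> \<ge> 0" by linarith
  then show ?thesis
  proof cases
    case pp
    then show ?thesis unfolding geo_cdf_def K_def[symmetric]
      using m1[of s s'] s eq_cos_between[OF pp, of _] by (auto simp: mult_ac)
  next
    case nn
    then show ?thesis unfolding geo_cdf_def K_def[symmetric] using m2[of s s'] s by (auto simp: mult_ac)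
  next
    case pn
    obtain t where t: "s \<le> t" "t \<le> s'" "eq_cos k t \<theta> = 0"
      using IVT2'[OF less_imp_le[OF pn(2)] pn(1) s(2) cont] by blast
    have "cdf_near k t \<theta> + K * (t - s) \<le> cdf_near k s \<theta>"
    proof (rule m1)
      show "eq_cos k u \<theta> \<ge> 0" if "s \<le> u" "u \<le> t" for u
        by (rule eq_cos_between[OF pn(1) _ that]) (use t s in linarith)+
    qed (use t in auto)
    moreover have "cdf_far k s' \<theta> + K * (s' - t) \<le> cdf_far k t \<theta>"
      by (rule m2) (use t in auto)
    ultimately show ?thesis unfolding geo_cdf_def K_def[symmetric] using pn eq[OF t] by (simp add: algebra_simps)
  next
    case np
    obtain t where t: "s \<le> t" "t \<le> s'" "eq_cos k t \<theta> = 0"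
      using IVT'[of "\<lambda>t. eq_cos k t \<theta>", OF less_imp_le[OF np(1)] np(2) s(2) cont] by blast
    have "cdf_near k s' \<theta> + K * (s' - t) \<le> cdf_near k t \<theta>"
    proof (rule m1)
      show "eq_cos k u \<theta> \<ge> 0" if "t \<le> u" "u \<le> s'" for u
        by (rule eq_cos_between[OF _ np(2) that]) (use t s in linarith)+
    qed (use t in auto)
    moreover have "cdf_far k t \<theta> + K * (t - s) \<le> cdf_far k s \<theta>"
      by (rule m2) (use t in auto)
    ultimately show ?thesis unfolding geo_cdf_def K_def[symmetric] using np eq[OF t] by (simp add: algebra_simps)
  qed
qed

section \<open>Transport cost\<close>

abbreviation geo_dens :: "real \<Rightarrow> real \<Rightarrow> real \<Rightarrow> real" where
  "geo_dens k s t \<equiv> kernel (eq_cos k s t) (height_sq k s)"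

lemma height_sq_minus [simp]: "height_sq (- k) s = height_sq k s"
  by (simp add: height_sq_def)

lemma eq_cos_minus: "eq_cos (- k) s t = - eq_cos k s (pi - t)"
  by (simp add: eq_cos_def)

lemma kernel_minus: "kernel (- c) y = kernel c y - c * y / (2 * sqrt (1 - c\<^sup>2) ^ 3)"
  by (auto simp: kernel_def max_def)

lemma geo_cdf_pi:
  assumes "0 < s" "s < pi/2"
  shows "geo_cdf k s pi = (1 + k) / 2"
  using cos_gt_zero_pi[of s] assms by (simp add: geo_cdf_def eq_cos_def)

lemma has_integral_reflect_Icc:
  fixes f :: "real \<Rightarrow> 'a::real_normed_vector"
  shows "((\<lambda>t. f (a + b - t)) has_integral I) {a..b} \<longleftrightarrow> (f has_integral I) {a..b}"
  using has_integral_shift_real_ivl_iff[of "\<lambda>t. f (a + b - t)" I a b "a + b"]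
    has_integral_reflect_real[of f I a b] by simp

text \<open>Reflecting the second arc turns \<open>geo_dens (- k)\<close> into
  \<open>geo_dens k\<close> minus half the second derivative \<open>o'\<close> of the distance. The
  sum becomes \<open>pi\<close> times the mass \<open>(1 + k) / 2\<close> minus half the integral of
  \<open>(pi - t) * o' t\<close>, and the latter is found by integrating by parts down to the
  distances \<open>s\<close> and \<open>pi - s\<close> at the two ends.\<close>

lemma tent_integral:
  assumes k: "\<bar>k\<bar> < 1" and s: "0 < s" "s < pi/2"
  shows "integral {0..pi} (\<lambda>t. t * geo_dens k s t) + integral {0..pi} (\<lambda>t. t * geo_dens (- k) s t) = s"
proof -
  have sp: "s < pi" using s by simp
  have snz: "sin s > 0" using s by (simp add: sin_gt_zero)
  define q where "q t = eq_sin k s t / sqrt (1 - (eq_cos k s t)\<^sup>2)" for t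
  define o' where "o' t = eq_cos k s t * height_sq k s / sqrt (1 - (eq_cos k s t)\<^sup>2) ^ 3" for t
  have q0: "q 0 = - k"
  proof -
    have "1 - (cos s)\<^sup>2 = (sin s)\<^sup>2" by (simp add: sin_squared_eq)
    then show ?thesis using snz by (simp add: q_def eq_sin_def eq_cos_def)
  qed
  have dq: "(q has_vector_derivative o' t) (at t)" for t
    unfolding q_def o'_def has_real_derivative_iff_has_vector_derivative[symmetric]
    by (rule eq_sin_over_deriv[OF k s(1) sp])
  have dw: "((\<lambda>t. arccos (eq_cos k s t)) has_vector_derivative q t) (at t)" for t
    unfolding q_def has_real_derivative_iff_has_vector_derivative[symmetric]
    by (rule arccos_eq_cos_deriv[OF k s(1) sp])
  have cq: "continuous_on {0..pi} q"
    using dq by (intro continuous_at_imp_continuous_on ballI) (auto intro: has_vector_derivative_continuous)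
  have "(q has_integral arccos (eq_cos k s pi) - arccos (eq_cos k s 0)) {0..pi}"
    by (rule fundamental_theorem_of_calculus) (auto intro: dw has_vector_derivative_at_within)
  moreover have "arccos (eq_cos k s 0) = s" "arccos (eq_cos k s pi) = pi - s"
    using s arccos_cos[of s] arccos_cos[of "pi - s"] by (simp_all add: eq_cos_def)
  ultimately have iq: "(q has_integral pi - 2 * s) {0..pi}" by simp
  have "((\<lambda>t. o' t * (pi - t)) has_integral (pi * k + (pi - 2 * s))) {0..pi}"
  proof (rule integration_by_parts[OF bounded_bilinear_mult, where f = q and g' = "\<lambda>t. -1"])
    show "((\<lambda>t. q t * - 1) has_integral q pi * (pi - pi) - q 0 * (pi - 0) - (pi * k + (pi - 2 * s))) {0..pi}"
      using has_integral_neg[OF iq] q0 by (simp add: algebra_simps)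
  qed (use cq dq in \<open>auto intro!: continuous_intros derivative_eq_intros simp: has_real_derivative_iff_has_vector_derivative[symmetric]\<close>)
  then have "((\<lambda>t. (pi - t) * o' t) has_integral (pi * k + (pi - 2 * s))) {0..pi}"
    by (simp only: mult.commute)
  then have iO: "((\<lambda>t. (pi - t) * (o' t / 2)) has_integral (pi * k + (pi - 2 * s)) / 2) {0..pi}"
    using has_integral_mult_right[of "\<lambda>t. (pi - t) * o' t" _ _ "1/2"] by simp
  have ck: "continuous_on S (geo_dens j s)" if "\<bar>j\<bar> < 1" for j S
    by (rule continuous_on_kernel_eq_cos[OF that s(1) sp])
  have ik: "(geo_dens k s has_integral (1 + k) / 2) {0..pi}"
    using has_integral_kernel[OF k s, of pi] by (simp add: geo_cdf_pi[OF s])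
  have it: "((\<lambda>t. t * geo_dens k s t) has_integral integral {0..pi} (\<lambda>t. t * geo_dens k s t)) {0..pi}"
    by (intro integrable_integral integrable_continuous_real continuous_intros ck k)
  have "((\<lambda>t. pi * geo_dens k s t - t * geo_dens k s t - (pi - t) * (o' t / 2)) has_integral
      pi * ((1 + k) / 2) - integral {0..pi} (\<lambda>t. t * geo_dens k s t) - (pi * k + (pi - 2 * s)) / 2) {0..pi}"
    by (intro has_integral_diff has_integral_mult_right ik it iO)
  \<comment> \<open>The antipode of the point at \<open>t\<close> on the first arc is the point at
    distance \<open>pi - t\<close> from \<open>a\<close> on the second one, and
    \<open>eq_cos\<close> changes sign there.\<close>
  also have "(\<lambda>t. pi * geo_dens k s t - t * geo_dens k s t - (pi - t) * (o' t / 2)) = (\<lambda>t. (0 + pi - t) * geo_dens (- k) s (0 + pi - t))"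
    by (auto simp: eq_cos_minus kernel_minus o'_def algebra_simps)
  finally have "((\<lambda>t. (0 + pi - t) * geo_dens (- k) s (0 + pi - t)) has_integral
      s - integral {0..pi} (\<lambda>t. t * geo_dens k s t)) {0..pi}"
    by (rule has_integral_eq_rhs) (simp add: field_simps)
  then have "((\<lambda>t. t * geo_dens (- k) s t) has_integral s - integral {0..pi} (\<lambda>t. t * geo_dens k s t)) {0..pi}"
    by (rule has_integral_reflect_Icc[of "\<lambda>t. t * geo_dens (- k) s t" 0 pi, THEN iffD1])
  then show ?thesis by (simp add: integral_unique)
qed

text \<open>Averaging makes \<open>g\<close> differentiable with derivative of norm at most one, which
  allows integration by parts without any differentiability of \<open>g\<close>.\<close>

lemma norm_integral_lipschitz_le:
  fixes g :: "real \<Rightarrow> 'a::banach"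
  assumes g: "1-lipschitz_on UNIV g" and \<phi>: "continuous_on {0..b} \<phi>" and b: "0 \<le> b"
    and \<Phi>: "\<And>t. t \<in> {0..b} \<Longrightarrow> (\<phi> has_integral \<Phi> t) {0..t}" "\<Phi> b = 0" "\<And>t. t \<in> {0..b} \<Longrightarrow> \<Phi> t \<ge> 0"
    and xy: "0 \<le> x" "x \<le> y" "y \<le> b" "0 \<le> \<kappa>" "\<And>t. t \<in> {x..y} \<Longrightarrow> \<Phi> t \<ge> \<kappa>"
  shows "norm (integral {0..b} (\<lambda>t. \<phi> t *\<^sub>R g t)) \<le>
      - integral {0..b} (\<lambda>t. t * \<phi> t) - \<kappa> * (y - x - norm (g y - g x))"
proof -
  define I where "I t = integral {0..t} g" for t
  define A where "A \<eta> t = (I (t + \<eta>) - I t) /\<^sub>R \<eta>" for \<eta> t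
  define A' where "A' \<eta> t = (g (t + \<eta>) - g t) /\<^sub>R \<eta>" for \<eta> t
  define M where "M = integral {0..b} (\<lambda>t. \<bar>\<phi> t\<bar>)"
  have gc: "continuous_on S g" for S
    using lipschitz_on_continuous_on[OF g] continuous_on_subset by blast
  have gi: "g integrable_on {u..v}" for u v by (intro integrable_continuous_real gc)
  have lip: "norm (g u - g v) \<le> \<bar>u - v\<bar>" for u v
    using lipschitz_onD[OF g, of u v] by (simp add: dist_norm)
  have dI: "(I has_vector_derivative g t) (at t)" if "t > 0" for t
  proof -
    have "(I has_vector_derivative g t) (at t within {0..t+1})"
      unfolding I_def by (rule integral_has_vector_derivative) (use gc that in auto)
    then show ?thesis using that by (simp add: at_within_Icc_at)
  qed
  have A_close: "norm (A \<eta> t - g t) \<le> \<eta>" if "0 < \<eta>" "0 \<le> t" for \<eta> t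
  proof -
    have e: "I t + integral {t..t + \<eta>} g = I (t + \<eta>)"
      unfolding I_def by (rule Henstock_Kurzweil_Integration.integral_combine) (use that gi in auto)
    then have "I (t + \<eta>) - I t - \<eta> *\<^sub>R g t = integral {t..t + \<eta>} (\<lambda>u. g u - g t)"
      using that by (subst integral_diff) (auto intro: gi simp flip: e)
    also have "norm \<dots> \<le> \<eta> * (t + \<eta> - t)"
    proof (rule integral_bound)
      show "norm (g u - g t) \<le> \<eta>" if "u \<in> {t..t + \<eta>}" for u using lip[of u t] that by auto
    qed (use that gc in \<open>auto intro!: continuous_intros\<close>)
    finally have "norm ((I (t + \<eta>) - I t - \<eta> *\<^sub>R g t) /\<^sub>R \<eta>) \<le> \<eta>"
      unfolding norm_scaleR using that by (simp add: field_simps)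
    moreover have "(I (t + \<eta>) - I t - \<eta> *\<^sub>R g t) /\<^sub>R \<eta> = A \<eta> t - g t"
      using that by (simp add: A_def scaleR_diff_right)
    ultimately show ?thesis by simp
  qed
  have \<Phi>_int: "\<Phi> t = integral {0..t} \<phi>" if "t \<in> {0..b}" for t
    using \<Phi>(1)[OF that] by (simp add: integral_unique)
  have \<Phi>0: "\<Phi> 0 = 0" using \<Phi>_int[of 0] b by simp
  have \<Phi>c: "continuous_on {0..b} \<Phi>"
    using indefinite_integral_continuous_1[OF integrable_continuous_real[OF \<phi>]]
    by (subst continuous_on_cong[OF refl \<Phi>_int]) auto
  have d\<Phi>: "(\<Phi> has_vector_derivative \<phi> t) (at t)" if "t \<in> {0<..<b}" for t
  proof -
    have "((\<lambda>t. integral {0..t} \<phi>) has_vector_derivative \<phi> t) (at t within {0..b})"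
      by (rule integral_has_vector_derivative) (use \<phi> that in auto)
    then have "((\<lambda>t. integral {0..t} \<phi>) has_vector_derivative \<phi> t) (at t)"
      using that by (simp add: at_within_Icc_at)
    then show ?thesis
      by (rule has_vector_derivative_transform_within_open[where S = "{0<..<b}"])
        (use that \<Phi>_int in auto)
  qed
  \<comment> \<open>Integration by parts against the identity: the integral of \<Phi> is the
    transport cost that bounds the norm.\<close>
  have I\<Phi>: "(\<Phi> has_integral - integral {0..b} (\<lambda>t. t * \<phi> t)) {0..b}"
  proof -
    have "((\<lambda>t. 1 * \<Phi> t) has_integral - integral {0..b} (\<lambda>t. t * \<phi> t)) {0..b}"
    proof (rule integration_by_parts_interior[OF bounded_bilinear_mult b, where f = "\<lambda>t. t" and g' = \<phi>])
      show "((\<lambda>t. t * \<phi> t) has_integral b * \<Phi> b - 0 * \<Phi> 0 - - integral {0..b} (\<lambda>t. t * \<phi> t)) {0..b}"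
        using \<phi> by (auto simp: \<Phi>(2) intro!: integrable_integral integrable_continuous_real continuous_intros)
    qed (auto intro!: \<Phi>c d\<Phi> continuous_intros)
    then show ?thesis by simp
  qed
  have main: "norm (integral {0..b} (\<lambda>t. \<phi> t *\<^sub>R g t)) \<le>
      - integral {0..b} (\<lambda>t. t * \<phi> t) - \<kappa> * (y - x - norm (g y - g x)) + \<eta> * (M + 2 * \<kappa>)"
    if \<eta>: "0 < \<eta>" for \<eta>
  proof -
    have dA: "(A \<eta> has_vector_derivative A' \<eta> t) (at t)" if "t > 0" for t
    proof -
      have "((\<lambda>t. I (t + \<eta>)) has_vector_derivative 1 *\<^sub>R g (t + \<eta>)) (at t)"
        unfolding o_def[symmetric, of I "\<lambda>t. t + \<eta>"]
      proof (rule vector_diff_chain_at)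
        show "((\<lambda>t. t + \<eta>) has_vector_derivative 1) (at t)"
          by (auto intro!: derivative_eq_intros simp flip: has_real_derivative_iff_has_vector_derivative)
      qed (use dI that \<eta> in auto)
      then show ?thesis unfolding A_def[abs_def] A'_def
        by (auto intro!: derivative_eq_intros dI[OF that])
    qed
    have Ic: "continuous_on {0..b + \<eta>} I"
      unfolding I_def[abs_def] by (rule indefinite_integral_continuous_1[OF gi])
    have Ac: "continuous_on {0..b} (A \<eta>)" unfolding A_def[abs_def]
      by (intro continuous_intros continuous_on_compose2[OF Ic]) (use \<eta> in auto)
    have A'c: "continuous_on S (A' \<eta>)" for S unfolding A'_def[abs_def]
      by (intro continuous_intros continuous_on_compose2[OF gc]) auto
    have A'1: "norm (A' \<eta> t) \<le> 1" for t
      using lip[of "t + \<eta>" t] \<eta> unfolding A'_def norm_scaleR by (simp add: field_simps)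
    define J where "J = integral {0..b} (\<lambda>t. \<Phi> t *\<^sub>R A' \<eta> t)"
    have iJ: "((\<lambda>t. \<Phi> t *\<^sub>R A' \<eta> t) has_integral J) {0..b}"
      unfolding J_def by (intro integrable_integral integrable_continuous_real continuous_intros \<Phi>c A'c)
    have P: "((\<lambda>t. \<phi> t *\<^sub>R A \<eta> t) has_integral - J) {0..b}"
      by (rule integration_by_parts_interior[OF bounded_bilinear_scaleR b \<Phi>c Ac, where g' = "A' \<eta>"])
        (use iJ in \<open>auto simp: \<Phi>(2) \<Phi>0 intro!: d\<Phi> dA\<close>)
    have xyA: "((\<lambda>t. A' \<eta> t) has_integral A \<eta> y - A \<eta> x) {x..y}"
      by (rule fundamental_theorem_of_calculus_interior)
        (use xy dA in \<open>auto intro: continuous_on_subset[OF Ac]\<close>)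
    then have xyA': "((\<lambda>t. if t \<in> {x..y} then A' \<eta> t else 0) has_integral A \<eta> y - A \<eta> x) {0..b}"
      using xy by (subst has_integral_restrict) auto
    have xyc: "((\<lambda>t. if t \<in> {x..y} then \<kappa> else 0) has_integral \<kappa> * (y - x)) {0..b}"
      using xy has_integral_const_real[of \<kappa> x y] by (subst has_integral_restrict) (auto simp: mult.commute)
    have d1: "((\<lambda>t. \<Phi> t *\<^sub>R A' \<eta> t - \<kappa> *\<^sub>R (if t \<in> {x..y} then A' \<eta> t else 0))
        has_integral J - \<kappa> *\<^sub>R (A \<eta> y - A \<eta> x)) {0..b}"
      by (intro has_integral_diff has_integral_cmul iJ xyA')
    have d2: "((\<lambda>t. \<Phi> t - (if t \<in> {x..y} then \<kappa> else 0)) has_integral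
         - integral {0..b} (\<lambda>t. t * \<phi> t) - \<kappa> * (y - x)) {0..b}"
      by (intro has_integral_diff I\<Phi> xyc)
    \<comment> \<open>Removing \<kappa> from the weight on \<open>{x..y}\<close> leaves it
      nonnegative, so the bound on \<open>A'\<close> still applies. The removed part integrates
      exactly to an increment of \<open>A \<eta>\<close>, which costs about
      \<open>\<kappa> * norm (g y - g x)\<close> in place of
      \<open>\<kappa> * (y - x)\<close>.\<close>
    have "norm (J - \<kappa> *\<^sub>R (A \<eta> y - A \<eta> x)) \<le> - integral {0..b} (\<lambda>t. t * \<phi> t) - \<kappa> * (y - x)"
      unfolding integral_unique[OF d1, symmetric] integral_unique[OF d2, symmetric]
    proof (rule integral_norm_bound_integral)
      fix t assume t: "t \<in> {0..b}"
      have "norm (c *\<^sub>R A' \<eta> t) \<le> c" if "c \<ge> 0" for c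
        using that A'1[of t] by (simp add: mult_left_le)
      then show "norm (\<Phi> t *\<^sub>R A' \<eta> t - \<kappa> *\<^sub>R (if t \<in> {x..y} then A' \<eta> t else 0)) \<le>
          \<Phi> t - (if t \<in> {x..y} then \<kappa> else 0)"
        using \<Phi>(3)[OF t] xy(5)[of t] by (auto simp: scaleR_diff_left[symmetric])
    qed (use d1 d2 in auto)
    moreover have "norm J \<le> norm (J - \<kappa> *\<^sub>R (A \<eta> y - A \<eta> x)) + norm (\<kappa> *\<^sub>R (A \<eta> y - A \<eta> x))"
      using norm_triangle_sub[of J "\<kappa> *\<^sub>R (A \<eta> y - A \<eta> x)"] by simp
    moreover have "norm (A \<eta> y - A \<eta> x) \<le> norm (g y - g x) + 2 * \<eta>"
    proof -
      have "A \<eta> y - A \<eta> x = (g y - g x) + ((A \<eta> y - g y) - (A \<eta> x - g x))" by simp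
      also have "norm \<dots> \<le> norm (g y - g x) + (\<eta> + \<eta>)"
        using A_close[OF \<eta>, of x] A_close[OF \<eta>, of y] xy
        by (intro norm_triangle_mono order_refl order_trans[OF norm_triangle_ineq4]) auto
      finally show ?thesis by simp
    qed
    then have "norm (\<kappa> *\<^sub>R (A \<eta> y - A \<eta> x)) \<le> \<kappa> * (norm (g y - g x) + 2 * \<eta>)"
      using xy(4) by (simp add: mult_left_mono)
    ultimately have J: "norm J \<le> - integral {0..b} (\<lambda>t. t * \<phi> t) - \<kappa> * (y - x - norm (g y - g x)) + 2 * \<kappa> * \<eta>"
      by (simp add: algebra_simps)
    have ig: "(\<lambda>t. \<phi> t *\<^sub>R g t) integrable_on {0..b}"
      by (intro integrable_continuous_real continuous_intros \<phi> gc)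
    have "norm (integral {0..b} (\<lambda>t. \<phi> t *\<^sub>R g t - \<phi> t *\<^sub>R A \<eta> t)) \<le> integral {0..b} (\<lambda>t. \<eta> * \<bar>\<phi> t\<bar>)"
    proof (rule integral_norm_bound_integral)
      fix t assume "t \<in> {0..b}"
      then have "norm (g t - A \<eta> t) \<le> \<eta>" using A_close[OF \<eta>, of t] by (simp add: norm_minus_commute)
      then show "norm (\<phi> t *\<^sub>R g t - \<phi> t *\<^sub>R A \<eta> t) \<le> \<eta> * \<bar>\<phi> t\<bar>"
        using mult_right_mono[of "norm (g t - A \<eta> t)" \<eta> "\<bar>\<phi> t\<bar>"]
        by (simp add: scaleR_diff_right[symmetric] mult.commute)
    qed (intro integrable_continuous_real continuous_intros \<phi> gc Ac)+
    also have "\<dots> = \<eta> * M" unfolding M_def by simp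
    also have "integral {0..b} (\<lambda>t. \<phi> t *\<^sub>R g t - \<phi> t *\<^sub>R A \<eta> t) = integral {0..b} (\<lambda>t. \<phi> t *\<^sub>R g t) + J"
      using integral_diff[OF ig has_integral_integrable[OF P]] integral_unique[OF P] by simp
    finally have "norm (integral {0..b} (\<lambda>t. \<phi> t *\<^sub>R g t)) \<le> \<eta> * M + norm J"
      using norm_triangle_ineq4[of "integral {0..b} (\<lambda>t. \<phi> t *\<^sub>R g t) + J" J] by simp
    then show ?thesis using J by (simp add: algebra_simps)
  qed
  have "M \<ge> 0" unfolding M_def by (rule integral_nonneg) (auto intro!: integrable_continuous_real continuous_intros \<phi>)
  then have M: "M + 2 * \<kappa> + 1 > 0" "M + 2 * \<kappa> \<ge> 0" using xy(4) by auto
  show ?thesis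
  proof (rule field_le_epsilon)
    fix e :: real assume e: "e > 0"
    have le: "e / (M + 2 * \<kappa> + 1) * (M + 2 * \<kappa>) \<le> e"
      using M e by (simp add: field_simps)
    show "norm (integral {0..b} (\<lambda>t. \<phi> t *\<^sub>R g t)) \<le>
      - integral {0..b} (\<lambda>t. t * \<phi> t) - \<kappa> * (y - x - norm (g y - g x)) + e"
      by (rule order_trans[OF main[OF divide_pos_pos[OF e M(1)]] add_left_mono[OF le]])
  qed
qed

section \<open>The filling on the open hemisphere\<close>

lemma integral_periodic_shift:
  fixes f :: "real \<Rightarrow> 'a::banach"
  assumes f: "continuous_on UNIV f" and per: "\<And>x. f (x + p) = f x" and p: "0 \<le> p"
  shows "integral {a..a+p} f = integral {b..b+p} f"
proof -
  have "integral {a..a+p} f = integral {b..b+p} f" if "a \<le> b" for a b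
  proof -
    have int: "f integrable_on {u..v}" for u v
      by (intro integrable_continuous_real continuous_on_subset[OF f]) auto
    have "integral {a..a+p} f + integral {a+p..b+p} f = integral {a..b+p} f"
      by (rule Henstock_Kurzweil_Integration.integral_combine) (use that p int in auto)
    moreover have "integral {a..b} f + integral {b..b+p} f = integral {a..b+p} f"
      by (rule Henstock_Kurzweil_Integration.integral_combine) (use that p int in auto)
    moreover have "integral {a+p..b+p} f = integral {a..b} f"
      using integral_shift_real_ivl[of "a+p" p "b+p" f] by (simp add: per)
    ultimately show ?thesis by (metis add.commute add_left_cancel)
  qed
  then show ?thesis by (metis nle_le)
qed

definition fill_int :: "(real \<Rightarrow> 'a::banach) \<Rightarrow> real^3 \<Rightarrow> 'a" where
  "fill_int g p = integral {-pi..pi} (\<lambda>\<theta>. kernel (p $ 1 * cos \<theta> + p $ 2 * sin \<theta>) ((p $ 3)\<^sup>2) *\<^sub>R g \<theta>)"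

text \<open>Polar coordinates around the equatorial point at angle \<omega>: \<open>s\<close> is the
  distance and \<open>k\<close> the cosine of the angle between the great circle and the
  equator.\<close>

definition geo_pt :: "real \<Rightarrow> real \<Rightarrow> real \<Rightarrow> real^3" where
  "geo_pt \<omega> k s = vector [cos s * cos \<omega> - k * sin s * sin \<omega>, cos s * sin \<omega> + k * sin s * cos \<omega>, sqrt (1 - k\<^sup>2) * sin s]"

lemma geo_pt_eq_cos: "geo_pt \<omega> k s $ 1 * cos (\<omega> + \<theta>) + geo_pt \<omega> k s $ 2 * sin (\<omega> + \<theta>) = eq_cos k s \<theta>"
  unfolding geo_pt_def eq_cos_def vector_3 cos_add sin_add
  using sin_cos_squared_add[of \<omega>] by algebra

lemma geo_pt_height_sq: "\<bar>k\<bar> \<le> 1 \<Longrightarrow> (geo_pt \<omega> k s $ 3)\<^sup>2 = height_sq k s"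
  unfolding geo_pt_def height_sq_def vector_3 by (simp add: power_mult_distrib abs_square_le_1)

text \<open>This is the same point seen from the antipodal equatorial point. It carries estimates
  proved for \<open>s < pi / 2\<close> to the other half of the great circle.\<close>

lemma geo_pt_flip: "geo_pt (\<omega> + pi) (- k) (pi - s) = geo_pt \<omega> k s"
  by (simp add: geo_pt_def)

locale periodic_lipschitz =
  fixes g :: "real \<Rightarrow> 'a::banach"
  assumes lip: "1-lipschitz_on UNIV g" and per: "g (x + 2 * pi) = g x"
begin

lemma norm_diff_le: "norm (g x - g y) \<le> \<bar>x - y\<bar>"
  using lipschitz_onD[OF lip, of x y] by (simp add: dist_norm)

lemma cont [continuous_intros]: "continuous_on S f \<Longrightarrow> continuous_on S (\<lambda>x. g (f x))"
  using continuous_on_compose2[OF lipschitz_on_continuous_on[OF lip]] by blast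

lemma fill_int_geo_pt:
  assumes k: "\<bar>k\<bar> < 1" and s: "0 < s" "s < pi"
  shows "fill_int g (geo_pt \<omega> k s) = integral {0..pi} (\<lambda>\<theta>. geo_dens k s \<theta> *\<^sub>R g (\<omega> + \<theta>))
     + integral {0..pi} (\<lambda>\<theta>. geo_dens (- k) s \<theta> *\<^sub>R g (\<omega> - \<theta>))"
proof -
  let ?p = "geo_pt \<omega> k s"
  define f where "f \<theta> = kernel (?p $ 1 * cos \<theta> + ?p $ 2 * sin \<theta>) ((?p $ 3)\<^sup>2) *\<^sub>R g \<theta>" for \<theta>
  have kc: "continuous_on S (geo_dens k s)" for S by (rule continuous_on_kernel_eq_cos[OF k s])
  have fe: "f (\<omega> + \<theta>) = geo_dens k s \<theta> *\<^sub>R g (\<omega> + \<theta>)" for \<theta>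
    using k by (simp add: f_def geo_pt_eq_cos geo_pt_height_sq)
  have fe': "f \<theta> = geo_dens k s (\<theta> - \<omega>) *\<^sub>R g \<theta>" for \<theta> using fe[of "\<theta> - \<omega>"] by simp
  have fc: "continuous_on UNIV f"
    unfolding fe'[abs_def] by (intro continuous_intros continuous_on_compose2[OF kc]) auto
  have fc': "continuous_on S (\<lambda>\<theta>. f (\<omega> + \<theta>))" for S
    by (intro continuous_on_compose2[OF fc] continuous_intros) auto
  have "fill_int g ?p = integral {- pi..- pi + 2 * pi} f"
    by (simp add: fill_int_def f_def[abs_def])
  also have "\<dots> = integral {\<omega> - pi..\<omega> - pi + 2 * pi} f"
    by (rule integral_periodic_shift[OF fc]) (auto simp: f_def per)
  also have "\<dots> = integral {- pi..pi} (\<lambda>\<theta>. f (\<omega> + \<theta>))"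
    using integral_shift_real_ivl[of "\<omega> - pi" \<omega> "\<omega> + pi" f] by (simp add: add.commute)
  also have "\<dots> = integral {- pi..0} (\<lambda>\<theta>. f (\<omega> + \<theta>)) + integral {0..pi} (\<lambda>\<theta>. f (\<omega> + \<theta>))"
    by (rule Henstock_Kurzweil_Integration.integral_combine[symmetric])
      (auto intro!: integrable_continuous_real fc')
  also have "integral {- pi..0} (\<lambda>\<theta>. f (\<omega> + \<theta>)) = integral {0..pi} (\<lambda>\<theta>. f (\<omega> - \<theta>))"
  proof -
    have "(\<lambda>\<theta>. f (\<omega> - \<theta>)) integrable_on {0..pi}"
      by (intro integrable_continuous_real continuous_on_compose2[OF fc] continuous_intros) auto
    from has_integral_reflect_real[THEN iffD2, OF integrable_integral[OF this]]
    show ?thesis by (simp add: integral_unique)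
  qed
  also have "(\<lambda>\<theta>. f (\<omega> - \<theta>)) = (\<lambda>\<theta>. geo_dens (- k) s \<theta> *\<^sub>R g (\<omega> - \<theta>))"
    using fe[of "- _"] by (auto simp: eq_cos_def)
  finally show ?thesis unfolding fe by (simp add: add.commute)
qed

text \<open>On each arc the mass is the same for \<open>s\<close> and \<open>s'\<close>, so the
  primitive of the density difference vanishes at both ends and
  \<open>norm_integral_lipschitz_le\<close> applies to each arc separately. By
  \<open>tent_integral\<close> the two costs add up to \<open>s' - s\<close>. The gain is collected
  on the arc from \<omega> to \<open>\<omega> + pi\<close> only.\<close>

lemma fill_int_geo_pt_near:
  assumes k: "\<bar>k\<bar> < 1" and s: "0 < s" "s \<le> s'" "s' < pi / 2" and h: "0 \<le> h" "h \<le> pi / 2"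
  shows "norm (fill_int g (geo_pt \<omega> k s) - fill_int g (geo_pt \<omega> k s')) \<le> (s' - s)
    - (1 - k\<^sup>2) * sin s / (2 * pi) * (cos s' * (h * sin h)) * (s' - s) *
      (pi - 2 * h - norm (g (\<omega> + (pi - h)) - g (\<omega> + h)))"
proof -
  define \<phi> where "\<phi> j t = geo_dens j s t - geo_dens j s' t" for j t
  define \<kappa> where "\<kappa> = (1 - k\<^sup>2) * sin s / (2 * pi) * (cos s' * (h * sin h)) * (s' - s)"
  have s': "0 < s'" "s < pi / 2" "s < pi" "s' < pi" using s by auto
  have k': "\<bar>- k\<bar> < 1" using k by simp
  have kc: "continuous_on S (geo_dens j t)" if "\<bar>j\<bar> < 1" "t \<in> {s,s'}" for j t S
    using that s s' continuous_on_kernel_eq_cos[OF that(1), of t] by auto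
  have \<phi>c: "continuous_on S (\<phi> j)" if "\<bar>j\<bar> < 1" for j S
    unfolding \<phi>_def by (intro continuous_intros kc that) auto
  have \<phi>i: "(\<phi> j has_integral geo_cdf j s t - geo_cdf j s' t) {0..t}" if "\<bar>j\<bar> < 1" "t \<in> {0..pi}" for j t
    unfolding \<phi>_def using that s s' by (intro has_integral_diff has_integral_kernel) auto
  have tc: "(\<lambda>t. t * geo_dens j u t) integrable_on {0..pi}" if "\<bar>j\<bar> < 1" "u \<in> {s,s'}" for j u
    by (intro integrable_continuous_real continuous_intros kc that)
  have t\<phi>: "integral {0..pi} (\<lambda>t. t * \<phi> j t) = integral {0..pi} (\<lambda>t. t * geo_dens j s t) - integral {0..pi} (\<lambda>t. t * geo_dens j s' t)"
    if "\<bar>j\<bar> < 1" for j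
    unfolding \<phi>_def right_diff_distrib by (intro integral_diff tc that) auto
  have lip1: "1-lipschitz_on UNIV (\<lambda>t. g (\<omega> + t))" "1-lipschitz_on UNIV (\<lambda>t. g (\<omega> - t))"
    using norm_diff_le[of "\<omega> + _" "\<omega> + _"] norm_diff_le[of "\<omega> - _" "\<omega> - _"]
    by (auto intro!: lipschitz_onI simp: dist_norm abs_minus_commute)
  have nn: "geo_cdf j s t - geo_cdf j s' t \<ge> 0" if "\<bar>j\<bar> < 1" "t \<in> {0..pi}" for j t
    using geo_cdf_mono_s[OF that(1) s, of 0 t] that by auto
  have \<kappa>: "geo_cdf k s t - geo_cdf k s' t \<ge> \<kappa>" if "t \<in> {h..pi - h}" for t
    using geo_cdf_mono_s[OF k s h(1), of t] that unfolding \<kappa>_def by auto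
  have "\<kappa> \<ge> 0"
    unfolding \<kappa>_def using k s s' h abs_square_less_1[of k]
    by (auto intro!: mult_nonneg_nonneg divide_nonneg_nonneg sin_ge_zero cos_ge_zero)
  have 1: "norm (integral {0..pi} (\<lambda>t. \<phi> k t *\<^sub>R g (\<omega> + t))) \<le> - integral {0..pi} (\<lambda>t. t * \<phi> k t)
       - \<kappa> * ((pi - h) - h - norm (g (\<omega> + (pi - h)) - g (\<omega> + h)))"
    by (rule norm_integral_lipschitz_le[OF lip1(1) \<phi>c[OF k] _ \<phi>i[OF k] _ nn[OF k]])
      (use h \<open>\<kappa> \<ge> 0\<close> \<kappa> s s' in \<open>auto simp: geo_cdf_pi\<close>)
  \<comment> \<open>On the other arc no gain is claimed: the rate is zero and the interval is
    degenerate.\<close>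
  have 2: "norm (integral {0..pi} (\<lambda>t. \<phi> (- k) t *\<^sub>R g (\<omega> - t))) \<le> - integral {0..pi} (\<lambda>t. t * \<phi> (- k) t)
       - 0 * (0 - 0 - norm (g (\<omega> - 0) - g (\<omega> - 0)))"
    by (rule norm_integral_lipschitz_le[OF lip1(2) \<phi>c[OF k'] _ \<phi>i[OF k'] _ nn[OF k']])
      (use nn[OF k'] s s' in \<open>auto simp: geo_cdf_pi\<close>)
  have gi: "(\<lambda>\<theta>. geo_dens j u \<theta> *\<^sub>R g (\<omega> + \<theta>)) integrable_on {0..pi}" "(\<lambda>\<theta>. geo_dens j u \<theta> *\<^sub>R g (\<omega> - \<theta>)) integrable_on {0..pi}"
    if "\<bar>j\<bar> < 1" "u \<in> {s,s'}" for j u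
    by (intro integrable_continuous_real continuous_intros kc that)+
  have "fill_int g (geo_pt \<omega> k s) - fill_int g (geo_pt \<omega> k s') =
     integral {0..pi} (\<lambda>t. \<phi> k t *\<^sub>R g (\<omega> + t)) + integral {0..pi} (\<lambda>t. \<phi> (- k) t *\<^sub>R g (\<omega> - t))"
    unfolding fill_int_geo_pt[OF k s(1) s'(3)] fill_int_geo_pt[OF k s'(1,4)] \<phi>_def scaleR_diff_left
    using gi[OF k] gi[OF k', unfolded height_sq_minus] by (simp add: integral_diff)
  then have "norm (fill_int g (geo_pt \<omega> k s) - fill_int g (geo_pt \<omega> k s')) \<le>
      - (integral {0..pi} (\<lambda>t. t * \<phi> k t) + integral {0..pi} (\<lambda>t. t * \<phi> (- k) t))
       - \<kappa> * (pi - 2 * h - norm (g (\<omega> + (pi - h)) - g (\<omega> + h)))"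
    using 1 2 norm_triangle_ineq[of "integral {0..pi} (\<lambda>t. \<phi> k t *\<^sub>R g (\<omega> + t))" "integral {0..pi} (\<lambda>t. \<phi> (- k) t *\<^sub>R g (\<omega> - t))"]
    by simp
  also have "integral {0..pi} (\<lambda>t. t * \<phi> k t) + integral {0..pi} (\<lambda>t. t * \<phi> (- k) t) = s - s'"
    unfolding t\<phi>[OF k] t\<phi>[OF k'] using tent_integral[OF k, of s] tent_integral[OF k, of s'] s s' by simp
  finally show ?thesis unfolding \<kappa>_def by simp
qed

end

section \<open>Great circles through given points\<close>

lemma norm_vec3: "(norm (p :: real^3))\<^sup>2 = (p $ 1)\<^sup>2 + (p $ 2)\<^sup>2 + (p $ 3)\<^sup>2"
  unfolding power2_norm_eq_inner inner_vec_def by (simp add: sum_3 power2_eq_square)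

lemma unit_vec3: "norm (p :: real^3) = 1 \<longleftrightarrow> (p $ 1)\<^sup>2 + (p $ 2)\<^sup>2 + (p $ 3)\<^sup>2 = 1"
  by (metis norm_vec3 norm_ge_zero one_power2 power2_eq_imp_eq zero_le_one)

text \<open>\<tau> is the cotangent of the angle at which the great circle through \<open>p\<close>
  and the equatorial point \<omega> leaves the equator, so
  \<open>\<tau> / sqrt (1 + \<tau>\<^sup>2)\<close> is its cosine.\<close>

lemma geo_pt_surj:
  assumes p: "norm p = 1" "p $ 3 > 0" and \<tau>: "p $ 2 * cos \<omega> - p $ 1 * sin \<omega> = \<tau> * p $ 3"
  defines "s \<equiv> arccos (p $ 1 * cos \<omega> + p $ 2 * sin \<omega>)"
  shows "p = geo_pt \<omega> (\<tau> / sqrt (1 + \<tau>\<^sup>2)) s" "0 < s" "s < pi" "\<bar>\<tau> / sqrt (1 + \<tau>\<^sup>2)\<bar> < 1"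
    "cos s = p $ 1 * cos \<omega> + p $ 2 * sin \<omega>"
proof -
  let ?r = "sqrt (1 + \<tau>\<^sup>2)"
  define x where "x = p $ 1 * cos \<omega> + p $ 2 * sin \<omega>"
  define y where "y = p $ 2 * cos \<omega> - p $ 1 * sin \<omega>"
  have r: "?r > 0" "?r\<^sup>2 = 1 + \<tau>\<^sup>2" by (auto simp: add_pos_nonneg)
  have yz: "y = \<tau> * p $ 3" using \<tau> by (simp add: y_def)
  have "x\<^sup>2 + y\<^sup>2 = (p $ 1)\<^sup>2 + (p $ 2)\<^sup>2"
    unfolding x_def y_def using sin_cos_squared_add[of \<omega>] by algebra
  then have u: "x\<^sup>2 + y\<^sup>2 + (p $ 3)\<^sup>2 = 1" using p by (simp add: unit_vec3)
  then have sq: "1 - x\<^sup>2 = (p $ 3 * ?r)\<^sup>2"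
    unfolding power_mult_distrib r yz by (simp add: algebra_simps)
  have "1 - x\<^sup>2 > 0" unfolding sq using p r by simp
  then have "\<bar>x\<bar> < 1" by (simp add: abs_square_less_1)
  then have x: "-1 < x" "x < 1" by auto
  show s: "0 < s" "s < pi" using arccos_lt_bounded[OF x] by (simp_all add: s_def x_def)
  show cs: "cos s = p $ 1 * cos \<omega> + p $ 2 * sin \<omega>" using x by (simp add: s_def x_def[symmetric])
  have "sin s = sqrt (1 - x\<^sup>2)" using x by (simp add: s_def x_def[symmetric] sin_arccos)
  also have "\<dots> = p $ 3 * ?r" unfolding sq using p r by simp
  finally have sn: "sin s = p $ 3 * ?r" .
  have k: "1 - (\<tau> / ?r)\<^sup>2 = (1 / ?r)\<^sup>2" 
  proof -
    have "1 + \<tau>\<^sup>2 \<noteq> 0" using zero_le_power2[of \<tau>] by linarith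
    then show ?thesis unfolding power_divide r by (simp add: field_simps)
  qed
  then have "(\<tau> / ?r)\<^sup>2 < 1" using r by (metis diff_gt_0_iff_gt divide_pos_pos zero_less_one zero_less_power)
  then show "\<bar>\<tau> / ?r\<bar> < 1" using abs_square_less_1 by blast
  have 3: "sqrt (1 - (\<tau> / ?r)\<^sup>2) * sin s = p $ 3" unfolding k sn using r by simp
  have ks: "\<tau> / ?r * sin s = y" unfolding sn yz using r by simp
  have "cos s * cos \<omega> - \<tau> / ?r * sin s * sin \<omega> = p $ 1" "cos s * sin \<omega> + \<tau> / ?r * sin s * cos \<omega> = p $ 2"
    unfolding ks cs y_def using sin_cos_squared_add[of \<omega>] by algebra+
  then show "p = geo_pt \<omega> (\<tau> / ?r) s"
    unfolding geo_pt_def vec_eq_iff forall_3 vector_3 using 3 by simp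
qed

lemma geo_pt_inner:
  assumes "\<bar>k\<bar> < 1"
  shows "geo_pt \<omega> k s \<bullet> geo_pt \<omega> k s' = cos (s - s')"
proof -
  have "sqrt (1 - k\<^sup>2) * sqrt (1 - k\<^sup>2) = 1 - k\<^sup>2" using assms abs_square_less_1[of k] by simp
  then show ?thesis
    unfolding geo_pt_def inner_vec_def sum_3 vector_3 cos_diff inner_real_def
    using sin_cos_squared_add[of \<omega>] by algebra
qed

lemma arccos_geo_pt:
  assumes "\<bar>k\<bar> < 1" "\<bar>s - s'\<bar> \<le> pi"
  shows "arccos (geo_pt \<omega> k s \<bullet> geo_pt \<omega> k s') = \<bar>s - s'\<bar>"
  unfolding geo_pt_inner[OF assms(1)] using assms(2) by (simp add: arccos_cos_eq_abs)

lemma norm_geo_pt: "\<bar>k\<bar> < 1 \<Longrightarrow> norm (geo_pt \<omega> k s) = 1"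
  using geo_pt_inner[of k \<omega> s s] by (simp add: norm_eq_sqrt_inner)

lemma geo_pt_3_pos: "\<bar>k\<bar> < 1 \<Longrightarrow> 0 < s \<Longrightarrow> s < pi \<Longrightarrow> geo_pt \<omega> k s $ 3 > 0"
  using abs_square_less_1[of k] by (simp add: geo_pt_def sin_gt_zero)

text \<open>The last hypothesis says that \<open>p\<close>, \<open>q\<close> and the equatorial
  point at \<omega> are coplanar; both points then give the same \<tau> in
  \<open>geo_pt_surj\<close>.\<close>

lemma geo_pt_surj2:
  assumes p: "norm p = 1" "p $ 3 > 0" and q: "norm q = 1" "q $ 3 > 0"
    and c: "q $ 3 * (p $ 2 * cos \<omega> - p $ 1 * sin \<omega>) = p $ 3 * (q $ 2 * cos \<omega> - q $ 1 * sin \<omega>)"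
  obtains k s s' where "p = geo_pt \<omega> k s" "q = geo_pt \<omega> k s'" "\<bar>k\<bar> < 1" "0 < s" "s < pi" "0 < s'" "s' < pi"
    "cos s = p $ 1 * cos \<omega> + p $ 2 * sin \<omega>" "cos s' = q $ 1 * cos \<omega> + q $ 2 * sin \<omega>"
proof -
  define \<tau> where "\<tau> = (p $ 2 * cos \<omega> - p $ 1 * sin \<omega>) / p $ 3"
  have 1: "p $ 2 * cos \<omega> - p $ 1 * sin \<omega> = \<tau> * p $ 3" using p by (simp add: \<tau>_def)
  have 2: "q $ 2 * cos \<omega> - q $ 1 * sin \<omega> = \<tau> * q $ 3" using p q c by (simp add: \<tau>_def field_simps)
  show ?thesis using geo_pt_surj[OF p 1] geo_pt_surj[OF q 2] that by blast
qed

lemma ex_direction: "\<exists>\<omega>. a * sin \<omega> = b * cos (\<omega> :: real)"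
proof (cases "a = 0")
  case True then show ?thesis by (intro exI[of _ "pi/2"]) simp
next
  case False
  have "cos (arctan (b / a)) * tan (arctan (b / a)) = sin (arctan (b / a))" by (simp add: tan_def del: tan_arctan)
  then show ?thesis using False by (intro exI[of _ "arctan (b / a)"]) (simp add: tan_arctan field_simps)
qed

text \<open>The coplanarity condition is homogeneous and linear in \<open>cos \<omega>\<close> and
  \<open>sin \<omega>\<close>, hence solvable.\<close>

lemma geo_pt_surj_pair:
  assumes p: "norm p = 1" "p $ 3 > 0" and q: "norm q = 1" "q $ 3 > 0"
  obtains \<omega> k s s' where "p = geo_pt \<omega> k s" "q = geo_pt \<omega> k s'" "\<bar>k\<bar> < 1" "0 < s" "s < pi" "0 < s'" "s' < pi"
proof -
  obtain \<omega> where "(q $ 3 * p $ 1 - p $ 3 * q $ 1) * sin \<omega> = (q $ 3 * p $ 2 - p $ 3 * q $ 2) * cos \<omega>"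
    using ex_direction by blast
  then have "q $ 3 * (p $ 2 * cos \<omega> - p $ 1 * sin \<omega>) = p $ 3 * (q $ 2 * cos \<omega> - q $ 1 * sin \<omega>)"
    by (simp add: algebra_simps)
  from geo_pt_surj2[OF assms this] show ?thesis using that by blast
qed

section \<open>Regularity of the density away from the equator\<close>

definition cap :: "real \<Rightarrow> (real^3) set" where
  "cap z = {p. norm p = 1 \<and> p $ 3 \<ge> z}"

lemma kernel_lipschitz:
  assumes r: "0 \<le> r" "r < 1"
  obtains L where "L \<ge> 0" "\<And>c d. \<bar>c\<bar> \<le> r \<Longrightarrow> \<bar>d\<bar> \<le> r \<Longrightarrow>
    \<bar>max 0 c / (2 * sqrt (1 - c\<^sup>2) ^ 3) - max 0 d / (2 * sqrt (1 - d\<^sup>2) ^ 3)\<bar> \<le> L * \<bar>c - d\<bar>"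
proof -
  define f where "f c = c / (2 * sqrt (1 - c\<^sup>2) ^ 3)" for c :: real
  define f' where "f' c = (1 + 2 * c\<^sup>2) / (2 * sqrt (1 - c\<^sup>2) ^ 5)" for c :: real
  have pos: "1 - c\<^sup>2 > 0" if "\<bar>c\<bar> \<le> r" for c :: real
    using that r abs_square_less_1[of c] by simp
  have d: "(f has_real_derivative f' c) (at c)" if "\<bar>c\<bar> \<le> r" for c
  proof -
    let ?u = "sqrt (1 - c\<^sup>2)"
    have u: "?u > 0" "?u\<^sup>2 = 1 - c\<^sup>2" using pos[OF that] by auto
    have du: "((\<lambda>c. sqrt (1 - c\<^sup>2)) has_real_derivative - c / ?u) (at c)"
      using pos[OF that] by (auto intro!: derivative_eq_intros simp: field_simps)
    have alg: "(1 * (2 * v ^ 3) - c * (2 * (of_nat 3 * (- c / v * v ^ (3 - Suc 0))))) / (2 * v ^ 3 * (2 * v ^ 3))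
        = (v\<^sup>2 + 3 * c\<^sup>2) / (2 * v ^ 5)" if "v > 0" for v :: real
      using that by (simp add: field_simps eval_nat_numeral)
    note h = DERIV_divide[OF DERIV_ident DERIV_cmult[OF DERIV_power[OF du, of 3], of 2]]
    have "(f has_real_derivative (?u ^ 2 + 3 * c\<^sup>2) / (2 * ?u ^ 5)) (at c)"
      unfolding f_def by (rule DERIV_cong[OF h alg]) (use u(1) in auto)
    then show ?thesis unfolding f'_def u by (simp add: algebra_simps)
  qed
  have "1 - c\<^sup>2 \<noteq> 0" if "c \<in> {-r..r}" for c using pos[of c] that by (auto simp: abs_le_iff)
  then have "continuous_on {-r..r} f'"
    unfolding f'_def by (intro continuous_intros) auto
  then have "bounded (f' ` {-r..r})" by (intro compact_imp_bounded compact_continuous_image) auto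
  then obtain L where L: "L > 0" "\<And>c. \<bar>c\<bar> \<le> r \<Longrightarrow> \<bar>f' c\<bar> \<le> L"
    unfolding bounded_pos by (auto simp: abs_le_iff)
  have fl: "\<bar>f c - f d\<bar> \<le> L * \<bar>c - d\<bar>" if "c \<in> {-r..r}" "d \<in> {-r..r}" for c d
  proof -
    have "norm (f c - f d) \<le> L * norm (c - d)"
    proof (rule field_differentiable_bound[of "{-r..r}" f f'])
      fix x assume "x \<in> {-r..r}"
      then have x: "\<bar>x\<bar> \<le> r" by (simp add: abs_le_iff)
      show "(f has_field_derivative f' x) (at x within {-r..r})"
        by (rule has_field_derivative_at_within[OF d[OF x]])
      show "norm (f' x) \<le> L" using L(2)[OF x] by simp
    qed (use that in auto)
    then show ?thesis by simp
  qed
  show ?thesis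
  proof (rule that[of L])
    fix c d assume cd: "\<bar>c\<bar> \<le> r" "\<bar>d\<bar> \<le> r"
    \<comment> \<open>The kink is harmless: \<open>f\<close> is smooth on the interval and
      \<open>max 0\<close> is 1-Lipschitz.\<close>
    have "\<bar>f (max 0 c) - f (max 0 d)\<bar> \<le> L * \<bar>max 0 c - max 0 d\<bar>" by (rule fl) (use cd r in auto)
    also have "\<dots> \<le> L * \<bar>c - d\<bar>" using L(1) by (intro mult_left_mono) auto
    moreover have "f (max 0 c) = max 0 c / (2 * sqrt (1 - c\<^sup>2) ^ 3)" for c by (auto simp: f_def max_def)
    ultimately show "\<bar>max 0 c / (2 * sqrt (1 - c\<^sup>2) ^ 3) - max 0 d / (2 * sqrt (1 - d\<^sup>2) ^ 3)\<bar> \<le> L * \<bar>c - d\<bar>" by simp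
  qed (use L in simp)
qed

abbreviation fill_dens :: "real^3 \<Rightarrow> real \<Rightarrow> real" where
  "fill_dens p \<theta> \<equiv> kernel (p $ 1 * cos \<theta> + p $ 2 * sin \<theta>) ((p $ 3)\<^sup>2)"

lemma abs_dot_circle_le: "\<bar>a * cos \<theta> + b * sin \<theta>\<bar> \<le> sqrt (a\<^sup>2 + b\<^sup>2)"
proof (rule abs_le_square_iff[THEN iffD2, of _ "sqrt (a\<^sup>2 + b\<^sup>2)", simplified])
  have "(a * cos \<theta> + b * sin \<theta>)\<^sup>2 + (a * sin \<theta> - b * cos \<theta>)\<^sup>2 = a\<^sup>2 + b\<^sup>2"
    using sin_cos_squared_add[of \<theta>] by algebra
  then show "(a * cos \<theta> + b * sin \<theta>)\<^sup>2 \<le> a\<^sup>2 + b\<^sup>2"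
    using zero_le_power2[of "a * sin \<theta> - b * cos \<theta>"] by linarith
qed

lemma cap_dot_le:
  assumes "p \<in> cap z" "0 \<le> z"
  shows "\<bar>p $ 1 * cos \<theta> + p $ 2 * sin \<theta>\<bar> \<le> sqrt (1 - z\<^sup>2)"
proof -
  have "z\<^sup>2 \<le> (p $ 3)\<^sup>2" using assms by (intro power_mono) (auto simp: cap_def)
  moreover have "(p $ 1)\<^sup>2 + (p $ 2)\<^sup>2 + (p $ 3)\<^sup>2 = 1" using assms by (simp add: cap_def unit_vec3)
  ultimately have "(p $ 1)\<^sup>2 + (p $ 2)\<^sup>2 \<le> 1 - z\<^sup>2" by linarith
  then show ?thesis by (intro order_trans[OF abs_dot_circle_le]) simp
qed

lemma continuous_on_fill_dens:
  assumes "p \<in> cap z" "0 < z"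
  shows "continuous_on S (fill_dens p)"
proof (rule continuous_on_kernel)
  fix t
  have "p $ 3 > 0" using assms by (simp add: cap_def)
  then have "(p $ 3)\<^sup>2 > 0" "norm p = 1" using assms by (auto simp: cap_def)
  moreover have "(p $ 1 * cos t + p $ 2 * sin t)\<^sup>2 \<le> (p $ 1)\<^sup>2 + (p $ 2)\<^sup>2"
    using abs_dot_circle_le[of "p $ 1" t "p $ 2"] real_sqrt_le_iff
    by (metis abs_ge_zero power2_abs power_mono real_sqrt_pow2 sum_power2_ge_zero)
  ultimately show "(p $ 1 * cos t + p $ 2 * sin t)\<^sup>2 < 1" unfolding unit_vec3 by linarith
qed (intro continuous_intros)

lemma fill_dens_lipschitz:
  assumes z: "0 < z"
  obtains L where "L \<ge> 0" "\<And>p q \<theta>. p \<in> cap z \<Longrightarrow> q \<in> cap z \<Longrightarrow> \<bar>fill_dens p \<theta> - fill_dens q \<theta>\<bar> \<le> L * norm (p - q)"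
proof (cases "z \<le> 1")
  case False
  have "p \<notin> cap z" for p using component_le_norm_cart[of p 3] False by (auto simp: cap_def)
  then show ?thesis using that[of 0] by simp
next
  case True
  let ?r = "sqrt (1 - z\<^sup>2)"
  have z2: "z\<^sup>2 \<le> 1" "z\<^sup>2 > 0" using True z by (auto simp: power_le_one)
  then have r: "0 \<le> ?r" "?r < 1" by auto
  obtain L where L: "L \<ge> 0" "\<And>c d. \<bar>c\<bar> \<le> ?r \<Longrightarrow> \<bar>d\<bar> \<le> ?r \<Longrightarrow>
    \<bar>max 0 c / (2 * sqrt (1 - c\<^sup>2) ^ 3) - max 0 d / (2 * sqrt (1 - d\<^sup>2) ^ 3)\<bar> \<le> L * \<bar>c - d\<bar>"
    using kernel_lipschitz[OF r] by metis
  define f where "f c = max 0 c / (2 * sqrt (1 - c\<^sup>2) ^ 3)" for c :: real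
  have fL: "\<bar>f c - f d\<bar> \<le> L * \<bar>c - d\<bar>" if "\<bar>c\<bar> \<le> ?r" "\<bar>d\<bar> \<le> ?r" for c d
    using L(2)[OF that] by (simp add: f_def)
  show ?thesis
  proof (rule that[of "L + 2 * L + 1"])
    fix p q \<theta> assume p: "p \<in> cap z" and q: "q \<in> cap z"
    define c d where "c = p $ 1 * cos \<theta> + p $ 2 * sin \<theta>" and "d = q $ 1 * cos \<theta> + q $ 2 * sin \<theta>"
    have c: "\<bar>c\<bar> \<le> ?r" and d: "\<bar>d\<bar> \<le> ?r" using cap_dot_le p q z unfolding c_def d_def by auto
    have n1: "\<bar>p $ 3\<bar> \<le> 1" "\<bar>q $ 3\<bar> \<le> 1" using component_le_norm_cart[of p 3] component_le_norm_cart[of q 3] p q by (auto simp: cap_def)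
    have n3: "\<bar>p $ 3 - q $ 3\<bar> \<le> norm (p - q)" using component_le_norm_cart[of "p - q" 3] by simp
    have h: "sqrt ((p $ 1 - q $ 1)\<^sup>2 + (p $ 2 - q $ 2)\<^sup>2) \<le> norm (p - q)"
      by (rule real_le_lsqrt[THEN order_trans, OF _ _ order_refl]) (auto simp: norm_vec3)
    have cd: "\<bar>c - d\<bar> \<le> norm (p - q)"
      using abs_dot_circle_le[of "p $ 1 - q $ 1" \<theta> "p $ 2 - q $ 2"] h by (simp add: c_def d_def algebra_simps)
    have "\<bar>d\<bar> \<le> 1" using d r by linarith
    then have "L * \<bar>d\<bar> \<le> L * 1" using L(1) by (rule mult_left_mono)
    moreover have "\<bar>f d\<bar> \<le> L * \<bar>d\<bar>" using fL[of d 0] d r(1) by (simp add: f_def[of 0])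
    ultimately have fd: "\<bar>f d\<bar> \<le> L" by simp
    have y: "\<bar>(p $ 3)\<^sup>2 - (q $ 3)\<^sup>2\<bar> \<le> 2 * norm (p - q)"
    proof -
      have "(p $ 3)\<^sup>2 - (q $ 3)\<^sup>2 = (p $ 3 + q $ 3) * (p $ 3 - q $ 3)" by algebra
      then show ?thesis using mult_mono[of "\<bar>p $ 3 + q $ 3\<bar>" 2 "\<bar>p $ 3 - q $ 3\<bar>" "norm (p - q)"] n1 n3
        by (simp add: abs_mult)
    qed
    have "f c * (p $ 3)\<^sup>2 - f d * (q $ 3)\<^sup>2 = (f c - f d) * (p $ 3)\<^sup>2 + f d * ((p $ 3)\<^sup>2 - (q $ 3)\<^sup>2)" by algebra
    also have "\<bar>\<dots>\<bar> \<le> \<bar>f c - f d\<bar> * (p $ 3)\<^sup>2 + \<bar>f d\<bar> * \<bar>(p $ 3)\<^sup>2 - (q $ 3)\<^sup>2\<bar>"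
      using abs_triangle_ineq[of "(f c - f d) * (p $ 3)\<^sup>2" "f d * ((p $ 3)\<^sup>2 - (q $ 3)\<^sup>2)"] by (simp add: abs_mult)
    also have "\<dots> \<le> (L * norm (p - q)) * 1 + L * (2 * norm (p - q))"
    proof (rule add_mono)
      have "\<bar>f c - f d\<bar> \<le> L * norm (p - q)" using fL[OF c d] mult_left_mono[OF cd L(1)] by linarith
      moreover have "(p $ 3)\<^sup>2 \<le> 1" using n1 abs_square_le_1 by blast
      ultimately show "\<bar>f c - f d\<bar> * (p $ 3)\<^sup>2 \<le> (L * norm (p - q)) * 1"
        using L(1) by (intro mult_mono) auto
      show "\<bar>f d\<bar> * \<bar>(p $ 3)\<^sup>2 - (q $ 3)\<^sup>2\<bar> \<le> L * (2 * norm (p - q))"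
        by (rule mult_mono[OF fd y L(1)]) simp
    qed
    finally have 1: "\<bar>f c * (p $ 3)\<^sup>2 - f d * (q $ 3)\<^sup>2\<bar> \<le> (L + 2 * L) * norm (p - q)" by (simp add: algebra_simps)
    \<comment> \<open>The square root is not Lipschitz at zero, which is reached at the pole. Read
      as the length of the horizontal projection, the term is 1-Lipschitz there too.\<close>
    have e: "sqrt (1 - (v $ 3)\<^sup>2) = norm (vector [v $ 1, v $ 2] :: real^2)" if "v \<in> cap z" for v
    proof -
      have "(v $ 1)\<^sup>2 + (v $ 2)\<^sup>2 + (v $ 3)\<^sup>2 = 1" using that by (simp add: cap_def unit_vec3)
      then have "1 - (v $ 3)\<^sup>2 = (v $ 1)\<^sup>2 + (v $ 2)\<^sup>2" by linarith
      then show ?thesis unfolding norm_vec_def L2_set_def by (simp add: sum_2)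
    qed
    have "\<bar>sqrt (1 - (p $ 3)\<^sup>2) - sqrt (1 - (q $ 3)\<^sup>2)\<bar> \<le> norm (vector [p $ 1, p $ 2] - vector [q $ 1, q $ 2] :: real^2)"
      unfolding e[OF p] e[OF q] by (rule norm_triangle_ineq3)
    also have "\<dots> = sqrt ((p $ 1 - q $ 1)\<^sup>2 + (p $ 2 - q $ 2)\<^sup>2)"
      unfolding norm_vec_def L2_set_def by (simp add: sum_2)
    finally have 2: "\<bar>sqrt (1 - (p $ 3)\<^sup>2) - sqrt (1 - (q $ 3)\<^sup>2)\<bar> \<le> norm (p - q)" using h by simp
    have "fill_dens p \<theta> - fill_dens q \<theta> = (f c * (p $ 3)\<^sup>2 - f d * (q $ 3)\<^sup>2) - (sqrt (1 - (p $ 3)\<^sup>2) - sqrt (1 - (q $ 3)\<^sup>2)) / (2 * pi)"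
      unfolding kernel_def f_def c_def d_def by (simp add: field_simps)
    also have "\<bar>\<dots>\<bar> \<le> \<bar>f c * (p $ 3)\<^sup>2 - f d * (q $ 3)\<^sup>2\<bar> + \<bar>(sqrt (1 - (p $ 3)\<^sup>2) - sqrt (1 - (q $ 3)\<^sup>2)) / (2 * pi)\<bar>"
      by (rule abs_triangle_ineq4)
    also have "\<bar>(sqrt (1 - (p $ 3)\<^sup>2) - sqrt (1 - (q $ 3)\<^sup>2)) / (2 * pi)\<bar> \<le> \<bar>sqrt (1 - (p $ 3)\<^sup>2) - sqrt (1 - (q $ 3)\<^sup>2)\<bar> / 1"
      unfolding abs_divide using pi_ge_two by (intro divide_left_mono) auto
    finally show "\<bar>fill_dens p \<theta> - fill_dens q \<theta>\<bar> \<le> (L + 2 * L + 1) * norm (p - q)"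
      using 1 2 by (simp add: algebra_simps)
  qed (use L in simp)
qed

context periodic_lipschitz
begin

lemma norm_bounded: obtains G where "G \<ge> 0" "\<And>x. x \<in> {-pi..pi} \<Longrightarrow> norm (g x) \<le> G"
proof -
  have "bounded (g ` {-pi..pi})" by (intro compact_imp_bounded compact_continuous_image cont continuous_intros) auto
  then obtain G where "0 < G" "\<forall>x\<in>g ` {-pi..pi}. norm x \<le> G" by (auto simp: bounded_pos)
  then show ?thesis using that[of G] by auto
qed

text \<open>The constant degenerates near the equator; the bound only serves to get continuity along
  great circles, in particular across \<open>s = pi / 2\<close>.\<close>

lemma fill_int_lipschitz:
  assumes "0 < z"
  obtains L where "L \<ge> 0" "\<And>p q. p \<in> cap z \<Longrightarrow> q \<in> cap z \<Longrightarrow> norm (fill_int g p - fill_int g q) \<le> L * norm (p - q)"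
proof -
  obtain L where L: "L \<ge> 0" "\<And>p q \<theta>. p \<in> cap z \<Longrightarrow> q \<in> cap z \<Longrightarrow> \<bar>fill_dens p \<theta> - fill_dens q \<theta>\<bar> \<le> L * norm (p - q)"
    using fill_dens_lipschitz[OF assms] by metis
  obtain G where G: "G \<ge> 0" "\<And>x. x \<in> {-pi..pi} \<Longrightarrow> norm (g x) \<le> G" by (rule norm_bounded) blast
  show ?thesis
  proof (rule that[of "L * G * (2 * pi)"])
    fix p q assume pq: "p \<in> cap z" "q \<in> cap z"
    note c = continuous_on_fill_dens[OF pq(1) assms] continuous_on_fill_dens[OF pq(2) assms]
    have i: "(\<lambda>\<theta>. fill_dens v \<theta> *\<^sub>R g \<theta>) integrable_on {-pi..pi}" if "v \<in> {p,q}" for v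
      using that c by (auto intro!: integrable_continuous_real continuous_intros)
    have "fill_int g p - fill_int g q = integral {-pi..pi} (\<lambda>\<theta>. (fill_dens p \<theta> - fill_dens q \<theta>) *\<^sub>R g \<theta>)"
      unfolding fill_int_def scaleR_diff_left by (intro integral_diff[symmetric] i) auto
    also have "norm \<dots> \<le> (L * norm (p - q) * G) * (pi - - pi)"
    proof (rule integral_bound)
      fix \<theta> assume "\<theta> \<in> {-pi..pi}"
      then show "norm ((fill_dens p \<theta> - fill_dens q \<theta>) *\<^sub>R g \<theta>) \<le> L * norm (p - q) * G"
        using L G pq by (auto intro!: mult_mono)
    qed (use c in \<open>auto intro!: continuous_intros\<close>)
    finally show "norm (fill_int g p - fill_int g q) \<le> L * G * (2 * pi) * norm (p - q)" by (simp add: mult_ac)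
  qed (use L G in simp)
qed

lemma continuous_on_fill_int_geo_pt:
  assumes k: "\<bar>k\<bar> < 1"
  shows "continuous_on {0<..<pi} (\<lambda>s. fill_int g (geo_pt \<omega> k s))"
proof (rule continuous_at_imp_continuous_on, rule ballI)
  fix s assume s: "s \<in> {0<..<pi}"
  let ?z = "geo_pt \<omega> k s $ 3 / 2"
  have z: "?z > 0" using geo_pt_3_pos[OF k] s by simp
  obtain L where L: "L \<ge> 0" "\<And>p q. p \<in> cap ?z \<Longrightarrow> q \<in> cap ?z \<Longrightarrow> norm (fill_int g p - fill_int g q) \<le> L * norm (p - q)"
    using fill_int_lipschitz[OF z] by metis
  have "((\<lambda>t. geo_pt \<omega> k t $ i) \<longlongrightarrow> geo_pt \<omega> k s $ i) (at s)" for i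
    using exhaust_3[of i] by (elim disjE; simp add: geo_pt_def; intro tendsto_intros)
  then have sc: "((\<lambda>t. geo_pt \<omega> k t) \<longlongrightarrow> geo_pt \<omega> k s) (at s)" by (rule vec_tendstoI)
  have "eventually (\<lambda>t. geo_pt \<omega> k t $ 3 > ?z) (at s)"
    by (rule order_tendstoD[OF tendsto_vec_nth[OF sc]]) (use z in simp)
  then have ev: "eventually (\<lambda>t. geo_pt \<omega> k t \<in> cap ?z) (at s)"
    by eventually_elim (simp add: cap_def norm_geo_pt[OF k])
  have s0: "geo_pt \<omega> k s \<in> cap ?z" using z by (simp add: cap_def norm_geo_pt[OF k])
  have "((\<lambda>t. fill_int g (geo_pt \<omega> k t) - fill_int g (geo_pt \<omega> k s)) \<longlongrightarrow> 0) (at s)"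
  proof (rule Lim_null_comparison)
    show "eventually (\<lambda>t. norm (fill_int g (geo_pt \<omega> k t) - fill_int g (geo_pt \<omega> k s)) \<le> L * norm (geo_pt \<omega> k t - geo_pt \<omega> k s)) (at s)"
      using ev by eventually_elim (rule L(2)[OF _ s0])
    have "((\<lambda>t. L * norm (geo_pt \<omega> k t - geo_pt \<omega> k s)) \<longlongrightarrow> L * norm (geo_pt \<omega> k s - geo_pt \<omega> k s)) (at s)"
      by (intro tendsto_intros sc)
    then show "((\<lambda>t. L * norm (geo_pt \<omega> k t - geo_pt \<omega> k s)) \<longlongrightarrow> 0) (at s)" by simp
  qed
  then show "isCont (\<lambda>s. fill_int g (geo_pt \<omega> k s)) s" unfolding isCont_def by (rule Lim_null[THEN iffD2])
qed

text \<open>The open quarter circles on both sides of \<open>pi / 2\<close> are covered by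
  \<open>fill_int_geo_pt_near\<close> with \<open>h = 0\<close>, the second one through
  \<open>geo_pt_flip\<close>. Continuity closes them up at \<open>pi / 2\<close>, where they are
  glued.\<close>

lemma fill_int_geo_pt_lipschitz:
  assumes k: "\<bar>k\<bar> < 1" and s: "0 < s" "s < pi" "0 < s'" "s' < pi"
  shows "norm (fill_int g (geo_pt \<omega> k s) - fill_int g (geo_pt \<omega> k s')) \<le> \<bar>s - s'\<bar>"
proof -
  let ?H = "\<lambda>s. fill_int g (geo_pt \<omega> k s)"
  have near: "norm (fill_int g (geo_pt \<omega> k s) - fill_int g (geo_pt \<omega> k s')) \<le> \<bar>s - s'\<bar>"
    if "\<bar>k\<bar> < 1" "0 < s" "s < pi/2" "0 < s'" "s' < pi / 2" for \<omega> k s s'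
  proof -
    have "norm (fill_int g (geo_pt \<omega> k s) - fill_int g (geo_pt \<omega> k s')) \<le> s' - s"
      if "s \<le> s'" "\<bar>k\<bar> < 1" "0 < s" "s' < pi / 2" for s s'
      using fill_int_geo_pt_near[OF that(2,3,1,4), of 0 \<omega>] by simp
    from this[of s s'] this[of s' s] that show ?thesis
      by (cases "s \<le> s'") (auto simp: norm_minus_commute)
  qed
  have l1: "1-lipschitz_on {0<..<pi/2} ?H"
    using near[OF k] by (intro lipschitz_onI) (auto simp: dist_norm)
  have l2: "1-lipschitz_on {pi/2<..<pi} ?H"
    using near[of "- k" "pi - _" "pi - _" "\<omega> + pi"] k unfolding geo_pt_flip
    by (intro lipschitz_onI) (auto simp: dist_norm abs_minus_commute)
  have c: "continuous_on {a..b} ?H" if "0 < a" "b < pi" for a b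
    by (rule continuous_on_subset[OF continuous_on_fill_int_geo_pt[OF k]]) (use that in auto)
  have l1': "1-lipschitz_on {a..pi/2} ?H" if "0 < a" "a < pi/2" for a
  proof -
    have "{a<..<pi/2} \<subseteq> {0<..<pi/2}" using that by auto
    then show ?thesis
      using lipschitz_on_closure[OF lipschitz_on_subset[OF l1, of "{a<..<pi/2}"]] that c[of a "pi/2"] by simp
  qed
  have l2': "1-lipschitz_on {pi/2..b} ?H" if "pi/2 < b" "b < pi" for b
  proof -
    have "{pi/2<..<b} \<subseteq> {pi/2<..<pi}" using that by auto
    then show ?thesis
      using lipschitz_on_closure[OF lipschitz_on_subset[OF l2, of "{pi/2<..<b}"]] that c[of "pi/2" b] by simp
  qed
  define a where "a = min (min s s') (pi/4)"
  define b where "b = max (max s s') (3*pi/4)"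
  have ab: "0 < a" "a < pi/2" "pi/2 < b" "b < pi" "s \<in> {a..b}" "s' \<in> {a..b}"
    using s pi_gt_zero unfolding a_def b_def by auto
  have "1-lipschitz_on {a..b} (\<lambda>t. if t \<le> pi/2 then ?H t else ?H t)"
    by (rule lipschitz_on_concat[OF l1'[OF ab(1,2)] l2'[OF ab(3,4)]]) auto
  then show ?thesis using lipschitz_onD[of 1 "{a..b}" ?H s s'] ab by (simp add: dist_norm)
qed

lemma fill_int_dist:
  assumes "norm p = 1" "p $ 3 > 0" "norm q = 1" "q $ 3 > 0"
  shows "norm (fill_int g p - fill_int g q) \<le> dH2 p q"
proof -
  obtain \<omega> k s s' where "p = geo_pt \<omega> k s" "q = geo_pt \<omega> k s'" "\<bar>k\<bar> < 1" "0 < s" "s < pi" "0 < s'" "s' < pi"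
    using geo_pt_surj_pair[OF assms] .
  then show ?thesis using fill_int_geo_pt_lipschitz[of k s s' \<omega>] arccos_geo_pt[of k s s' \<omega>] by (simp add: dH2_def)
qed

text \<open>The distance of the mean from \<open>g \<omega>\<close> is at most the mean distance to
  the point at \<omega>, which is \<open>s\<close> by \<open>tent_integral\<close>.\<close>

lemma fill_int_geo_pt_boundary:
  assumes k: "\<bar>k\<bar> < 1" and s: "0 < s" "s < pi / 2"
  shows "norm (fill_int g (geo_pt \<omega> k s) - g \<omega>) \<le> s"
proof -
  have sp: "s < pi" using s by simp
  have k': "\<bar>-k\<bar> < 1" using k by simp
  have kc: "continuous_on S (geo_dens j s)" if "\<bar>j\<bar> < 1" for j S
    by (rule continuous_on_kernel_eq_cos[OF that s(1) sp])
  have mass: "(geo_dens j s has_integral (1 + j) / 2) {0..pi}" if "\<bar>j\<bar> < 1" for j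
    using has_integral_kernel[OF that s, of pi] geo_cdf_pi[OF s] by simp
  have pos: "geo_dens j s t \<ge> 0" if "\<bar>j\<bar> < 1" for j t
    unfolding kernel_def using eq_cos_sq_less[OF that s(1) sp, of t] height_sq_pos[OF that s(1) sp] height_sq_le_1[of j s] by simp
  have bd: "norm (integral {0..pi} (\<lambda>t. geo_dens j s t *\<^sub>R g (\<omega> + c * t)) - ((1 + j) / 2) *\<^sub>R g \<omega>) \<le> integral {0..pi} (\<lambda>t. t * geo_dens j s t)"
    if j: "\<bar>j\<bar> < 1" and c: "\<bar>c\<bar> = 1" for j c
  proof -
    have i1: "(\<lambda>t. geo_dens j s t *\<^sub>R g (\<omega> + c * t)) integrable_on {0..pi}"
      by (intro integrable_continuous_real continuous_intros kc j)
    have i2: "((\<lambda>t. geo_dens j s t *\<^sub>R g \<omega>) has_integral ((1 + j) / 2) *\<^sub>R g \<omega>) {0..pi}"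
      by (rule has_integral_scaleR_left[OF mass[OF j]])
    have e: "integral {0..pi} (\<lambda>t. geo_dens j s t *\<^sub>R g (\<omega> + c * t)) - ((1 + j) / 2) *\<^sub>R g \<omega>
        = integral {0..pi} (\<lambda>t. geo_dens j s t *\<^sub>R g (\<omega> + c * t) - geo_dens j s t *\<^sub>R g \<omega>)"
      using integral_diff[OF i1 has_integral_integrable[OF i2]] integral_unique[OF i2] by simp
    show ?thesis unfolding e
    proof (rule integral_norm_bound_integral)
      fix t assume "t \<in> {0..pi}"
      then have "norm (g (\<omega> + c * t) - g \<omega>) \<le> t"
        using norm_diff_le[of "\<omega> + c * t" \<omega>] c by (simp add: abs_mult)
      then show "norm (geo_dens j s t *\<^sub>R g (\<omega> + c * t) - geo_dens j s t *\<^sub>R g \<omega>) \<le> t * geo_dens j s t"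
        using mult_right_mono[OF _ pos[OF j, of t], of "norm (g (\<omega> + c * t) - g \<omega>)" t] pos[OF j, of t]
        by (simp add: scaleR_diff_right[symmetric] mult.commute)
    qed (use i1 i2 in \<open>auto intro!: integrable_diff integrable_continuous_real continuous_intros kc j\<close>)
  qed
  have e: "fill_int g (geo_pt \<omega> k s) - g \<omega> =
     (integral {0..pi} (\<lambda>t. geo_dens k s t *\<^sub>R g (\<omega> + 1 * t)) - ((1 + k) / 2) *\<^sub>R g \<omega>) +
     (integral {0..pi} (\<lambda>t. geo_dens (- k) s t *\<^sub>R g (\<omega> + (- 1) * t)) - ((1 + - k) / 2) *\<^sub>R g \<omega>)"
  proof -
    have "((1 + k) / 2) *\<^sub>R g \<omega> + ((1 + - k) / 2) *\<^sub>R g \<omega> = g \<omega>"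
      by (simp add: scaleR_add_left[symmetric] field_simps)
    then show ?thesis unfolding fill_int_geo_pt[OF k s(1) sp] by (simp add: algebra_simps)
  qed
  show ?thesis
    unfolding e using bd[OF k, of 1] bd[OF k', of "- 1"] tent_integral[OF k s]
    by (intro order_trans[OF norm_triangle_ineq]) simp
qed

end

section \<open>The filling on the closed hemisphere\<close>

lemma dH2_commute: "dH2 p q = dH2 q p"
  by (simp add: dH2_def inner_commute)

definition circ :: "real \<Rightarrow> real^2" where
  "circ \<theta> = vector [cos \<theta>, sin \<theta>]"

lemma circ_inner: "circ a \<bullet> circ b = cos (a - b)"
  by (simp add: circ_def inner_vec_def sum_2 cos_diff)

lemma circ_in_S1: "circ a \<in> S1"
  using circ_inner[of a a] by (simp add: S1_def norm_eq_sqrt_inner)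

lemma S1_circ:
  assumes "x \<in> S1" obtains \<omega> where "x = circ \<omega>"
proof -
  have "(x $ 1)\<^sup>2 + (x $ 2)\<^sup>2 = (norm x)\<^sup>2"
    unfolding power2_norm_eq_inner inner_vec_def by (simp add: sum_2 power2_eq_square)
  then have "(x $ 1)\<^sup>2 + (x $ 2)\<^sup>2 = 1" using assms by (simp add: S1_def)
  then obtain \<omega> where "x $ 1 = cos \<omega>" "x $ 2 = sin \<omega>" using sincos_total_2pi by metis
  then show ?thesis by (intro that[of \<omega>]) (simp add: circ_def vec_eq_iff forall_2)
qed

lemma arccos_cos_le: "arccos (cos x) \<le> \<bar>x\<bar>"
proof (cases "\<bar>x\<bar> \<le> pi")
  case True then show ?thesis by (simp add: arccos_cos_eq_abs)
next
  case False then show ?thesis using arccos_ubound[of "cos x"] by (smt (verit) cos_ge_minus_one cos_le_one)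
qed

lemma periodic_lipschitz_circ:
  assumes "lipschitz_wrt dS1 1 S1 \<gamma>"
  shows "periodic_lipschitz (\<gamma> \<circ> circ)"
proof
  have "dist (\<gamma> (circ x)) (\<gamma> (circ y)) \<le> dist x y" for x y
  proof -
    have "dist (\<gamma> (circ x)) (\<gamma> (circ y)) \<le> 1 * dS1 (circ x) (circ y)"
      using assms circ_in_S1 unfolding lipschitz_wrt_def by blast
    also have "\<dots> \<le> dist x y" using arccos_cos_le[of "x - y"] by (simp add: dS1_def circ_inner dist_real_def)
    finally show ?thesis .
  qed
  then show "1-lipschitz_on UNIV (\<gamma> \<circ> circ)" by (intro lipschitz_onI) auto
  show "(\<gamma> \<circ> circ) (x + 2 * pi) = (\<gamma> \<circ> circ) x" for x by (simp add: circ_def)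
qed

text \<open>At height zero \<open>kernel\<close> vanishes identically, since the mass has
  concentrated at a point, and \<open>fill_int\<close> would give zero; so the boundary values are
  put in by hand.\<close>

definition hemi_fill :: "(real^2 \<Rightarrow> 'a::banach) \<Rightarrow> real^3 \<Rightarrow> 'a" where
  "hemi_fill \<gamma> p = (if p $ 3 > 0 then fill_int (\<gamma> \<circ> circ) p else \<gamma> (vector [p $ 1, p $ 2]))"

lemma hemi_fill_equator: "hemi_fill \<gamma> (equator x) = \<gamma> x"
  by (simp add: hemi_fill_def equator_def) (rule arg_cong[of _ _ \<gamma>], simp add: vec_eq_iff forall_2)

lemma H2_equator:
  assumes "p \<in> H2" "\<not> p $ 3 > 0" obtains \<omega> where "p = equator (circ \<omega>)"
proof -
  have p: "p $ 3 = 0" "(p $ 1)\<^sup>2 + (p $ 2)\<^sup>2 = 1" using assms by (auto simp: H2_def unit_vec3)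
  then obtain \<omega> where "p $ 1 = cos \<omega>" "p $ 2 = sin \<omega>" using sincos_total_2pi by metis
  then show ?thesis using p
    by (intro that[of \<omega>]) (simp add: circ_def equator_def vec_eq_iff forall_3)
qed

lemma hemi_fill_lipschitz:
  assumes \<gamma>: "lipschitz_wrt dS1 1 S1 \<gamma>"
  shows "lipschitz_wrt dH2 1 H2 (hemi_fill \<gamma>)"
proof -
  interpret periodic_lipschitz "\<gamma> \<circ> circ" by (rule periodic_lipschitz_circ[OF \<gamma>])
  have mixed: "dist (hemi_fill \<gamma> p) (hemi_fill \<gamma> q) \<le> dH2 p q" if p: "p \<in> H2" "p $ 3 > 0" and q: "q \<in> H2" "\<not> q $ 3 > 0" for p q
  proof -
    obtain \<omega> where \<omega>: "q = equator (circ \<omega>)" using H2_equator[OF q] .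
    have in1: "\<bar>p \<bullet> v\<bar> \<le> 1" if "norm v = 1" for v
      using Cauchy_Schwarz_ineq2[of p v] p that by (simp add: H2_def)
    have nq: "norm q = 1" using q by (simp add: H2_def)
    \<comment> \<open>The boundary point is approached along the meridian above it, the case
      \<open>k = 0\<close>, so that the interior estimate and
      \<open>fill_int_geo_pt_boundary\<close> combine in the limit.\<close>
    have "((\<lambda>t. p \<bullet> (cos t *\<^sub>R q + sin t *\<^sub>R axis 3 1)) \<longlongrightarrow> p \<bullet> (cos 0 *\<^sub>R q + sin 0 *\<^sub>R axis 3 1)) (at_right 0)"
      by (intro tendsto_intros)
    moreover have geo_pt: "cos t *\<^sub>R q + sin t *\<^sub>R axis 3 1 = geo_pt \<omega> 0 t" for t
      by (simp add: \<omega> geo_pt_def equator_def circ_def vec_eq_iff forall_3 axis_def)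
    ultimately have "((\<lambda>t. p \<bullet> geo_pt \<omega> 0 t) \<longlongrightarrow> p \<bullet> q) (at_right 0)" by simp
    then have "((\<lambda>t. arccos (p \<bullet> geo_pt \<omega> 0 t)) \<longlongrightarrow> arccos (p \<bullet> q)) (at_right 0)"
      by (rule continuous_on_tendsto_compose[OF continuous_on_arccos'])
        (use in1[of "geo_pt \<omega> 0 _"] norm_geo_pt[of 0 \<omega>] in1[OF nq] in \<open>auto simp: abs_le_iff minus_le_iff intro!: always_eventually\<close>)
    then have lim: "((\<lambda>t. dH2 p (geo_pt \<omega> 0 t) + t) \<longlongrightarrow> dH2 p q + 0) (at_right 0)"
      unfolding dH2_def by (rule tendsto_add) (rule tendsto_ident_at)
    have "dist (hemi_fill \<gamma> p) (hemi_fill \<gamma> q) \<le> dH2 p q + 0"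
    proof (rule tendsto_lowerbound[OF lim])
      have "eventually (\<lambda>t. 0 < t \<and> t < pi / 2) (at_right (0::real))"
        using eventually_at_right_field[of "\<lambda>t. 0 < t \<and> t < pi / 2" 0] pi_half_gt_zero by blast
      then show "eventually (\<lambda>t. dH2 p (geo_pt \<omega> 0 t) + t \<ge> dist (hemi_fill \<gamma> p) (hemi_fill \<gamma> q)) (at_right 0)"
      proof eventually_elim
        case (elim t)
        have "norm (fill_int (\<gamma> \<circ> circ) p - fill_int (\<gamma> \<circ> circ) (geo_pt \<omega> 0 t)) \<le> dH2 p (geo_pt \<omega> 0 t)"
          by (rule fill_int_dist) (use p elim norm_geo_pt[of 0] geo_pt_3_pos[of 0 t \<omega>] in \<open>auto simp: H2_def\<close>)
        moreover have "norm (fill_int (\<gamma> \<circ> circ) (geo_pt \<omega> 0 t) - \<gamma> (circ \<omega>)) \<le> t"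
          using fill_int_geo_pt_boundary[of 0 t \<omega>] elim by simp
        moreover have "hemi_fill \<gamma> q = \<gamma> (circ \<omega>)" unfolding \<omega> by (rule hemi_fill_equator)
        moreover have "hemi_fill \<gamma> p = fill_int (\<gamma> \<circ> circ) p" using p by (simp add: hemi_fill_def)
        ultimately show ?case
          using dist_triangle[of "hemi_fill \<gamma> p" "hemi_fill \<gamma> q" "fill_int (\<gamma> \<circ> circ) (geo_pt \<omega> 0 t)"] by (simp add: dist_norm)
      qed
    qed simp
    then show ?thesis by simp
  qed
  show ?thesis unfolding lipschitz_wrt_def
  proof (intro ballI)
    fix p q assume p: "p \<in> H2" and q: "q \<in> H2"
    consider "p $ 3 > 0" "q $ 3 > 0" | "p $ 3 > 0" "\<not> q $ 3 > 0" | "\<not> p $ 3 > 0" "q $ 3 > 0" | "\<not> p $ 3 > 0" "\<not> q $ 3 > 0" by blast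
    then show "dist (hemi_fill \<gamma> p) (hemi_fill \<gamma> q) \<le> 1 * dH2 p q"
    proof cases
      case 1 then show ?thesis using fill_int_dist[of p q] p q by (simp add: hemi_fill_def H2_def dist_norm)
    next
      case 2 then show ?thesis using mixed[OF p _ q] by simp
    next
      case 3 then show ?thesis using mixed[OF q _ p] by (simp add: dist_commute dH2_commute)
    next
      case 4
      obtain a b where ab: "p = equator (circ a)" "q = equator (circ b)" using H2_equator p q 4 by metis
      have "dH2 p q = dS1 (circ a) (circ b)"
        by (simp add: ab dH2_def dS1_def equator_def inner_vec_def sum_3 sum_2)
      then show ?thesis using \<gamma> circ_in_S1 unfolding ab hemi_fill_equator lipschitz_wrt_def by auto
    qed
  qed
qed

text \<open>If no antipodal pair were shortened, then for any \<open>x\<close> and \<open>y\<close>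
  the triangle inequality through the image of \<open>y\<close>, applied to \<open>x\<close> and its
  antipode, would leave no room for shortening the distance of \<open>x\<close> and
  \<open>y\<close>.\<close>

lemma bad_antipodes:
  assumes \<gamma>: "lipschitz_wrt dS1 1 S1 \<gamma>" and ni: "\<not> isometric_embedding_S1 \<gamma>"
  obtains \<omega> where "norm ((\<gamma> \<circ> circ) (\<omega> + pi) - (\<gamma> \<circ> circ) \<omega>) < pi"
proof (rule ccontr)
  assume "\<not> thesis"
  then have anti: "norm ((\<gamma> \<circ> circ) (\<omega> + pi) - (\<gamma> \<circ> circ) \<omega>) \<ge> pi" for \<omega>
    using that[of \<omega>] by (meson not_le)
  have "dist (\<gamma> x) (\<gamma> y) = dS1 x y" if x: "x \<in> S1" and y: "y \<in> S1" for x y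
  proof -
    obtain a b where ab: "x = circ a" "y = circ b" using S1_circ x y by metis
    have cc: "circ (a + pi) = - circ a" by (simp add: circ_def vec_eq_iff forall_2)
    have "pi \<le> dist (\<gamma> (circ (a + pi))) (\<gamma> x)" using anti[of a] by (simp add: dist_norm ab)
    also have "\<dots> \<le> dist (\<gamma> (circ (a + pi))) (\<gamma> y) + dist (\<gamma> x) (\<gamma> y)" by (metis dist_commute dist_triangle)
    also have "dist (\<gamma> (circ (a + pi))) (\<gamma> y) \<le> dS1 (circ (a + pi)) y"
      using \<gamma> circ_in_S1 y unfolding lipschitz_wrt_def by fastforce
    also have "dS1 (circ (a + pi)) y = pi - dS1 x y"
      unfolding dS1_def cc ab(1) using Cauchy_Schwarz_ineq2[of "circ a" y] y circ_in_S1[of a]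
      by (simp add: S1_def arccos_minus_abs)
    finally have "dS1 x y \<le> dist (\<gamma> x) (\<gamma> y)" by simp
    moreover have "dist (\<gamma> x) (\<gamma> y) \<le> dS1 x y" using \<gamma> x y unfolding lipschitz_wrt_def by fastforce
    ultimately show ?thesis by simp
  qed
  then show False using ni unfolding isometric_embedding_S1_def by blast
qed

section \<open>Strict contraction near a shortened pair of antipodes\<close>

lemma x_cos_le_sin:
  assumes "0 \<le> x" "x \<le> pi / 2"
  shows "x * cos x \<le> sin (x :: real)"
proof -
  have "sin 0 - 0 * cos 0 \<le> sin x - x * cos x"
  proof (rule DERIV_nonneg_imp_nondecreasing[OF assms(1)])
    fix t assume "0 \<le> t" "t \<le> x"
    then have "t * sin t \<ge> 0" using assms by (intro mult_nonneg_nonneg sin_ge_zero) auto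
    moreover have "((\<lambda>t. sin t - t * cos t) has_real_derivative t * sin t) (at t)"
      by (auto intro!: derivative_eq_intros)
    ultimately show "\<exists>y. ((\<lambda>t. sin t - t * cos t) has_real_derivative y) (at t) \<and> 0 \<le> y" by blast
  qed
  then show ?thesis by simp
qed

lemma abs_arctan_le: "\<bar>arctan x\<bar> \<le> \<bar>x\<bar>"
proof -
  have "arctan y \<le> y" if "y \<ge> 0" for y
  proof -
    have c: "cos (arctan y) > 0" using cos_arctan[of y] by (simp add: add_pos_nonneg)
    have "arctan y * cos (arctan y) \<le> sin (arctan y)"
      using that arctan_ubound[of y] by (intro x_cos_le_sin) auto
    also have "\<dots> = tan (arctan y) * cos (arctan y)" using c by (simp add: tan_def del: tan_arctan)
    finally have "arctan y * cos (arctan y) \<le> y * cos (arctan y)" by (simp add: tan_arctan)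
    then show ?thesis using c by simp
  qed
  from this[of x] this[of "- x"] show ?thesis by (cases "x \<ge> 0") (auto simp: arctan_minus)
qed

text \<open>A thin layer just above the equatorial point at \<omega>. The upper bound on the height
  keeps the great circles of \<open>patch_node\<close> close to \<omega> at the equator; the lower
  bound keeps the rate of contraction away from zero.\<close>

definition patch :: "real \<Rightarrow> real \<Rightarrow> real \<Rightarrow> (real^3) set" where
  "patch \<omega> z \<eta> = {p. norm p = 1 \<and> z / 2 < p $ 3 \<and> p $ 3 < z \<and> 3 / 4 < p $ 1 * cos \<omega> + p $ 2 * sin \<omega>
     \<and> \<bar>p $ 2 * cos \<omega> - p $ 1 * sin \<omega>\<bar> < \<eta> / 4}"

text \<open>Two points of a patch whose heights differ by a definite fraction of their distance lie on
  a great circle that meets the equator near the angle \<open>\<omega>\<close>.\<close>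

lemma patch_node:
  assumes p: "p \<in> patch \<omega> z \<eta>" and q: "q \<in> patch \<omega> z \<eta>" and pq: "p \<noteq> q" "norm (p - q) / 4 \<le> \<bar>p $ 3 - q $ 3\<bar>"
    and z: "0 < z" "16 * z \<le> \<eta>" and \<eta>: "\<eta> \<le> 1 / 8"
  obtains \<phi> where "\<bar>\<phi>\<bar> \<le> \<eta>"
    "q $ 3 * (p $ 2 * cos (\<omega> + \<phi>) - p $ 1 * sin (\<omega> + \<phi>)) = p $ 3 * (q $ 2 * cos (\<omega> + \<phi>) - q $ 1 * sin (\<omega> + \<phi>))"
proof -
  define m where "m = q $ 3 - p $ 3"
  have m: "\<bar>m\<bar> > 0" "norm (p - q) \<le> 4 * \<bar>m\<bar>" using pq unfolding m_def by (auto simp: abs_minus_commute)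
  \<comment> \<open>The point \<open>(q $ 1 + e, q $ 2 + f)\<close> is where the line through
    \<open>p\<close> and \<open>q\<close> meets the equatorial plane. The shift
    \<open>(e, f)\<close> has length at most \<open>4 * z\<close>, hence at most
    \<open>\<eta> / 4\<close>, because the heights differ by a quarter of the distance.\<close>
  define e f where "e = q $ 3 * (p $ 1 - q $ 1) / m" and "f = q $ 3 * (p $ 2 - q $ 2) / m"
  have q3: "0 < q $ 3" "q $ 3 < z" using q z by (auto simp: patch_def)
  have "sqrt ((p $ 1 - q $ 1)\<^sup>2 + (p $ 2 - q $ 2)\<^sup>2) \<le> sqrt ((norm (p - q))\<^sup>2)"
    unfolding norm_vec3 by (intro real_sqrt_le_mono) simp
  then have h: "sqrt ((p $ 1 - q $ 1)\<^sup>2 + (p $ 2 - q $ 2)\<^sup>2) \<le> 4 * \<bar>m\<bar>" using m(2) by simp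
  have ef: "sqrt (e\<^sup>2 + f\<^sup>2) \<le> 4 * z"
  proof -
    have "e\<^sup>2 + f\<^sup>2 = (q $ 3 / m)\<^sup>2 * ((p $ 1 - q $ 1)\<^sup>2 + (p $ 2 - q $ 2)\<^sup>2)"
      unfolding e_def f_def by (simp add: power_mult_distrib power_divide distrib_left)
    then have "sqrt (e\<^sup>2 + f\<^sup>2) = q $ 3 / \<bar>m\<bar> * sqrt ((p $ 1 - q $ 1)\<^sup>2 + (p $ 2 - q $ 2)\<^sup>2)"
      using q3 by (simp add: real_sqrt_mult)
    also have "\<dots> \<le> z / \<bar>m\<bar> * (4 * \<bar>m\<bar>)"
      using h q3 m by (intro mult_mono divide_right_mono) auto
    finally show ?thesis using m by simp
  qed
  \<comment> \<open>Coordinates of that intersection in the frame turned by \<omega>; its polar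
    angle there is the required \<phi>.\<close>
  define x y where "x = (q $ 1 + e) * cos \<omega> + (q $ 2 + f) * sin \<omega>" and "y = (q $ 2 + f) * cos \<omega> - (q $ 1 + e) * sin \<omega>"
  have "\<bar>e * cos \<omega> + f * sin \<omega>\<bar> \<le> 4 * z" using abs_dot_circle_le[of e \<omega> f] ef by linarith
  moreover have "3 / 4 < q $ 1 * cos \<omega> + q $ 2 * sin \<omega>" using q by (simp add: patch_def)
  moreover have "x = (q $ 1 * cos \<omega> + q $ 2 * sin \<omega>) + (e * cos \<omega> + f * sin \<omega>)" by (simp add: x_def algebra_simps)
  ultimately have x: "x > 1 / 2" using z \<eta> by linarith
  have "\<bar>f * cos \<omega> + (- e) * sin \<omega>\<bar> \<le> 4 * z" using abs_dot_circle_le[of f \<omega> "- e"] ef by (simp add: add.commute)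
  moreover have "\<bar>q $ 2 * cos \<omega> - q $ 1 * sin \<omega>\<bar> < \<eta> / 4" using q by (simp add: patch_def)
  moreover have "y = (q $ 2 * cos \<omega> - q $ 1 * sin \<omega>) + (f * cos \<omega> + (- e) * sin \<omega>)" by (simp add: y_def algebra_simps)
  ultimately have y: "\<bar>y\<bar> \<le> \<eta> / 2" using z by linarith
  define \<phi> where "\<phi> = arctan (y / x)"
  have c: "cos \<phi> > 0" unfolding \<phi>_def using cos_arctan[of "y / x"] by (simp add: add_pos_nonneg)
  have "tan \<phi> = y / x" unfolding \<phi>_def by (rule tan_arctan)
  then have s: "y * cos \<phi> = x * sin \<phi>" using c x by (simp add: tan_def field_simps)
  have "\<bar>y / x\<bar> \<le> (\<eta> / 2) / (1 / 2)"
    unfolding abs_divide using x y by (intro frac_le) auto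
  moreover have "\<bar>\<phi>\<bar> \<le> \<bar>y / x\<bar>"
    unfolding \<phi>_def by (rule abs_arctan_le)
  ultimately have \<phi>: "\<bar>\<phi>\<bar> \<le> \<eta>" by simp
  have em: "e * m = q $ 3 * (p $ 1 - q $ 1)" "f * m = q $ 3 * (p $ 2 - q $ 2)" using m by (auto simp: e_def f_def)
  have "m * (y * cos \<phi> - x * sin \<phi>) = q $ 3 * (p $ 2 * cos (\<omega> + \<phi>) - p $ 1 * sin (\<omega> + \<phi>)) - p $ 3 * (q $ 2 * cos (\<omega> + \<phi>) - q $ 1 * sin (\<omega> + \<phi>))"
    unfolding x_def y_def cos_add sin_add using em unfolding m_def by algebra
  then show ?thesis using s by (intro that[OF \<phi>]) simp
qed

context periodic_lipschitz
begin

text \<open>By \<open>patch_node\<close> the great circle through the two points starts near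
  \<omega> and ends near \<open>\<omega> + pi\<close>. A slightly shorter arc between its two nodes
  is still shortened by \<open>g\<close>, so the gain in \<open>fill_int_geo_pt_near\<close> has a
  definite size.\<close>

lemma fill_int_strict:
  assumes bad: "norm (g (\<omega> + pi) - g \<omega>) < pi"
  obtains \<epsilon> z \<eta> where "0 < \<epsilon>" "\<epsilon> < 1" "0 < z" "z \<le> 1 / 16" "0 < \<eta>"
    "\<And>p q. p \<in> patch \<omega> z \<eta> \<Longrightarrow> q \<in> patch \<omega> z \<eta> \<Longrightarrow> norm (p - q) / 4 \<le> \<bar>p $ 3 - q $ 3\<bar> \<Longrightarrow>
       norm (fill_int g p - fill_int g q) \<le> (1 - \<epsilon>) * dH2 p q"
proof -
  define \<delta> where "\<delta> = pi - norm (g (\<omega> + pi) - g \<omega>)"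
  have \<delta>: "0 < \<delta>" "\<delta> \<le> pi" using bad by (auto simp: \<delta>_def)
  \<comment> \<open>Moving both ends of the antipodal pair by at most \<open>\<eta> + h\<close> and
    cutting \<open>2 * h\<close> off the arc reduces the deficit \<delta> by at most
    \<open>2 * \<eta> + 4 * h\<close>. The choices leave at least
    \<open>\<delta> / 2\<close>.\<close>
  define \<eta> where "\<eta> = min (\<delta> / 8) (1 / 8)"
  define z where "z = \<eta> / 16"
  define h where "h = \<delta> / 16"
  have \<eta>: "0 < \<eta>" "\<eta> \<le> \<delta> / 8" "\<eta> \<le> 1 / 8" using \<delta> by (auto simp: \<eta>_def)
  have z: "0 < z" "16 * z \<le> \<eta>" "z \<le> 1 / 16" using \<eta> by (auto simp: z_def)
  have h: "0 < h" "h \<le> pi / 2" "h < pi" using \<delta> by (auto simp: h_def)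
  then have h_sin: "0 < h * sin h" by (simp add: sin_gt_zero)
  \<comment> \<open>Since \<open>sin s \<le> 1\<close>, the factor
    \<open>(1 - k\<^sup>2) * sin s\<close> is at least the squared height, hence at least
    \<open>(z / 2)\<^sup>2\<close>; the factor \<open>1 / 2\<close> bounds
    \<open>cos s'\<close>.\<close>
  define \<kappa> where "\<kappa> = (z / 2)\<^sup>2 / (2 * pi) * (1 / 2 * (h * sin h))"
  have \<kappa>: "\<kappa> > 0" unfolding \<kappa>_def using z h_sin by simp
  define \<epsilon> where "\<epsilon> = min (\<kappa> * (\<delta> / 2)) (1 / 2)"
  have \<epsilon>: "0 < \<epsilon>" "\<epsilon> < 1" "\<epsilon> \<le> \<kappa> * (\<delta> / 2)" using \<kappa> \<delta> by (auto simp: \<epsilon>_def)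
  have core: "norm (fill_int g (geo_pt w k s) - fill_int g (geo_pt w k s')) \<le> (1 - \<epsilon>) * (s' - s)"
    if w: "\<bar>w - \<omega>\<bar> \<le> \<eta>" and k: "\<bar>k\<bar> < 1" and s: "0 < s" "s \<le> s'" "s' < pi / 2" "cos s' \<ge> 1 / 2"
      and p3: "geo_pt w k s $ 3 \<ge> z / 2" for w k s s'
  proof -
    define A where "A = (1 - k\<^sup>2) * sin s / (2 * pi) * (cos s' * (h * sin h))"
    define N where "N = pi - 2 * h - norm (g (w + (pi - h)) - g (w + h))"
    have ss: "0 \<le> sin s" "sin s \<le> 1" using s by (auto intro: sin_ge_zero)
    have k2: "0 \<le> 1 - k\<^sup>2" using k abs_square_less_1[of k] by simp
    have "(z / 2)\<^sup>2 \<le> (geo_pt w k s $ 3)\<^sup>2" using p3 z by (intro power_mono) auto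
    also have "\<dots> = (1 - k\<^sup>2) * (sin s * sin s)" using k geo_pt_height_sq[of k w s] by (simp add: height_sq_def power2_eq_square[of "sin s"])
    also have "\<dots> \<le> (1 - k\<^sup>2) * sin s" using ss k2 by (intro mult_left_mono) (auto simp: mult_left_le)
    finally have "\<kappa> \<le> (1 - k\<^sup>2) * sin s / (2 * pi) * (cos s' * (h * sin h))"
      unfolding \<kappa>_def using s h_sin k2 ss by (intro mult_mono divide_right_mono mult_right_mono) auto
    moreover have "\<delta> / 2 \<le> pi - 2 * h - norm (g (w + (pi - h)) - g (w + h))"
    proof -
      have "g (w + (pi - h)) - g (w + h) = (g (w + (pi - h)) - g (\<omega> + pi)) + (g (\<omega> + pi) - g \<omega>) + (g \<omega> - g (w + h))" by simp
      also have "norm \<dots> \<le> norm (g (w + (pi - h)) - g (\<omega> + pi)) + norm (g (\<omega> + pi) - g \<omega>) + norm (g \<omega> - g (w + h))"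
        by (intro norm_triangle_mono) auto
      also have "\<dots> \<le> (\<eta> + h) + (pi - \<delta>) + (\<eta> + h)"
        using norm_diff_le[of "w + (pi - h)" "\<omega> + pi"] norm_diff_le[of \<omega> "w + h"] w h
        by (simp add: \<delta>_def)
      finally show ?thesis using \<eta> by (simp add: h_def)
    qed
    ultimately have "\<kappa> * (\<delta> / 2) \<le> A * N" unfolding A_def[symmetric] N_def[symmetric]
      using \<kappa> \<delta> by (intro mult_mono) auto
    from mult_right_mono[OF order_trans[OF \<epsilon>(3) this], of "s' - s"]
    have "\<epsilon> * (s' - s) \<le> A * (s' - s) * N" using s by (simp add: mult_ac)
    then show ?thesis
      using fill_int_geo_pt_near[OF k s(1-3) less_imp_le[OF h(1)] h(2), of w, folded A_def N_def]
      by (simp add: left_diff_distrib)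
  qed
  show ?thesis
  proof (rule that[OF \<epsilon>(1,2) z(1,3) \<eta>(1)])
    fix p q assume p: "p \<in> patch \<omega> z \<eta>" and q: "q \<in> patch \<omega> z \<eta>" and d: "norm (p - q) / 4 \<le> \<bar>p $ 3 - q $ 3\<bar>"
    show "norm (fill_int g p - fill_int g q) \<le> (1 - \<epsilon>) * dH2 p q"
    proof (cases "p = q")
      case True
      have "p \<bullet> p = 1" using p by (simp add: patch_def norm_eq_1)
      then show ?thesis using True by (simp add: dH2_def)
    next
      case False
      obtain \<phi> where \<phi>: "\<bar>\<phi>\<bar> \<le> \<eta>"
        "q $ 3 * (p $ 2 * cos (\<omega> + \<phi>) - p $ 1 * sin (\<omega> + \<phi>)) = p $ 3 * (q $ 2 * cos (\<omega> + \<phi>) - q $ 1 * sin (\<omega> + \<phi>))"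
        using patch_node[OF p q False d z(1,2) \<eta>(3)] .
      have pp: "norm p = 1" "p $ 3 > 0" "norm q = 1" "q $ 3 > 0" using p q z by (auto simp: patch_def)
      obtain k s s' where ks: "p = geo_pt (\<omega> + \<phi>) k s" "q = geo_pt (\<omega> + \<phi>) k s'" "\<bar>k\<bar> < 1" "0 < s" "s < pi" "0 < s'" "s' < pi"
        "cos s = p $ 1 * cos (\<omega> + \<phi>) + p $ 2 * sin (\<omega> + \<phi>)" "cos s' = q $ 1 * cos (\<omega> + \<phi>) + q $ 2 * sin (\<omega> + \<phi>)"
        by (rule geo_pt_surj2[OF pp \<phi>(2)])
      \<comment> \<open>Both points are thus closer than \<open>pi / 2\<close> to the node, as
        \<open>fill_int_geo_pt_near\<close> demands. The numbers are
        \<open>3 / 4 * 7 / 8 - 1 / 32 > 1 / 2\<close>.\<close>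
      have half: "1 / 2 \<le> v $ 1 * cos (\<omega> + \<phi>) + v $ 2 * sin (\<omega> + \<phi>)" if v: "v \<in> patch \<omega> z \<eta>" for v
      proof -
        define x y where "x = v $ 1 * cos \<omega> + v $ 2 * sin \<omega>" and "y = v $ 2 * cos \<omega> - v $ 1 * sin \<omega>"
        have x: "x > 3 / 4" and y: "\<bar>y\<bar> \<le> 1 / 32" using v \<eta> by (auto simp: patch_def x_def y_def)
        have "\<bar>\<phi>\<bar> \<le> 1 / 8" using \<phi> \<eta> by simp
        then have "\<phi>\<^sup>2 \<le> (1 / 8)\<^sup>2" by (metis abs_ge_zero power2_abs power_mono)
        then have "cos \<phi> \<ge> 7 / 8" using cos_double_sin[of "\<phi> / 2"] power_mono[OF abs_sin_x_le_abs_x[of "\<phi> / 2"], of 2]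
          by (simp add: power_divide)
        then have "x * cos \<phi> \<ge> (3 / 4) * (7 / 8)" using x by (intro mult_mono) auto
        moreover have "\<bar>y * sin \<phi>\<bar> \<le> 1 / 32 * 1" unfolding abs_mult using y by (intro mult_mono) auto
        moreover have "v $ 1 * cos (\<omega> + \<phi>) + v $ 2 * sin (\<omega> + \<phi>) = x * cos \<phi> + y * sin \<phi>"
          unfolding x_def y_def cos_add sin_add by (simp add: algebra_simps)
        ultimately show ?thesis by linarith
      qed
      have cs: "cos s \<ge> 1 / 2" "cos s' \<ge> 1 / 2" using half[OF p] half[OF q] ks by auto
      have lt: "t < pi / 2" if "0 < t" "t < pi" "cos t \<ge> 1 / 2" for t
      proof (rule ccontr)
        assume "\<not> t < pi / 2"
        then have "cos t \<le> cos (pi / 2)" using that by (intro cos_monotone_0_pi_le) auto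
        then show False using that by simp
      qed
      have 3: "geo_pt (\<omega> + \<phi>) k s $ 3 \<ge> z / 2" "geo_pt (\<omega> + \<phi>) k s' $ 3 \<ge> z / 2"
        using p q unfolding ks(1,2)[symmetric] by (auto simp: patch_def)
      have w: "\<bar>(\<omega> + \<phi>) - \<omega>\<bar> \<le> \<eta>" using \<phi> by simp
      have dd: "dH2 p q = \<bar>s - s'\<bar>" unfolding dH2_def ks(1,2) using ks by (intro arccos_geo_pt) auto
      show ?thesis
      proof (cases "s \<le> s'")
        case True
        then show ?thesis using core[OF w ks(3,4) True lt[OF ks(6,7) cs(2)] cs(2) 3(1)] unfolding dd unfolding ks(1,2) by simp
      next
        case False
        then have "s' \<le> s" by simp
        from core[OF w ks(3,6) this lt[OF ks(4,5) cs(1)] cs(1) 3(2)] this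
        show ?thesis unfolding dd unfolding ks(1,2) by (simp add: norm_minus_commute)
      qed
    qed
  qed
qed

end

section \<open>Metric differentials\<close>

text \<open>The vector factor is merely bounded, so dominated convergence is applied to the scalars
  \<open>\<bar>\<phi> n t\<bar>\<close>.\<close>

lemma integral_null_seq:
  fixes g :: "real \<Rightarrow> 'a::banach" and \<phi> :: "nat \<Rightarrow> real \<Rightarrow> real"
  assumes g: "continuous_on {a..b} g" and \<phi>: "\<And>n. continuous_on {a..b} (\<phi> n)"
    and B: "\<And>n t. t \<in> {a..b} \<Longrightarrow> \<bar>\<phi> n t\<bar> \<le> B"
    and N: "negligible N" "\<And>t. t \<in> {a..b} - N \<Longrightarrow> (\<lambda>n. \<phi> n t) \<longlonglongrightarrow> 0"
  shows "(\<lambda>n. integral {a..b} (\<lambda>t. \<phi> n t *\<^sub>R g t)) \<longlonglongrightarrow> 0"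
proof -
  have "bounded (g ` {a..b})" using g by (intro compact_imp_bounded compact_continuous_image) auto
  then obtain G where G: "0 < G" "\<forall>x\<in>g ` {a..b}. norm x \<le> G" by (auto simp: bounded_pos)
  define f where "f n t = (if t \<in> N then 0 else \<bar>\<phi> n t\<bar>)" for n t
  have i\<phi>: "(\<lambda>t. \<bar>\<phi> n t\<bar>) integrable_on {a..b}" for n
    by (intro integrable_continuous_real continuous_intros \<phi>)
  have "(\<lambda>n. integral {a..b} (f n)) \<longlonglongrightarrow> integral {a..b} (\<lambda>t. 0)"
  proof (rule dominated_convergence(2)[where h = "\<lambda>t. \<bar>B\<bar>"])
    show "f n integrable_on {a..b}" for n
      by (rule integrable_spike[OF i\<phi>[of n] N(1)]) (simp add: f_def)
    show "norm (f n t) \<le> \<bar>B\<bar>" if "t \<in> {a..b}" for n t using B[OF that, of n] by (auto simp: f_def)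
    show "(\<lambda>n. f n t) \<longlonglongrightarrow> 0" if "t \<in> {a..b}" for t
      using tendsto_rabs_zero[OF N(2)[of t]] that by (cases "t \<in> N") (simp_all add: f_def)
  qed auto
  moreover have "integral {a..b} (f n) = integral {a..b} (\<lambda>t. \<bar>\<phi> n t\<bar>)" for n
    by (rule integral_spike[OF N(1)]) (simp add: f_def)
  ultimately have "(\<lambda>n. G * integral {a..b} (\<lambda>t. \<bar>\<phi> n t\<bar>)) \<longlonglongrightarrow> G * 0"
    by (intro tendsto_mult tendsto_const) simp
  then have lim: "(\<lambda>n. G * integral {a..b} (\<lambda>t. \<bar>\<phi> n t\<bar>)) \<longlonglongrightarrow> 0" by simp
  have "norm (integral {a..b} (\<lambda>t. \<phi> n t *\<^sub>R g t)) \<le> G * integral {a..b} (\<lambda>t. \<bar>\<phi> n t\<bar>)" for n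
  proof -
    have "norm (integral {a..b} (\<lambda>t. \<phi> n t *\<^sub>R g t)) \<le> integral {a..b} (\<lambda>t. G * \<bar>\<phi> n t\<bar>)"
    proof (rule integral_norm_bound_integral)
      show "norm (\<phi> n t *\<^sub>R g t) \<le> G * \<bar>\<phi> n t\<bar>" if "t \<in> {a..b}" for t
        using G that mult_right_mono[of "norm (g t)" G "\<bar>\<phi> n t\<bar>"] by (simp add: mult.commute)
    qed (intro integrable_continuous_real continuous_intros \<phi> g)+
    then show ?thesis by simp
  qed
  then show ?thesis by (intro Lim_null_comparison[OF _ lim] always_eventually) simp
qed

lemma integral_quotient_tendsto_0:
  fixes g :: "real \<Rightarrow> 'a::banach" and \<phi> :: "real \<Rightarrow> real \<Rightarrow> real"
  assumes g: "continuous_on {a..b} g" and N: "negligible N" and d: "d > 0"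
    and \<phi>: "\<And>h. 0 < \<bar>h\<bar> \<Longrightarrow> \<bar>h\<bar> < d \<Longrightarrow> continuous_on {a..b} (\<phi> h)"
    and B: "\<And>h t. 0 < \<bar>h\<bar> \<Longrightarrow> \<bar>h\<bar> < d \<Longrightarrow> t \<in> {a..b} \<Longrightarrow> \<bar>\<phi> h t\<bar> \<le> B"
    and lim: "\<And>t. t \<in> {a..b} - N \<Longrightarrow> ((\<lambda>h. \<phi> h t) \<longlongrightarrow> 0) (at 0)"
  shows "((\<lambda>h. integral {a..b} (\<lambda>t. \<phi> h t *\<^sub>R g t)) \<longlongrightarrow> 0) (at 0)"
  unfolding tendsto_at_iff_sequentially comp_def
proof (intro allI impI)
  fix X :: "nat \<Rightarrow> real" assume X0: "\<forall>i. X i \<in> UNIV - {0}" and X: "X \<longlonglongrightarrow> 0"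
  have "eventually (\<lambda>n. \<bar>X n\<bar> < d) sequentially"
    using order_tendstoD(2)[OF tendsto_rabs[OF X], of d] d by simp
  then obtain M where M: "\<And>n. n \<ge> M \<Longrightarrow> \<bar>X n\<bar> < d" by (auto simp: eventually_sequentially)
  have "(\<lambda>n. integral {a..b} (\<lambda>t. \<phi> (X (n + M)) t *\<^sub>R g t)) \<longlonglongrightarrow> 0"
  proof (rule integral_null_seq[OF g _ _ N, where B = B])
    fix t assume "t \<in> {a..b} - N"
    from lim[OF this] have "(\<lambda>n. \<phi> (X n) t) \<longlonglongrightarrow> 0"
      unfolding tendsto_at_iff_sequentially comp_def using X0 X by blast
    then show "(\<lambda>n. \<phi> (X (n + M)) t) \<longlonglongrightarrow> 0" by (rule LIMSEQ_ignore_initial_segment)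
  qed (use X0 M in \<open>auto intro!: \<phi> B\<close>)
  then show "(\<lambda>n. integral {a..b} (\<lambda>t. \<phi> (X n) t *\<^sub>R g t)) \<longlonglongrightarrow> 0" by (rule LIMSEQ_offset)
qed

text \<open>Convergence follows from completeness; the product of \<open>\<psi>\<close> and \<open>g\<close> is never integrated.\<close>

lemma integral_quotient_convergent:
  fixes g :: "real \<Rightarrow> 'a::banach" and \<phi> :: "real \<Rightarrow> real \<Rightarrow> real"
  assumes g: "continuous_on {a..b} g" and N: "negligible N" and d: "d > 0"
    and \<phi>: "\<And>h. 0 < \<bar>h\<bar> \<Longrightarrow> \<bar>h\<bar> < d \<Longrightarrow> continuous_on {a..b} (\<phi> h)"
    and B: "\<And>h t. 0 < \<bar>h\<bar> \<Longrightarrow> \<bar>h\<bar> < d \<Longrightarrow> t \<in> {a..b} \<Longrightarrow> \<bar>\<phi> h t\<bar> \<le> B"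
    and lim: "\<And>t. t \<in> {a..b} - N \<Longrightarrow> ((\<lambda>h. \<phi> h t) \<longlongrightarrow> \<psi> t) (at 0)"
  shows "\<exists>l. ((\<lambda>h. integral {a..b} (\<lambda>t. \<phi> h t *\<^sub>R g t)) \<longlongrightarrow> l) (at 0)"
proof -
  define Q where "Q h = integral {a..b} (\<lambda>t. \<phi> h t *\<^sub>R g t)" for h
  \<comment> \<open>Comparing two arbitrary null sequences gives both the Cauchy property along one
    of them and the independence of the limit from the sequence.\<close>
  have two: "(\<lambda>n. Q (X n) - Q (Y n)) \<longlonglongrightarrow> 0"
    if X: "\<And>n. 0 < \<bar>X n\<bar> \<and> \<bar>X n\<bar> < d" "X \<longlonglongrightarrow> 0" and Y: "\<And>n. 0 < \<bar>Y n\<bar> \<and> \<bar>Y n\<bar> < d" "Y \<longlonglongrightarrow> 0" for X Y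
  proof -
    have c: "continuous_on {a..b} (\<phi> (X n))" "continuous_on {a..b} (\<phi> (Y n))" for n using X Y by (auto intro: \<phi>)
    have "(\<lambda>n. integral {a..b} (\<lambda>t. (\<phi> (X n) t - \<phi> (Y n) t) *\<^sub>R g t)) \<longlonglongrightarrow> 0"
    proof (rule integral_null_seq[OF g _ _ N, where B = "2 * B"])
      show "continuous_on {a..b} (\<lambda>t. \<phi> (X n) t - \<phi> (Y n) t)" for n by (intro continuous_intros c)
      show "\<bar>\<phi> (X n) t - \<phi> (Y n) t\<bar> \<le> 2 * B" if "t \<in> {a..b}" for n t
        using B[of "X n" t] B[of "Y n" t] X(1)[of n] Y(1)[of n] that by fastforce
      fix t assume t: "t \<in> {a..b} - N"
      have "(\<lambda>n. \<phi> (X n) t) \<longlonglongrightarrow> \<psi> t" "(\<lambda>n. \<phi> (Y n) t) \<longlonglongrightarrow> \<psi> t"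
        using lim[OF t] X Y unfolding tendsto_at_iff_sequentially comp_def by force+
      then show "(\<lambda>n. \<phi> (X n) t - \<phi> (Y n) t) \<longlonglongrightarrow> 0" using tendsto_diff by fastforce
    qed
    moreover have "integral {a..b} (\<lambda>t. (\<phi> (X n) t - \<phi> (Y n) t) *\<^sub>R g t) = Q (X n) - Q (Y n)" for n
      unfolding Q_def scaleR_diff_left
      by (intro integral_diff integrable_continuous_real continuous_intros c g)
    ultimately show ?thesis by simp
  qed
  define e where "e n = d / (real n + 2)" for n :: nat
  have e: "0 < \<bar>e n\<bar> \<and> \<bar>e n\<bar> < d" for n
  proof -
    have "d * 1 < d * (real n + 2)" using d by (intro mult_strict_left_mono) auto
    then show ?thesis using d by (simp add: e_def divide_less_eq)
  qed
  have "(\<lambda>n. d * inverse (real (Suc (Suc n)))) \<longlonglongrightarrow> d * 0"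
    by (intro tendsto_mult tendsto_const LIMSEQ_Suc[OF LIMSEQ_inverse_real_of_nat])
  then have e0: "e \<longlonglongrightarrow> 0" by (simp add: e_def[abs_def] divide_inverse add.commute)
  have "Cauchy (\<lambda>n. Q (e n))"
  proof (rule ccontr)
    assume "\<not> Cauchy (\<lambda>n. Q (e n))"
    then obtain \<epsilon> where \<epsilon>: "\<epsilon> > 0" "\<forall>M. \<exists>m\<ge>M. \<exists>n\<ge>M. \<not> dist (Q (e m)) (Q (e n)) < \<epsilon>"
      unfolding Cauchy_def by blast
    then obtain m n where mn: "\<And>M. m M \<ge> M \<and> n M \<ge> M \<and> \<not> dist (Q (e (m M))) (Q (e (n M))) < \<epsilon>" by metis
    have "filterlim m at_top sequentially" "filterlim n at_top sequentially"
      using mn by (auto intro!: filterlim_at_top_mono[OF filterlim_ident] always_eventually)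
    then have "(\<lambda>M. e (m M)) \<longlonglongrightarrow> 0" "(\<lambda>M. e (n M)) \<longlonglongrightarrow> 0"
      using filterlim_compose[OF e0] by blast+
    then have "(\<lambda>M. Q (e (m M)) - Q (e (n M))) \<longlonglongrightarrow> 0" using e by (intro two) auto
    then have "eventually (\<lambda>M. dist (Q (e (m M)) - Q (e (n M))) 0 < \<epsilon>) sequentially" using \<epsilon>(1) by (rule tendstoD)
    then show False using mn by (auto simp: dist_norm eventually_sequentially)
  qed
  then obtain l where l: "(\<lambda>n. Q (e n)) \<longlonglongrightarrow> l" using Cauchy_convergent_iff convergent_def by blast
  have "(Q \<longlongrightarrow> l) (at 0)"
    unfolding tendsto_at_iff_sequentially comp_def
  proof (intro allI impI)
    fix X :: "nat \<Rightarrow> real" assume X0: "\<forall>i. X i \<in> UNIV - {0}" and X: "X \<longlonglongrightarrow> 0"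
    have "eventually (\<lambda>n. \<bar>X n\<bar> < d) sequentially"
      using order_tendstoD(2)[OF tendsto_rabs[OF X], of d] d by simp
    then obtain M where M: "\<And>n. n \<ge> M \<Longrightarrow> \<bar>X n\<bar> < d" by (auto simp: eventually_sequentially)
    have "(\<lambda>n. Q (X (n + M)) - Q (e n)) \<longlonglongrightarrow> 0"
      by (rule two) (use X0 M e e0 LIMSEQ_ignore_initial_segment[OF X] in auto)
    from tendsto_add[OF this l] have "(\<lambda>n. Q (X (n + M))) \<longlonglongrightarrow> l" by simp
    then show "(\<lambda>n. Q (X n)) \<longlonglongrightarrow> l" by (rule LIMSEQ_offset)
  qed
  then show ?thesis unfolding Q_def by blast
qed

section \<open>The stereographic chart\<close>

lemma norm_vec2: "(norm (u :: real^2))\<^sup>2 = (u $ 1)\<^sup>2 + (u $ 2)\<^sup>2"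
  unfolding power2_norm_eq_inner inner_vec_def by (simp add: sum_2 power2_eq_square)

lemma stereo_inner:
  "stereo_inv u \<bullet> stereo_inv w = (4 * (u \<bullet> w) + (1 - (norm u)\<^sup>2) * (1 - (norm w)\<^sup>2)) / ((1 + (norm u)\<^sup>2) * (1 + (norm w)\<^sup>2))"
  unfolding stereo_inv_def inner_vec_def sum_3 sum_2 vector_3 inner_real_def times_divide_times_eq
    add_divide_distrib[symmetric]
  by (rule arg_cong2[where f = "(/)"]) (simp_all add: algebra_simps)

lemma norm_stereo [simp]: "norm (stereo_inv u) = 1"
proof -
  have nz: "1 + (norm u)\<^sup>2 \<noteq> 0" by (metis add_pos_nonneg zero_le_power2 zero_less_one less_irrefl)
  have "4 * (norm u)\<^sup>2 + (1 - (norm u)\<^sup>2) * (1 - (norm u)\<^sup>2) = (1 + (norm u)\<^sup>2) * (1 + (norm u)\<^sup>2)" by algebra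
  then have "stereo_inv u \<bullet> stereo_inv u = 1"
    unfolding stereo_inner power2_norm_eq_inner[of u, symmetric] using nz by simp
  then show ?thesis by (simp add: norm_eq_1)
qed

lemma stereo_chord:
  "(norm (stereo_inv u - stereo_inv w))\<^sup>2 = 4 * (norm (u - w))\<^sup>2 / ((1 + (norm u)\<^sup>2) * (1 + (norm w)\<^sup>2))"
proof -
  have nz: "1 + (norm u)\<^sup>2 \<noteq> 0" "1 + (norm w)\<^sup>2 \<noteq> 0" by (metis add_pos_nonneg zero_le_power2 zero_less_one less_irrefl)+
  have 1: "(norm (v - v'))\<^sup>2 = (norm v)\<^sup>2 + (norm v')\<^sup>2 - 2 * (v \<bullet> v')" for v v' :: "'b::real_inner"
    by (simp add: power2_norm_eq_inner inner_diff inner_commute)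
  have 2: "1 + 1 - 2 * (X / D) = Y / D" if "D \<noteq> 0" "2 * D - 2 * X = Y" for X Y D :: real
    using that by (simp add: field_simps)
  show ?thesis unfolding 1 stereo_inner norm_stereo one_power2
  proof (rule 2)
    show "(1 + (norm u)\<^sup>2) * (1 + (norm w)\<^sup>2) \<noteq> 0" using nz by simp
  qed (simp add: algebra_simps)
qed

lemma stereo_3: "stereo_inv u $ 3 = (1 - (norm u)\<^sup>2) / (1 + (norm u)\<^sup>2)"
  by (simp add: stereo_inv_def)

lemma stereo_3_pos: "norm u < 1 \<Longrightarrow> stereo_inv u $ 3 > 0"
  unfolding stereo_3 by (simp add: abs_square_less_1 add_pos_nonneg)

lemma stereo_lipschitz: "norm (stereo_inv u - stereo_inv w) \<le> 2 * norm (u - w)"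
proof (rule power2_le_imp_le)
  have "1 * 1 \<le> (1 + (norm u)\<^sup>2) * (1 + (norm w)\<^sup>2)" by (intro mult_mono) auto
  then have "4 * (norm (u - w))\<^sup>2 / ((1 + (norm u)\<^sup>2) * (1 + (norm w)\<^sup>2)) \<le> 4 * (norm (u - w))\<^sup>2 / 1"
    by (intro divide_left_mono) auto
  then show "(norm (stereo_inv u - stereo_inv w))\<^sup>2 \<le> (2 * norm (u - w))\<^sup>2"
    unfolding stereo_chord by (simp add: power_mult_distrib)
qed simp

lemma continuous_stereo: "isCont stereo_inv u"
proof -
  have "2-lipschitz_on UNIV stereo_inv" by (intro lipschitz_onI) (auto simp: dist_norm stereo_lipschitz)
  then show ?thesis using lipschitz_on_continuous_on continuous_on_eq_continuous_at by blast
qed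

text \<open>The hypotheses at \<open>u\<close> avoid the kink of \<open>max\<close> and the points
  where a square root vanishes; \<open>y u = 1\<close> would be the pole.\<close>

lemma kernel_differentiable:
  fixes c y :: "'b::real_normed_vector \<Rightarrow> real"
  assumes c: "c differentiable (at u)" and y: "y differentiable (at u)"
    and u: "c u \<noteq> 0" "(c u)\<^sup>2 < 1" "y u < 1"
  shows "(\<lambda>x. kernel (c x) (y x)) differentiable (at u)"
proof -
  obtain c' y' where c': "(c has_derivative c') (at u)" and y': "(y has_derivative y') (at u)"
    using c y unfolding differentiable_def by blast
  have cc: "(c \<longlongrightarrow> c u) (at u)"
    using differentiable_imp_continuous_within[OF c] by (simp add: isCont_def)
  \<comment> \<open>The factor \<sigma> resolves the maximum: it is \<open>1\<close> where
    \<open>c\<close> is positive and \<open>0\<close> where \<open>c\<close> is negative.\<close>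
  have s: "(\<lambda>x. \<sigma> * (c x * y x / (2 * sqrt (1 - (c x)\<^sup>2) ^ 3)) + (1 - sqrt (1 - y x)) / (2 * pi)) differentiable (at u)" for \<sigma>
  proof -
    have sq: "(\<lambda>x. sqrt (f x)) differentiable (at u)" if "f differentiable (at u)" "f u > 0" for f :: "'b \<Rightarrow> real"
      using that has_derivative_real_sqrt unfolding differentiable_def by blast
    have "(\<lambda>x. sqrt (1 - (c x)\<^sup>2)) differentiable (at u)" "(\<lambda>x. sqrt (1 - y x)) differentiable (at u)"
      using u by (auto intro!: sq derivative_intros c y)
    then show ?thesis using u by (intro derivative_intros c y) auto
  qed
  have tr: "f' differentiable (at u)"
    if "f differentiable (at u)" "eventually (\<lambda>x. f x = f' x) (at u)" "f u = f' u" for f f' :: "'b \<Rightarrow> real"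
    using that has_derivative_transform_eventually[of f _ u UNIV f'] unfolding differentiable_def by blast
  show ?thesis
  proof (cases "c u > 0")
    case True
    have "eventually (\<lambda>x. c x > 0) (at u)" using order_tendstoD(1)[OF cc True] .
    then have "eventually (\<lambda>x. 1 * (c x * y x / (2 * sqrt (1 - (c x)\<^sup>2) ^ 3)) + (1 - sqrt (1 - y x)) / (2 * pi) = kernel (c x) (y x)) (at u)"
      by eventually_elim (simp add: kernel_def)
    then show ?thesis by (rule tr[OF s]) (use True in \<open>simp add: kernel_def\<close>)
  next
    case False
    then have "c u < 0" using u by simp
    then have "eventually (\<lambda>x. c x < 0) (at u)" using order_tendstoD(2)[OF cc] by blast
    then have "eventually (\<lambda>x. 0 * (c x * y x / (2 * sqrt (1 - (c x)\<^sup>2) ^ 3)) + (1 - sqrt (1 - y x)) / (2 * pi) = kernel (c x) (y x)) (at u)"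
      by eventually_elim (simp add: kernel_def)
    then show ?thesis by (rule tr[OF s]) (use False in \<open>simp add: kernel_def\<close>)
  qed
qed

lemma stereo_cap: "norm u < 1 \<Longrightarrow> z \<le> stereo_inv u $ 3 \<Longrightarrow> stereo_inv u \<in> cap z"
  by (simp add: cap_def)

lemma fill_dens_stereo_differentiable:
  assumes u: "u \<noteq> 0" "norm u < 1" and \<theta>: "u $ 1 * cos \<theta> + u $ 2 * sin \<theta> \<noteq> 0"
  shows "(\<lambda>w. fill_dens (stereo_inv w) \<theta>) differentiable (at u)"
proof (rule kernel_differentiable)
  have nz: "1 + (w \<bullet> w) \<noteq> 0" for w :: "real^2"
    using inner_ge_zero[of w] by linarith
  have d: "(\<lambda>w. w $ i) differentiable (at u)" "(\<lambda>w. w \<bullet> w) differentiable (at u)" for i :: 2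
    by (auto intro!: bounded_linear_imp_differentiable bounded_linear_vec_nth differentiable_inner)
  show "(\<lambda>w. stereo_inv w $ 1 * cos \<theta> + stereo_inv w $ 2 * sin \<theta>) differentiable (at u)"
    "(\<lambda>w. (stereo_inv w $ 3)\<^sup>2) differentiable (at u)"
    unfolding stereo_inv_def vector_3 power2_norm_eq_inner
    using nz by (auto intro!: derivative_intros d)
  have 3: "stereo_inv u $ 3 > 0" by (rule stereo_3_pos[OF u(2)])
  have "norm u > 0" using u by simp
  then have "stereo_inv u $ 3 < 1" unfolding stereo_3 by (simp add: divide_less_eq add_pos_nonneg)
  then show "(stereo_inv u $ 3)\<^sup>2 < 1" using 3 by (simp add: power_less_one_iff abs_square_less_1)
  have nz': "1 + (norm u)\<^sup>2 \<noteq> 0" using nz[of u] by (simp add: power2_norm_eq_inner)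
  have "stereo_inv u $ 1 * cos \<theta> + stereo_inv u $ 2 * sin \<theta> = 2 * (u $ 1 * cos \<theta> + u $ 2 * sin \<theta>) / (1 + (norm u)\<^sup>2)"
    by (simp add: stereo_inv_def add_divide_distrib distrib_left mult.assoc)
  then show "stereo_inv u $ 1 * cos \<theta> + stereo_inv u $ 2 * sin \<theta> \<noteq> 0" using \<theta> nz' by simp
  have "\<bar>stereo_inv u $ 1 * cos \<theta> + stereo_inv u $ 2 * sin \<theta>\<bar> \<le> sqrt (1 - (stereo_inv u $ 3)\<^sup>2)"
    using 3 u by (intro cap_dot_le stereo_cap) auto
  also have "\<dots> < 1" using 3 by simp
  finally show "(stereo_inv u $ 1 * cos \<theta> + stereo_inv u $ 2 * sin \<theta>)\<^sup>2 < 1" by (simp add: abs_square_less_1)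
qed

lemma has_derivative_quotient:
  fixes f :: "'b::real_normed_vector \<Rightarrow> real"
  assumes "(f has_derivative D) (at u)"
  shows "((\<lambda>h. (f (u + h *\<^sub>R v) - f u) / h) \<longlongrightarrow> D v) (at 0)"
proof -
  have "((\<lambda>h. u + h *\<^sub>R v) has_derivative (\<lambda>h. h *\<^sub>R v)) (at 0)"
    by (auto intro!: derivative_eq_intros)
  then have "((\<lambda>h. f (u + h *\<^sub>R v)) has_derivative (\<lambda>h. D (h *\<^sub>R v))) (at 0)"
    by (rule has_derivative_compose) (use assms in simp)
  moreover have "(\<lambda>h. D (h *\<^sub>R v)) = (*) (D v)"
    using linear_cmul[OF has_derivative_linear[OF assms]] by (auto simp: mult.commute)
  ultimately have "((\<lambda>h. f (u + h *\<^sub>R v)) has_real_derivative D v) (at 0)"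
    by (simp add: has_field_derivative_def)
  then show ?thesis by (simp add: DERIV_def)
qed

text \<open>These are the angles orthogonal to \<open>u\<close>, where the density has its kink.
  They lie in a countable set, so the difference quotients converge at almost every angle.\<close>

lemma negligible_dot_zero:
  fixes u :: "real^2"
  assumes "u \<noteq> 0"
  shows "negligible {\<theta>. u $ 1 * cos \<theta> + u $ 2 * sin \<theta> = 0}"
proof -
  have "(u $ 1)\<^sup>2 + (u $ 2)\<^sup>2 \<noteq> 0" 
  proof -
    have "u = 0 \<longleftrightarrow> u $ 1 = 0 \<and> u $ 2 = 0" by (simp add: vec_eq_iff forall_2)
    then have "\<not> (u $ 1 = 0 \<and> u $ 2 = 0)" using assms by blast
    then show ?thesis unfolding sum_power2_eq_zero_iff .
  qed
  then obtain r where r: "r\<^sup>2 = (u $ 1)\<^sup>2 + (u $ 2)\<^sup>2" "r \<noteq> 0"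
    by (metis add_nonneg_nonneg real_sqrt_pow2 zero_le_power2 zero_power2)
  have "(u $ 1 / r)\<^sup>2 + (u $ 2 / r)\<^sup>2 = 1"
    unfolding power_divide add_divide_distrib[symmetric] r(1)[symmetric] using r(2) by simp
  then obtain \<omega> where "u $ 1 / r = cos \<omega>" "u $ 2 / r = sin \<omega>" using sincos_total_2pi by metis
  then have "u $ 1 = r * cos \<omega>" "u $ 2 = r * sin \<omega>" using r by (auto simp: field_simps)
  then have "u $ 1 * cos \<theta> + u $ 2 * sin \<theta> = r * cos (\<theta> - \<omega>)" for \<theta> by (simp add: cos_diff algebra_simps)
  then have "\<theta> \<in> range (\<lambda>i::int. \<omega> + of_int i * (pi / 2))" if "u $ 1 * cos \<theta> + u $ 2 * sin \<theta> = 0" for \<theta>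
  proof -
    have "cos (\<theta> - \<omega>) = 0" using that r \<open>\<And>\<theta>. u $ 1 * cos \<theta> + u $ 2 * sin \<theta> = r * cos (\<theta> - \<omega>)\<close> by simp
    then obtain i where "\<theta> - \<omega> = of_int i * (pi / 2)" unfolding cos_zero_iff_int by blast
    then show ?thesis by (intro image_eqI[of _ _ i]) (auto simp: algebra_simps)
  qed
  then have "{\<theta>. u $ 1 * cos \<theta> + u $ 2 * sin \<theta> = 0} \<subseteq> range (\<lambda>i::int. \<omega> + of_int i * (pi / 2))" by blast
  then have "countable {\<theta>. u $ 1 * cos \<theta> + u $ 2 * sin \<theta> = 0}" by (rule countable_subset) simp
  then show ?thesis by (simp add: negligible_iff_null_sets countable_imp_null_set_lborel null_sets_completionI)
qed

context periodic_lipschitz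
begin

text \<open>The difference quotients of the density are bounded on a cap and converge off the
  negligible set \<open>N\<close>, so those of \<open>fill_int\<close> converge. The centre is
  excluded because the density contains the distance to the axis.\<close>

lemma fill_int_stereo_derivative:
  assumes u: "u \<noteq> 0" "norm u < 1"
  obtains l :: "real^2 \<Rightarrow> 'a" where "linear l"
    "\<And>v. ((\<lambda>h. (fill_int g (stereo_inv (u + h *\<^sub>R v)) - fill_int g (stereo_inv u)) /\<^sub>R h) \<longlongrightarrow> l v) (at 0)"
proof -
  define z where "z = stereo_inv u $ 3 / 2"
  have z: "z > 0" using stereo_3_pos[OF u(2)] by (simp add: z_def)
  have hz: "stereo_inv u \<in> cap z" using z by (simp add: cap_def z_def)
  obtain L where L: "L \<ge> 0" "\<And>p q \<theta>. p \<in> cap z \<Longrightarrow> q \<in> cap z \<Longrightarrow> \<bar>fill_dens p \<theta> - fill_dens q \<theta>\<bar> \<le> L * norm (p - q)"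
    using fill_dens_lipschitz[OF z] by metis
  define \<phi> where "\<phi> v h \<theta> = (fill_dens (stereo_inv (u + h *\<^sub>R v)) \<theta> - fill_dens (stereo_inv u) \<theta>) / h" for v h \<theta>
  define Q where "Q v h = (fill_int g (stereo_inv (u + h *\<^sub>R v)) - fill_int g (stereo_inv u)) /\<^sub>R h" for v h
  define B where "B v = 2 * L * norm v" for v :: "real^2"
  define N where "N = {\<theta>. u $ 1 * cos \<theta> + u $ 2 * sin \<theta> = (0::real)}"
  have N: "negligible N" unfolding N_def by (rule negligible_dot_zero[OF u(1)])
  have gc: "continuous_on {-pi..pi} g" by (intro cont continuous_intros)
  have "\<exists>d>0. \<forall>h. 0 < \<bar>h\<bar> \<longrightarrow> \<bar>h\<bar> < d \<longrightarrow> stereo_inv (u + h *\<^sub>R v) \<in> cap z" for v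
  proof -
    have "((\<lambda>h. u + h *\<^sub>R v) \<longlongrightarrow> u + 0 *\<^sub>R v) (at 0)" by (intro tendsto_intros)
    then have "((\<lambda>h. stereo_inv (u + h *\<^sub>R v)) \<longlongrightarrow> stereo_inv u) (at 0)"
      using isCont_tendsto_compose[OF continuous_stereo] by simp
    from order_tendstoD(1)[OF tendsto_vec_nth[OF this, of 3], of z]
    have "eventually (\<lambda>h. z < stereo_inv (u + h *\<^sub>R v) $ 3) (at 0)" using z by (simp add: z_def)
    then show ?thesis unfolding eventually_at by (force simp: cap_def)
  qed
  then obtain d where d: "\<And>v. d v > 0" "\<And>v h. 0 < \<bar>h\<bar> \<Longrightarrow> \<bar>h\<bar> < d v \<Longrightarrow> stereo_inv (u + h *\<^sub>R v) \<in> cap z" by metis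
  have c\<phi>: "continuous_on {-pi..pi} (\<phi> v h)" if "0 < \<bar>h\<bar>" "\<bar>h\<bar> < d v" for v h
    unfolding \<phi>_def using that
    by (intro continuous_intros continuous_on_fill_dens[OF d(2)[OF that] z] continuous_on_fill_dens[OF hz z]) auto
  have b\<phi>: "\<bar>\<phi> v h \<theta>\<bar> \<le> B v" if "0 < \<bar>h\<bar>" "\<bar>h\<bar> < d v" for v h \<theta>
  proof -
    have "\<bar>fill_dens (stereo_inv (u + h *\<^sub>R v)) \<theta> - fill_dens (stereo_inv u) \<theta>\<bar> \<le> L * norm (stereo_inv (u + h *\<^sub>R v) - stereo_inv u)"
      by (rule L(2)[OF d(2)[OF that] hz])
    also have "\<dots> \<le> L * (2 * norm (h *\<^sub>R v))"
      using stereo_lipschitz[of "u + h *\<^sub>R v" u] L(1) by (intro mult_left_mono) auto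
    finally show ?thesis using that by (simp add: \<phi>_def B_def abs_divide divide_le_eq mult_ac)
  qed
  have "\<exists>D. \<theta> \<notin> N \<longrightarrow> ((\<lambda>w. fill_dens (stereo_inv w) \<theta>) has_derivative D) (at u)" for \<theta>
    using fill_dens_stereo_differentiable[OF u, of \<theta>] unfolding differentiable_def N_def by auto
  then have "\<exists>D. \<forall>\<theta>. \<theta> \<notin> N \<longrightarrow> ((\<lambda>w. fill_dens (stereo_inv w) \<theta>) has_derivative D \<theta>) (at u)"
    by (intro choice allI)
  then obtain D where D: "\<And>\<theta>. \<theta> \<notin> N \<Longrightarrow> ((\<lambda>w. fill_dens (stereo_inv w) \<theta>) has_derivative D \<theta>) (at u)" by blast
  have lim: "((\<lambda>h. \<phi> v h \<theta>) \<longlongrightarrow> D \<theta> v) (at 0)" if "\<theta> \<notin> N" for v \<theta>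
    unfolding \<phi>_def by (rule has_derivative_quotient[OF D[OF that]])
  have Q: "Q v h = integral {-pi..pi} (\<lambda>\<theta>. \<phi> v h \<theta> *\<^sub>R g \<theta>)" if "0 < \<bar>h\<bar>" "\<bar>h\<bar> < d v" for v h
  proof -
    have c: "continuous_on {-pi..pi} (fill_dens (stereo_inv (u + h *\<^sub>R v)))" "continuous_on {-pi..pi} (fill_dens (stereo_inv u))"
      using continuous_on_fill_dens[OF d(2)[OF that] z] continuous_on_fill_dens[OF hz z] by auto
    have "fill_int g (stereo_inv (u + h *\<^sub>R v)) - fill_int g (stereo_inv u) =
       integral {-pi..pi} (\<lambda>\<theta>. fill_dens (stereo_inv (u + h *\<^sub>R v)) \<theta> *\<^sub>R g \<theta> - fill_dens (stereo_inv u) \<theta> *\<^sub>R g \<theta>)"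
      unfolding fill_int_def by (intro integral_diff[symmetric] integrable_continuous_real continuous_on_scaleR c gc)
    then show ?thesis
      unfolding Q_def \<phi>_def integral_cmul[symmetric]
      by (simp add: scaleR_diff_left[symmetric] divide_inverse mult.commute integral_cmul[symmetric])
  qed
  have "\<exists>l. (Q v \<longlongrightarrow> l) (at 0)" for v
  proof -
    have "\<exists>l. ((\<lambda>h. integral {-pi..pi} (\<lambda>\<theta>. \<phi> v h \<theta> *\<^sub>R g \<theta>)) \<longlongrightarrow> l) (at 0)"
      by (rule integral_quotient_convergent[OF gc N d(1)[of v] c\<phi> b\<phi> lim]) auto
    moreover have "eventually (\<lambda>h. integral {-pi..pi} (\<lambda>\<theta>. \<phi> v h \<theta> *\<^sub>R g \<theta>) = Q v h) (at 0)"
      unfolding eventually_at using d(1)[of v] by (auto simp: Q intro!: exI[of _ "d v"])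
    ultimately show ?thesis using tendsto_cong by fast
  qed
  then obtain l where l: "\<And>v. (Q v \<longlongrightarrow> l v) (at 0)" by metis
  \<comment> \<open>Linearity is proved before the limit: off \<open>N\<close> the combined scalar
    quotients tend to zero, because each \<open>D \<theta>\<close> is linear, and hence so do their
    integrals.\<close>
  have comb: "l x = a *\<^sub>R l v + b *\<^sub>R l w" if x: "x = a *\<^sub>R v + b *\<^sub>R w" for x v w a b
  proof -
    define e where "e = Min {d x, d v, d w}"
    have e: "e > 0" "e \<le> d x" "e \<le> d v" "e \<le> d w" unfolding e_def using d(1) by auto
    have cc: "continuous_on {-pi..pi} (\<phi> x h)" "continuous_on {-pi..pi} (\<phi> v h)" "continuous_on {-pi..pi} (\<phi> w h)"
      if "0 < \<bar>h\<bar>" "\<bar>h\<bar> < e" for h using c\<phi> that e by auto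
    have "((\<lambda>h. integral {-pi..pi} (\<lambda>\<theta>. (\<phi> x h \<theta> - a * \<phi> v h \<theta> - b * \<phi> w h \<theta>) *\<^sub>R g \<theta>)) \<longlongrightarrow> 0) (at 0)"
    proof (rule integral_quotient_tendsto_0[OF gc N e(1), where B = "B x + \<bar>a\<bar> * B v + \<bar>b\<bar> * B w"])
      fix h assume h: "0 < \<bar>h\<bar>" "\<bar>h\<bar> < e"
      show "continuous_on {-pi..pi} (\<lambda>\<theta>. \<phi> x h \<theta> - a * \<phi> v h \<theta> - b * \<phi> w h \<theta>)"
        by (intro continuous_intros cc[OF h])
      fix \<theta>
      have "\<bar>a * \<phi> v h \<theta>\<bar> \<le> \<bar>a\<bar> * B v" "\<bar>b * \<phi> w h \<theta>\<bar> \<le> \<bar>b\<bar> * B w" "\<bar>\<phi> x h \<theta>\<bar> \<le> B x"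
        unfolding abs_mult using h e by (auto intro!: mult_left_mono b\<phi>)
      then show "\<bar>\<phi> x h \<theta> - a * \<phi> v h \<theta> - b * \<phi> w h \<theta>\<bar> \<le> B x + \<bar>a\<bar> * B v + \<bar>b\<bar> * B w" by linarith
    next
      fix \<theta> assume "\<theta> \<in> {-pi..pi} - N"
      then have \<theta>: "\<theta> \<notin> N" by simp
      have "D \<theta> x = a * D \<theta> v + b * D \<theta> w"
        using has_derivative_linear[OF D[OF \<theta>]] unfolding x by (simp add: linear_add linear_cmul)
      moreover have "((\<lambda>h. \<phi> x h \<theta> - a * \<phi> v h \<theta> - b * \<phi> w h \<theta>) \<longlongrightarrow> D \<theta> x - a * D \<theta> v - b * D \<theta> w) (at 0)"
        by (intro tendsto_intros lim[OF \<theta>])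
      ultimately show "((\<lambda>h. \<phi> x h \<theta> - a * \<phi> v h \<theta> - b * \<phi> w h \<theta>) \<longlongrightarrow> 0) (at 0)" by simp
    qed
    moreover have "eventually (\<lambda>h. integral {-pi..pi} (\<lambda>\<theta>. (\<phi> x h \<theta> - a * \<phi> v h \<theta> - b * \<phi> w h \<theta>) *\<^sub>R g \<theta>) =
        Q x h - a *\<^sub>R Q v h - b *\<^sub>R Q w h) (at 0)"
      unfolding eventually_at
    proof (intro exI[of _ e] conjI ballI impI e)
      fix h :: real assume "h \<noteq> 0 \<and> dist h 0 < e"
      then have h: "0 < \<bar>h\<bar>" "\<bar>h\<bar> < e" by auto
      have i: "(\<lambda>\<theta>. \<phi> y h \<theta> *\<^sub>R g \<theta>) integrable_on {-pi..pi}" if "y \<in> {x,v,w}" for y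
        using that cc[OF h] by (auto intro!: integrable_continuous_real continuous_intros gc)
      have Qs: "Q y h = integral {-pi..pi} (\<lambda>\<theta>. \<phi> y h \<theta> *\<^sub>R g \<theta>)" if "y \<in> {x,v,w}" for y
        using that h e by (intro Q) auto
      show "integral {-pi..pi} (\<lambda>\<theta>. (\<phi> x h \<theta> - a * \<phi> v h \<theta> - b * \<phi> w h \<theta>) *\<^sub>R g \<theta>) =
          Q x h - a *\<^sub>R Q v h - b *\<^sub>R Q w h"
        unfolding scaleR_diff_left scaleR_scaleR[symmetric]
        by (simp add: Qs integral_diff integrable_diff integrable_cmul i del: scaleR_scaleR)
    qed
    ultimately have "((\<lambda>h. Q x h - a *\<^sub>R Q v h - b *\<^sub>R Q w h) \<longlongrightarrow> 0) (at 0)"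
      by (rule Lim_transform_eventually)
    moreover have "((\<lambda>h. Q x h - a *\<^sub>R Q v h - b *\<^sub>R Q w h) \<longlongrightarrow> l x - a *\<^sub>R l v - b *\<^sub>R l w) (at 0)"
      by (intro tendsto_intros l)
    ultimately have "l x - a *\<^sub>R l v - b *\<^sub>R l w = 0" using tendsto_unique by (metis at_neq_bot)
    then show ?thesis by (simp add: algebra_simps)
  qed
  have "linear l"
  proof (rule linearI)
    show "l (v + w) = l v + l w" for v w using comb[of "v + w" 1 v 1 w] by simp
    show "l (c *\<^sub>R v) = c *\<^sub>R l v" for c v using comb[of "c *\<^sub>R v" c v 0 v] by simp
  qed
  then show ?thesis using l unfolding Q_def by (rule that)
qed

end

section \<open>Jacobians\<close>

text \<open>For a unit vector \<open>e\<close> the map scales by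
  \<open>c * (\<alpha> + \<beta>)\<close> along \<open>e\<close> and by \<open>c * \<alpha>\<close>
  across it.\<close>

lemma det_matrix_rank_one:
  fixes e :: "real^2"
  shows "det (matrix (\<lambda>v. c *\<^sub>R (\<alpha> *\<^sub>R v + (\<beta> * (v \<bullet> e)) *\<^sub>R e))) = c\<^sup>2 * \<alpha> * (\<alpha> + \<beta> * (norm e)\<^sup>2)"
  unfolding det_2 matrix_def norm_vec2 inner_vec_def
  by (simp add: sum_2 axis_def algebra_simps power2_eq_square)

lemma linear_rank_one: "linear (\<lambda>v. c *\<^sub>R (\<alpha> *\<^sub>R v + (\<beta> * (v \<bullet> e)) *\<^sub>R e))"
  by (rule linearI) (simp_all add: inner_add_left algebra_simps)

lemma norm_rank_one:
  assumes "norm e = 1"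
  shows "(norm (c *\<^sub>R (\<alpha> *\<^sub>R v + (\<beta> * (v \<bullet> e)) *\<^sub>R e)))\<^sup>2 =
    c\<^sup>2 * (\<alpha>\<^sup>2 * ((norm v)\<^sup>2 - (v \<bullet> e)\<^sup>2) + (\<alpha> + \<beta>)\<^sup>2 * (v \<bullet> e)\<^sup>2)"
proof -
  have e: "e \<bullet> e = 1" using assms by (simp add: norm_eq_1)
  have "(norm (\<alpha> *\<^sub>R v + (\<beta> * (v \<bullet> e)) *\<^sub>R e))\<^sup>2 = \<alpha>\<^sup>2 * ((norm v)\<^sup>2 - (v \<bullet> e)\<^sup>2) + (\<alpha> + \<beta>)\<^sup>2 * (v \<bullet> e)\<^sup>2"
    unfolding power2_norm_eq_inner using e
    by (simp add: inner_add_left inner_add_right inner_commute[of e v] power2_eq_square algebra_simps)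
  then show ?thesis by (simp add: power_mult_distrib)
qed

text \<open>Monotonicity compares \<open>s\<close> with the Euclidean norm pulled back by
  \<open>T\<close>, whose Jacobian is known from the transformation rule and the
  normalisation.\<close>

lemma jacobian_norm_linear:
  assumes J: "jacobian J" and s: "seminorm2 s" and T: "linear T" and le: "\<And>v. s v \<le> norm (T v)"
  shows "J s \<le> \<bar>det (matrix T)\<bar>"
proof -
  have n: "seminorm2 norm" by (auto simp: seminorm2_def norm_triangle_ineq)
  have nT: "seminorm2 (norm \<circ> T)"
    using T by (auto simp: seminorm2_def linear_add linear_cmul norm_triangle_ineq)
  have "J s \<le> J (norm \<circ> T)" using J s nT le unfolding jacobian_def by auto
  also have "\<dots> = \<bar>det (matrix T)\<bar> * J norm" using J n T unfolding jacobian_def by blast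
  also have "J norm = 1" using J unfolding jacobian_def by blast
  finally show ?thesis by simp
qed

lemma jacobian_le:
  assumes J: "jacobian J" and s: "seminorm2 s" and c: "0 \<le> c" "\<And>v. s v \<le> c * norm v"
  shows "J s \<le> c\<^sup>2"
proof -
  have "J s \<le> \<bar>det (matrix (\<lambda>v::real^2. c *\<^sub>R (1 *\<^sub>R v + (0 * (v \<bullet> 0)) *\<^sub>R 0)))\<bar>"
    by (rule jacobian_norm_linear[OF J s linear_rank_one]) (use c in auto)
  then show ?thesis unfolding det_matrix_rank_one by simp
qed

text \<open>A strict inequality in a single direction would not decrease the Jacobian, since the Euclidean
  disc may still be the inscribed ellipse of largest area. It is needed on a sector of angle
  more than a right angle; then a slightly eccentric ellipse gives a smaller bound.\<close>

lemma jacobian_le_strict: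
  assumes b: "0 < b" "b < 1"
  obtains r where "0 \<le> r" "r < 1"
    "\<And>J s c u. jacobian J \<Longrightarrow> seminorm2 s \<Longrightarrow> 0 \<le> c \<Longrightarrow> (\<And>v. s v \<le> c * norm v) \<Longrightarrow> u \<noteq> 0 \<Longrightarrow>
      (\<And>v. \<bar>u \<bullet> v\<bar> > norm u * norm v / 2 \<Longrightarrow> s v \<le> b * (c * norm v)) \<Longrightarrow> J s \<le> c\<^sup>2 * r"
proof -
  \<comment> \<open>Outside the sector the component along \<open>e\<close> satisfies
    \<open>4 * r \<le> n\<close>, so \<open>n - r \<ge> 3 * r\<close>; stretching across
    \<open>e\<close> by \<open>sqrt (1 + a)\<close> then makes up for the shrinking by
    \<open>b\<close> along \<open>e\<close>.\<close>
  define a where "a = (1 - b\<^sup>2) / 3"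
  define \<alpha> where "\<alpha> = sqrt (1 + a)"
  have b2: "0 < b\<^sup>2" "b\<^sup>2 < 1" using b by (auto simp: power_less_one_iff)
  have a: "a > 0" "3 * a = 1 - b\<^sup>2" using b2 by (auto simp: a_def)
  have \<alpha>: "\<alpha> > 0" "\<alpha>\<^sup>2 = 1 + a" using a by (auto simp: \<alpha>_def)
  \<comment> \<open>With this \<open>a\<close>, positivity of the product is the inequality
    \<open>(1 + a) * b\<^sup>2 < 1\<close> cleared of denominators: the ellipse still has
    determinant below one.\<close>
  have "0 < (1 - b\<^sup>2) * (3 - b\<^sup>2)" using b2 by (intro mult_pos_pos) auto
  then have "(\<alpha> * b)\<^sup>2 < 1" unfolding power_mult_distrib \<alpha>(2) a_def by (simp add: field_simps)
  then have r1: "\<alpha> * b < 1" using \<alpha> b by (simp add: abs_square_less_1)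
  show ?thesis
  proof (rule that[of "\<alpha> * b"])
    fix J s c and u :: "real^2"
    assume J: "jacobian J" and s: "seminorm2 s" and c: "0 \<le> c" "\<And>v. s v \<le> c * norm v" and u: "u \<noteq> 0"
      and st: "\<And>v. \<bar>u \<bullet> v\<bar> > norm u * norm v / 2 \<Longrightarrow> s v \<le> b * (c * norm v)"
    define e where "e = u /\<^sub>R norm u"
    have e: "norm e = 1" using u by (simp add: e_def)
    let ?T = "\<lambda>v. c *\<^sub>R (\<alpha> *\<^sub>R v + ((b - \<alpha>) * (v \<bullet> e)) *\<^sub>R e)"
    have "J s \<le> \<bar>det (matrix ?T)\<bar>"
    proof (rule jacobian_norm_linear[OF J s linear_rank_one])
      fix v
      define n r where "n = (norm v)\<^sup>2" and "r = (v \<bullet> e)\<^sup>2"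
      have nT: "(norm (?T v))\<^sup>2 = c\<^sup>2 * ((1 + a) * (n - r) + b\<^sup>2 * r)"
        unfolding norm_rank_one[OF e] n_def r_def using \<alpha>(2) by simp
      have rn: "r \<le> n" using Cauchy_Schwarz_ineq[of v e] e unfolding r_def n_def power2_norm_eq_inner[of v] by (simp add: norm_eq_1)
      have r0: "r \<ge> 0" by (simp add: r_def)
      show "s v \<le> norm (?T v)"
      proof (cases "\<bar>u \<bullet> v\<bar> > norm u * norm v / 2")
        case True
        have "b\<^sup>2 * n \<le> (1 + a) * (n - r) + b\<^sup>2 * r"
          using mult_right_mono[of "b\<^sup>2" "1 + a" "n - r"] rn a b2 by (simp add: algebra_simps)
        then have "c\<^sup>2 * (b\<^sup>2 * n) \<le> c\<^sup>2 * ((1 + a) * (n - r) + b\<^sup>2 * r)" by (rule mult_left_mono) simp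
        then have "(b * (c * norm v))\<^sup>2 \<le> (norm (?T v))\<^sup>2"
          unfolding nT by (simp add: power_mult_distrib n_def mult_ac)
        then have "b * (c * norm v) \<le> norm (?T v)" by (rule power2_le_imp_le) simp
        then show ?thesis using st[OF True] by linarith
      next
        case False
        have "v \<bullet> e = (u \<bullet> v) / norm u" by (simp add: e_def inner_commute divide_inverse)
        then have "\<bar>v \<bullet> e\<bar> = \<bar>u \<bullet> v\<bar> / norm u" by simp
        also have "\<dots> \<le> (norm u * norm v / 2) / norm u" using False by (intro divide_right_mono) auto
        finally have "\<bar>v \<bullet> e\<bar> \<le> norm v / 2" using u by simp
        then have "r \<le> (norm v / 2)\<^sup>2" unfolding r_def by (metis abs_ge_zero power2_abs power_mono)
        then have "4 * r \<le> n" by (simp add: n_def power_divide)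
        then have "a * (3 * r) \<le> a * (n - r)" using a(1) by (intro mult_left_mono) auto
        then have "n \<le> (1 + a) * (n - r) + b\<^sup>2 * r"
          using arg_cong[OF a(2), of "\<lambda>x. x * r"] by (simp add: algebra_simps)
        then have "c\<^sup>2 * n \<le> c\<^sup>2 * ((1 + a) * (n - r) + b\<^sup>2 * r)" by (rule mult_left_mono) simp
        then have "(c * norm v)\<^sup>2 \<le> (norm (?T v))\<^sup>2" unfolding nT by (simp add: power_mult_distrib n_def)
        then have "c * norm v \<le> norm (?T v)" by (rule power2_le_imp_le) simp
        then show ?thesis using c(2)[of v] by linarith
      qed
    qed
    then show "J s \<le> c\<^sup>2 * (\<alpha> * b)"
      unfolding det_matrix_rank_one using e \<alpha> b c by (simp add: abs_mult mult.assoc)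
  qed (use \<alpha> b r1 in auto)
qed

section \<open>Conformal factor of the chart, chords and arcs\<close>

definition conformal :: "real^2 \<Rightarrow> real" where
  "conformal u = 2 / (1 + (norm u)\<^sup>2)"

lemma conformal_pos: "conformal u > 0"
  by (simp add: conformal_def add_pos_nonneg)

lemma unit_chord:
  assumes "norm p = 1" "norm q = 1"
  shows "norm (p - q) = 2 * sin (dH2 p q / 2)" "0 \<le> dH2 p q" "dH2 p q \<le> pi"
proof -
  have "\<bar>p \<bullet> q\<bar> \<le> 1" using Cauchy_Schwarz_ineq2[of p q] assms by simp
  then have d: "0 \<le> dH2 p q" "dH2 p q \<le> pi" and c: "cos (dH2 p q) = p \<bullet> q"
    unfolding dH2_def by (auto simp: abs_le_iff arccos_lbound arccos_ubound cos_arccos)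
  then show "0 \<le> dH2 p q" "dH2 p q \<le> pi" by auto
  have "(norm (p - q))\<^sup>2 = 2 - 2 * (p \<bullet> q)"
    using assms by (simp add: power2_norm_eq_inner inner_diff inner_commute norm_eq_1)
  then have sq: "(norm (p - q))\<^sup>2 = (2 * sin (dH2 p q / 2))\<^sup>2"
    using cos_double_sin[of "dH2 p q / 2"] c by (simp add: power_mult_distrib)
  have "sin (dH2 p q / 2) \<ge> 0" using d by (intro sin_ge_zero) auto
  then show "norm (p - q) = 2 * sin (dH2 p q / 2)"
    by (intro power2_eq_imp_eq[OF sq norm_ge_zero]) linarith
qed

text \<open>The chord is \<open>2 * sin (d / 2)\<close> and the denominator is
  \<open>cos (d / 2)\<close>, so the claim is \<open>x * cos x \<le> sin x\<close>. The bound is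
  sharp to first order, as the passage to metric differentials requires.\<close>

lemma dH2_le_chord:
  assumes pq: "norm p = 1" "norm q = 1" and lt: "norm (p - q) < 2"
  shows "dH2 p q \<le> norm (p - q) / sqrt (1 - (norm (p - q))\<^sup>2 / 4)"
proof -
  define d where "d = dH2 p q"
  define x where "x = norm (p - q)"
  have d: "0 \<le> d" "d \<le> pi" and x: "x = 2 * sin (d / 2)"
    using unit_chord[OF pq] by (simp_all add: d_def x_def)
  have c0: "cos (d / 2) \<ge> 0" using d by (intro cos_ge_zero) auto
  have "1 - x\<^sup>2 / 4 = (cos (d / 2))\<^sup>2" unfolding x cos_squared_eq by (simp add: power_mult_distrib)
  then have c: "sqrt (1 - x\<^sup>2 / 4) = cos (d / 2)" using c0 by simp
  have "x\<^sup>2 < 2\<^sup>2" using lt by (intro power_strict_mono) (auto simp: x_def)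
  then have "sqrt (1 - x\<^sup>2 / 4) > 0" by simp
  then have "cos (d / 2) > 0" unfolding c .
  moreover have "d / 2 * cos (d / 2) \<le> sin (d / 2)" using d by (intro x_cos_le_sin) auto
  ultimately have "d \<le> x / cos (d / 2)" using x by (simp add: field_simps)
  then show ?thesis unfolding c[symmetric] unfolding d_def x_def .
qed

lemma dH2_le_2_chord:
  assumes "norm p = 1" "norm q = 1"
  shows "dH2 p q \<le> 2 * norm (p - q)"
proof -
  have d: "0 \<le> dH2 p q" "dH2 p q \<le> pi" by (rule unit_chord[OF assms])+
  have s0: "sin (dH2 p q / 2) \<ge> 0" using d by (intro sin_ge_zero) auto
  have "2 * (dH2 p q / 2) \<le> pi * sin (dH2 p q / 2)" using d by (intro jordan_sin) auto
  moreover have "pi * sin (dH2 p q / 2) \<le> 4 * sin (dH2 p q / 2)"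
    using s0 pi_less_4 by (intro mult_right_mono) auto
  ultimately show ?thesis unfolding unit_chord(1)[OF assms] by linarith
qed

lemma stereo_chord_sqrt:
  "norm (stereo_inv u - stereo_inv w) = 2 * norm (u - w) / sqrt ((1 + (norm u)\<^sup>2) * (1 + (norm w)\<^sup>2))"
  by (rule power2_eq_imp_eq)
    (simp_all add: stereo_chord power_divide power_mult_distrib add_nonneg_nonneg)

text \<open>The chord divided by \<open>\<bar>t\<bar>\<close> tends to
  \<open>conformal u * norm v\<close>, and the bound on the ratio of arc to chord tends to
  one.\<close>

lemma stereo_speed:
  fixes L :: real
  assumes c: "0 \<le> c" and lim: "((\<lambda>t. dist (f (u + t *\<^sub>R v)) (f u) / \<bar>t\<bar>) \<longlongrightarrow> L) (at 0)"
    and le: "eventually (\<lambda>t. dist (f (u + t *\<^sub>R v)) (f u) \<le> c * dH2 (stereo_inv (u + t *\<^sub>R v)) (stereo_inv u)) (at 0)"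
  shows "L \<le> c * (conformal u * norm v)"
proof -
  define x where "x t = norm (stereo_inv (u + t *\<^sub>R v) - stereo_inv u)" for t
  define S where "S t = sqrt ((1 + (norm (u + t *\<^sub>R v))\<^sup>2) * (1 + (norm u)\<^sup>2))" for t
  have xS: "x t = \<bar>t\<bar> * (2 * norm v / S t)" for t
    unfolding x_def S_def stereo_chord_sqrt by simp
  have Spos: "S t > 0" for t unfolding S_def by (simp add: add_pos_nonneg)
  have S0: "S 0 = 1 + (norm u)\<^sup>2" unfolding S_def by (simp add: add_nonneg_nonneg)
  have Sl: "(S \<longlongrightarrow> S 0) (at 0)" unfolding S_def by (intro tendsto_intros)
  have ql: "((\<lambda>t. 2 * norm v / S t) \<longlongrightarrow> conformal u * norm v) (at 0)"
    using tendsto_divide[OF tendsto_const[of "2 * norm v"] Sl] Spos[of 0] by (simp add: S0 conformal_def less_imp_neq[symmetric])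
  have xl: "(x \<longlongrightarrow> 0) (at 0)"
  proof -
    have "((\<lambda>t. \<bar>t\<bar> * (2 * norm v / S t)) \<longlongrightarrow> \<bar>0\<bar> * (conformal u * norm v)) (at 0)" by (intro tendsto_intros ql)
    then show ?thesis by (simp add: xS[abs_def])
  qed
  have "((\<lambda>t. c * ((2 * norm v / S t) / sqrt (1 - (x t)\<^sup>2 / 4))) \<longlongrightarrow> c * ((conformal u * norm v) / sqrt (1 - 0\<^sup>2 / 4))) (at 0)"
    by (intro tendsto_intros ql xl) simp_all
  then have bl: "((\<lambda>t. c * ((2 * norm v / S t) / sqrt (1 - (x t)\<^sup>2 / 4))) \<longlongrightarrow> c * (conformal u * norm v)) (at 0)" by simp
  have "eventually (\<lambda>t. x t < 2) (at 0)" using order_tendstoD(2)[OF xl, of 2] by simp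
  moreover have "eventually (\<lambda>t. t \<noteq> (0::real)) (at 0)" by (simp add: eventually_at_filter)
  ultimately have "eventually (\<lambda>t. dist (f (u + t *\<^sub>R v)) (f u) / \<bar>t\<bar> \<le> c * ((2 * norm v / S t) / sqrt (1 - (x t)\<^sup>2 / 4))) (at 0)"
    using le
  proof eventually_elim
    case (elim t)
    have "dH2 (stereo_inv (u + t *\<^sub>R v)) (stereo_inv u) \<le> x t / sqrt (1 - (x t)\<^sup>2 / 4)"
      unfolding x_def by (rule dH2_le_chord) (use elim in \<open>auto simp: x_def\<close>)
    then have "c * dH2 (stereo_inv (u + t *\<^sub>R v)) (stereo_inv u) \<le> c * (x t / sqrt (1 - (x t)\<^sup>2 / 4))"
      by (rule mult_left_mono[OF _ c])
    also have "\<dots> = \<bar>t\<bar> * (c * ((2 * norm v / S t) / sqrt (1 - (x t)\<^sup>2 / 4)))"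
      by (subst xS) simp
    finally show ?case using elim by (simp add: divide_le_eq mult.commute)
  qed
  then show ?thesis by (rule tendsto_le[OF trivial_limit_at bl lim])
qed

section \<open>Area\<close>

text \<open>In terms of the squared norm \<rho> the squared factor is
  \<open>4 / (1 + \<rho>)\<^sup>2\<close>. It equals one at the rim, and minus its derivative is the
  integrand.\<close>

lemma conformal_sq_layer:
  assumes "p \<in> ball 0 1"
  shows "ennreal ((conformal p)\<^sup>2) = 1 + (\<integral>\<^sup>+\<tau>. ennreal (8 / (1 + \<tau>) ^ 3) * indicator {(norm p)\<^sup>2..1} \<tau> \<partial>lborel)"
proof -
  define \<rho> where "\<rho> = (norm p)\<^sup>2"
  have \<rho>: "0 \<le> \<rho>" "\<rho> \<le> 1" using assms by (auto simp: \<rho>_def power_le_one)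
  have "(\<integral>\<^sup>+\<tau>. ennreal (8 / (1 + \<tau>) ^ 3) * indicator {\<rho>..1} \<tau> \<partial>lborel) = ennreal (- 4 / (1 + 1)\<^sup>2 - (- 4 / (1 + \<rho>)\<^sup>2))"
  proof (rule nn_integral_FTC_Icc[OF _ _ _ \<rho>(2)])
    fix x assume x: "x \<in> {\<rho>..1}"
    have x0: "1 + x > 0" using \<rho> x by simp
    have alg: "(0 * y\<^sup>2 - of_nat 2 * ((0 + 1) * y ^ (2 - Suc 0)) * - 4) / (y\<^sup>2 * y\<^sup>2) = 8 / y ^ 3" if "y > 0" for y :: real
      using that by (simp add: field_simps eval_nat_numeral)
    show "((\<lambda>x. - 4 / (1 + x)\<^sup>2) has_real_derivative 8 / (1 + x) ^ 3) (at x)"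
      by (rule DERIV_cong[OF DERIV_divide[OF DERIV_const[of "- 4"] DERIV_power[OF DERIV_add[OF DERIV_const[of 1] DERIV_ident], of 2]]])
        (use x0 alg[OF x0] in \<open>simp_all add: mult_ac\<close>)
    show "0 \<le> 8 / (1 + x) ^ 3" using x0 by simp
  qed simp
  then have "1 + (\<integral>\<^sup>+\<tau>. ennreal (8 / (1 + \<tau>) ^ 3) * indicator {\<rho>..1} \<tau> \<partial>lborel) = ennreal 1 + ennreal (4 / (1 + \<rho>)\<^sup>2 - 1)"
    by simp
  also have "\<dots> = ennreal (1 + (4 / (1 + \<rho>)\<^sup>2 - 1))"
  proof (rule ennreal_plus[symmetric])
    have "(1 + \<rho>)\<^sup>2 \<le> 2\<^sup>2" using \<rho> by (intro power_mono) auto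
    then show "0 \<le> 4 / (1 + \<rho>)\<^sup>2 - 1" using \<rho> by (simp add: le_divide_eq)
  qed simp
  also have "1 + (4 / (1 + \<rho>)\<^sup>2 - 1) = (conformal p)\<^sup>2" by (simp add: conformal_def \<rho>_def power_divide)
  finally show ?thesis by (simp add: \<rho>_def)
qed

lemma emeasure_ball2: "0 \<le> r \<Longrightarrow> emeasure lborel (ball (0::real^2) r) = ennreal (pi * r\<^sup>2)"
  by (simp add: emeasure_ball unit_ball_vol_2)

lemma borel_measurable_conformal [measurable]: "conformal \<in> borel_measurable borel"
  unfolding conformal_def by measurable

text \<open>Layer cake: the superlevel sets of the conformal factor are discs.\<close>

lemma nn_integral_conformal_sq: "(\<integral>\<^sup>+p\<in>ball 0 1. ennreal ((conformal p)\<^sup>2) \<partial>lborel) = ennreal (2 * pi)"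
proof -
  let ?w = "\<lambda>\<tau>::real. ennreal (8 / (1 + \<tau>) ^ 3)"
  let ?f = "\<lambda>\<tau> (p::real^2). ?w \<tau> * indicator {(norm p)\<^sup>2..1} \<tau> * indicator (ball (0::real^2) 1) p"
  have borel2: "borel_measurable (lborel \<Otimes>\<^sub>M lborel) = borel_measurable (borel \<Otimes>\<^sub>M borel)"
    by (rule measurable_cong_sets) (auto intro!: sets_pair_measure_cong)
  have m1: "(\<lambda>(p, \<tau>). ?f \<tau> p) \<in> borel_measurable (lborel \<Otimes>\<^sub>M lborel)"
  proof -
    have "(\<lambda>(p::real^2, \<tau>). if (norm p)\<^sup>2 \<le> \<tau> \<and> \<tau> \<le> 1 \<and> norm p < 1 then ?w \<tau> else 0) \<in> borel_measurable (borel \<Otimes>\<^sub>M borel)"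
      by measurable
    also have "(\<lambda>(p::real^2, \<tau>). if (norm p)\<^sup>2 \<le> \<tau> \<and> \<tau> \<le> 1 \<and> norm p < 1 then ?w \<tau> else 0) = (\<lambda>(p, \<tau>). ?f \<tau> p)"
      by (auto simp: indicator_def fun_eq_iff)
    finally show ?thesis unfolding borel2 .
  qed
  have m2: "(\<lambda>(\<tau>, p). ?f \<tau> p) \<in> borel_measurable (lborel \<Otimes>\<^sub>M lborel)"
    using measurable_pair_swap[OF m1] by simp
  have "(\<integral>\<^sup>+p\<in>ball 0 1. ennreal ((conformal p)\<^sup>2) \<partial>lborel) =
     (\<integral>\<^sup>+p. indicator (ball (0::real^2) 1) p + (\<integral>\<^sup>+\<tau>. ?w \<tau> * indicator {(norm p)\<^sup>2..1} \<tau> * indicator (ball 0 1) p \<partial>lborel) \<partial>lborel)"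
  proof (rule nn_integral_cong)
    fix p :: "real^2"
    show "ennreal ((conformal p)\<^sup>2) * indicator (ball 0 1) p =
        indicator (ball 0 1) p + (\<integral>\<^sup>+\<tau>. ?w \<tau> * indicator {(norm p)\<^sup>2..1} \<tau> * indicator (ball 0 1) p \<partial>lborel)"
      using conformal_sq_layer[of p] by (auto simp: indicator_def split: if_splits)
  qed
  also have "\<dots> = (\<integral>\<^sup>+p. indicator (ball (0::real^2) 1) p \<partial>lborel) +
      (\<integral>\<^sup>+p. (\<integral>\<^sup>+\<tau>. ?w \<tau> * indicator {(norm p)\<^sup>2..1} \<tau> * indicator (ball (0::real^2) 1) p \<partial>lborel) \<partial>lborel)"
  proof (rule nn_integral_add)
    show "(\<lambda>p. \<integral>\<^sup>+\<tau>. ?f \<tau> p \<partial>lborel) \<in> borel_measurable lborel"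
      by (rule lborel.borel_measurable_nn_integral[OF m1])
  qed (auto intro!: borel_measurable_indicator)
  also have "(\<integral>\<^sup>+p. (\<integral>\<^sup>+\<tau>. ?w \<tau> * indicator {(norm p)\<^sup>2..1} \<tau> * indicator (ball (0::real^2) 1) p \<partial>lborel) \<partial>lborel) =
     (\<integral>\<^sup>+\<tau>. (\<integral>\<^sup>+p. ?w \<tau> * indicator {(norm p)\<^sup>2..1} \<tau> * indicator (ball (0::real^2) 1) p \<partial>lborel) \<partial>lborel)"
    by (rule lborel_pair.Fubini'[OF m2])
  also have "\<dots> = (\<integral>\<^sup>+\<tau>. ennreal (8 * pi * \<tau> / (1 + \<tau>) ^ 3) * indicator {0..1} \<tau> \<partial>lborel)"
  proof (rule nn_integral_cong)
    fix \<tau> :: real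
    show "(\<integral>\<^sup>+p. ?w \<tau> * indicator {(norm p)\<^sup>2..1} \<tau> * indicator (ball (0::real^2) 1) p \<partial>lborel) =
        ennreal (8 * pi * \<tau> / (1 + \<tau>) ^ 3) * indicator {0..1} \<tau>"
    proof (cases "0 \<le> \<tau> \<and> \<tau> \<le> 1")
      case False
      then have "indicator {(norm p)\<^sup>2..1} \<tau> = (0::ennreal)" for p :: "real^2"
        using order_trans[OF zero_le_power2[of "norm p"], of \<tau>] by (auto simp: indicator_def)
      moreover have "indicator {0..1} \<tau> = (0::ennreal)" using False by simp
      ultimately show ?thesis by (simp only: mult_zero_left mult_zero_right nn_integral_const)
    next
      case True
      \<comment> \<open>For \<open>\<tau> = 1\<close> the closed disc would stick out of the open
        unit ball.\<close>
      define S where "S = (if \<tau> < 1 then cball (0::real^2) (sqrt \<tau>) else ball 0 1)"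
      have S: "emeasure lborel S = ennreal (pi * \<tau>)" "S \<in> sets lborel"
        using True by (auto simp: S_def emeasure_cball emeasure_ball unit_ball_vol_2)
      have "indicator {(norm p)\<^sup>2..1} \<tau> * indicator (ball 0 1) p = (indicator S p :: ennreal)" for p :: "real^2"
      proof -
        have "(norm p)\<^sup>2 \<le> \<tau> \<longleftrightarrow> norm p \<le> sqrt \<tau>"
          using True by (metis norm_ge_zero real_sqrt_le_iff real_sqrt_abs abs_norm_cancel)
        moreover have "norm p < 1" if "\<tau> < 1" "norm p \<le> sqrt \<tau>"
        proof -
          have "sqrt \<tau> < 1" using that(1) by simp
          with that(2) show ?thesis by linarith
        qed
        moreover have "norm p < 1 \<Longrightarrow> (norm p)\<^sup>2 \<le> 1" by (simp add: power_le_one)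
        ultimately show ?thesis using True by (cases "\<tau> < 1") (auto simp: indicator_def S_def)
      qed
      then have "(\<integral>\<^sup>+p. ?w \<tau> * indicator {(norm p)\<^sup>2..1} \<tau> * indicator (ball (0::real^2) 1) p \<partial>lborel) =
          (\<integral>\<^sup>+p. ?w \<tau> * indicator S p \<partial>lborel)" by (simp add: mult.assoc)
      also have "\<dots> = ?w \<tau> * ennreal (pi * \<tau>)" using S by (simp add: nn_integral_cmult_indicator)
      also have "\<dots> = ennreal (8 / (1 + \<tau>) ^ 3 * (pi * \<tau>))" using True by (intro ennreal_mult[symmetric]) auto
      finally show ?thesis using True by (simp add: mult_ac)
    qed
  qed
  \<comment> \<open>The layers contribute \<open>pi\<close>, and the constant \<open>1\<close> of
    the layer formula contributes the area \<open>pi\<close> of the disc.\<close>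
  also have "\<dots> = ennreal (4 * pi * (1 / (1 + 1))\<^sup>2 - 4 * pi * (0 / (1 + 0))\<^sup>2)"
  proof (rule nn_integral_FTC_Icc)
    fix x :: real assume x: "x \<in> {0..1}"
    then have x0: "1 + x > 0" by simp
    have alg: "4 * pi * (of_nat 2 * ((1 * (1 + x) - x * (0 + 1)) / ((1 + x) * (1 + x)) * (x / (1 + x)) ^ (2 - Suc 0))) = 8 * pi * x / (1 + x) ^ 3"
      using x0 by (simp add: power3_eq_cube)
    show "((\<lambda>x. 4 * pi * (x / (1 + x))\<^sup>2) has_real_derivative 8 * pi * x / (1 + x) ^ 3) (at x)"
      by (rule DERIV_cong[OF DERIV_cmult[OF DERIV_power[OF DERIV_divide[OF DERIV_ident DERIV_add[OF DERIV_const[of 1] DERIV_ident]], where n = 2]]])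
        (use x0 alg in \<open>simp_all add: mult_ac\<close>)
    show "0 \<le> 8 * pi * x / (1 + x) ^ 3" using x by simp
  qed simp_all
  also have "(\<integral>\<^sup>+p. indicator (ball (0::real^2) 1) p \<partial>lborel) = ennreal pi"
    using emeasure_ball2[of 1] by simp
  finally show ?thesis by (simp add: power2_eq_square ennreal_plus[symmetric] del: ennreal_plus)
qed

section \<open>The metric differential of the filling in the chart\<close>

lemma hemi_fill_stereo_derivative:
  fixes \<gamma> :: "real^2 \<Rightarrow> 'a::banach"
  assumes \<gamma>: "lipschitz_wrt dS1 1 S1 \<gamma>" and u: "u \<noteq> 0" "norm u < 1"
  obtains l :: "real^2 \<Rightarrow> 'a" where "linear l"
    "\<And>v. ((\<lambda>t. dist ((hemi_fill \<gamma> \<circ> stereo_inv) (u + t *\<^sub>R v)) ((hemi_fill \<gamma> \<circ> stereo_inv) u) / \<bar>t\<bar>) \<longlongrightarrow> norm (l v)) (at 0)"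
proof -
  interpret periodic_lipschitz "\<gamma> \<circ> circ" by (rule periodic_lipschitz_circ[OF \<gamma>])
  obtain l where l: "linear l"
    "\<And>v. ((\<lambda>h. (fill_int (\<gamma> \<circ> circ) (stereo_inv (u + h *\<^sub>R v)) - fill_int (\<gamma> \<circ> circ) (stereo_inv u)) /\<^sub>R h) \<longlongrightarrow> l v) (at 0)"
    by (rule fill_int_stereo_derivative[OF u]) blast
  show ?thesis
  proof (rule that[OF l(1)])
    fix v
    have "((\<lambda>t. u + t *\<^sub>R v) \<longlongrightarrow> u + 0 *\<^sub>R v) (at 0)" by (intro tendsto_intros)
    then have "eventually (\<lambda>t. norm (u + t *\<^sub>R v) < 1) (at 0)"
      using u by (intro order_tendstoD(2)[OF tendsto_norm]) auto
    then have "eventually (\<lambda>t. norm ((fill_int (\<gamma> \<circ> circ) (stereo_inv (u + t *\<^sub>R v)) - fill_int (\<gamma> \<circ> circ) (stereo_inv u)) /\<^sub>R t) =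
        dist ((hemi_fill \<gamma> \<circ> stereo_inv) (u + t *\<^sub>R v)) ((hemi_fill \<gamma> \<circ> stereo_inv) u) / \<bar>t\<bar>) (at 0)"
    proof eventually_elim
      case (elim t)
      then show ?case using stereo_3_pos[OF elim] stereo_3_pos[OF u(2)]
        by (simp add: hemi_fill_def dist_norm divide_inverse mult.commute)
    qed
    then show "((\<lambda>t. dist ((hemi_fill \<gamma> \<circ> stereo_inv) (u + t *\<^sub>R v)) ((hemi_fill \<gamma> \<circ> stereo_inv) u) / \<bar>t\<bar>) \<longlongrightarrow> norm (l v)) (at 0)"
      by (rule Lim_transform_eventually[OF tendsto_norm[OF l(2)]])
  qed
qed

lemma stereo_in_H2: "norm u \<le> 1 \<Longrightarrow> stereo_inv u \<in> H2"
  by (simp add: H2_def stereo_3 power_le_one add_nonneg_nonneg divide_nonneg_nonneg)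

lemma open_stereo_patch: "open {u. norm u < 1 \<and> stereo_inv u \<in> patch \<omega> z \<eta>}"
proof -
  have c: "continuous_on UNIV stereo_inv"
    using continuous_stereo by (intro continuous_at_imp_continuous_on) simp
  have "{u. norm u < 1 \<and> stereo_inv u \<in> patch \<omega> z \<eta>} =
    {u. norm u < 1} \<inter> {u. z / 2 < stereo_inv u $ 3} \<inter> {u. stereo_inv u $ 3 < z} \<inter>
    {u. 3 / 4 < stereo_inv u $ 1 * cos \<omega> + stereo_inv u $ 2 * sin \<omega>} \<inter>
    {u. \<bar>stereo_inv u $ 2 * cos \<omega> - stereo_inv u $ 1 * sin \<omega>\<bar> < \<eta> / 4}"
    by (auto simp: patch_def)
  also have "open \<dots>" by (intro open_Int open_Collect_less continuous_intros c)
  finally show ?thesis .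
qed

lemma stereo_patch_nonempty:
  assumes z: "0 < z" "z \<le> 1 / 16" and \<eta>: "0 < \<eta>"
  shows "\<exists>u. norm u < 1 \<and> stereo_inv u \<in> patch \<omega> z \<eta>"
proof -
  \<comment> \<open>The witness lies vertically above the equatorial point at \<omega>, at height
    three quarters of \<open>z\<close>, the middle of the allowed range.\<close>
  define w where "w = 3 * z / 4"
  have w: "0 < w" "w < z" "z / 2 < w" "w < 1 / 16" using z by (auto simp: w_def)
  define \<rho> where "\<rho> = sqrt ((1 - w) / (1 + w))"
  have \<rho>2: "\<rho>\<^sup>2 = (1 - w) / (1 + w)" and \<rho>0: "\<rho> \<ge> 0" using w by (auto simp: \<rho>_def)
  have "\<rho>\<^sup>2 < 1" unfolding \<rho>2 using w by simp
  have n1: "norm (circ \<omega>) = 1" using circ_in_S1[of \<omega>] by (simp add: S1_def)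
  define u where "u = \<rho> *\<^sub>R circ \<omega>"
  have nu2: "(norm u)\<^sup>2 = \<rho>\<^sup>2" using n1 by (simp add: u_def power_mult_distrib)
  have nu: "norm u < 1" using \<open>\<rho>\<^sup>2 < 1\<close> nu2 by (metis abs_norm_cancel abs_square_less_1)
  have d: "1 + \<rho>\<^sup>2 = 2 / (1 + w)" "1 - \<rho>\<^sup>2 = 2 * w / (1 + w)" unfolding \<rho>2 using w by (auto simp: field_simps)
  have p3: "stereo_inv u $ 3 = w" unfolding stereo_3 nu2 d using w by simp
  define m where "m = 2 * \<rho> / (1 + \<rho>\<^sup>2)"
  have p12: "stereo_inv u $ 1 = m * cos \<omega>" "stereo_inv u $ 2 = m * sin \<omega>"
    unfolding stereo_inv_def vector_3 nu2 by (simp_all add: u_def circ_def m_def)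
  have "m\<^sup>2 * ((cos \<omega>)\<^sup>2 + (sin \<omega>)\<^sup>2) + w\<^sup>2 = 1"
    using norm_stereo[of u] unfolding unit_vec3 p12 p3 by (simp only: power_mult_distrib distrib_left)
  then have m2: "m\<^sup>2 = 1 - w\<^sup>2" by simp
  have "w\<^sup>2 \<le> (1 / 16)\<^sup>2" using w by (intro power_mono) auto
  then have "(3 / 4)\<^sup>2 < m\<^sup>2" unfolding m2 by (simp add: power2_eq_square)
  moreover have "m \<ge> 0" unfolding m_def using \<rho>0 by (simp add: add_nonneg_nonneg)
  ultimately have m: "3 / 4 < m" by (rule power2_less_imp_less)
  have "m * cos \<omega> * cos \<omega> + m * sin \<omega> * sin \<omega> = m * ((sin \<omega>)\<^sup>2 + (cos \<omega>)\<^sup>2)"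
    by (simp only: power2_eq_square algebra_simps)
  then have "m * cos \<omega> * cos \<omega> + m * sin \<omega> * sin \<omega> = m" by simp
  then have "stereo_inv u \<in> patch \<omega> z \<eta>"
    unfolding patch_def using p3 p12 m w \<eta> by simp
  then show ?thesis using nu by blast
qed

text \<open>The height depends on the norm only, and \<open>v\<close> makes an angle below 60
  degrees with the radial line. The squared norm then changes by at least
  \<open>(3 / 4 - 1 / 4) * \<bar>t\<bar> * norm v\<close>; the remaining factor \<open>1 / 2\<close>
  comes from \<open>sqrt D \<le> 2\<close>. This verifies the steepness condition of the strict
  estimate.\<close>

lemma stereo_height_diff:
  assumes u: "norm u < 1" "norm w < 1" and nu: "3 / 4 \<le> norm u"
    and v: "w = u + t *\<^sub>R v" "norm u * norm v / 2 < \<bar>u \<bullet> v\<bar>" "\<bar>t\<bar> * norm v \<le> 1 / 4"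
  shows "norm (stereo_inv w - stereo_inv u) / 4 \<le> \<bar>stereo_inv w $ 3 - stereo_inv u $ 3\<bar>"
proof -
  define a b where "a = (norm w)\<^sup>2" and "b = (norm u)\<^sup>2"
  have ab: "0 \<le> a" "a \<le> 1" "0 \<le> b" "b \<le> 1" using u by (auto simp: a_def b_def power_le_one)
  define D where "D = (1 + a) * (1 + b)"
  have D: "D > 0" using ab unfolding D_def by (intro mult_pos_pos) auto
  have "D \<le> 2 * 2" unfolding D_def using ab by (intro mult_mono) auto
  then have sD: "sqrt D \<le> 2" by (intro real_le_lsqrt) auto
  have sDp: "sqrt D > 0" "sqrt D * sqrt D = D" using D by auto
  have nz: "1 + a \<noteq> 0" "1 + b \<noteq> 0" using ab by auto
  have p3: "stereo_inv w $ 3 - stereo_inv u $ 3 = 2 * (b - a) / D"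
    unfolding stereo_3 a_def[symmetric] b_def[symmetric] D_def using nz by (simp add: field_simps)
  have ch: "norm (stereo_inv w - stereo_inv u) = 2 * (\<bar>t\<bar> * norm v) / sqrt D"
    unfolding stereo_chord_sqrt D_def a_def b_def v(1) by simp
  have "a - b = t * (2 * (u \<bullet> v) + t * (norm v)\<^sup>2)"
    unfolding a_def b_def v(1) power2_norm_eq_inner
    by (simp add: inner_add_left inner_add_right inner_commute algebra_simps power2_eq_square)
  then have "\<bar>b - a\<bar> = \<bar>t\<bar> * \<bar>2 * (u \<bullet> v) + t * (norm v)\<^sup>2\<bar>" by (simp add: abs_mult abs_minus_commute)
  moreover have "norm v / 2 \<le> \<bar>2 * (u \<bullet> v) + t * (norm v)\<^sup>2\<bar>"
  proof -
    have "3 / 4 * norm v \<le> norm u * norm v" using nu by (intro mult_right_mono) auto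
    moreover have "\<bar>t * (norm v)\<^sup>2\<bar> \<le> 1 / 4 * norm v"
      using mult_right_mono[OF v(3), of "norm v"] by (simp add: abs_mult power2_eq_square mult.assoc)
    ultimately show ?thesis using v(2) by linarith
  qed
  ultimately have ba: "\<bar>t\<bar> * norm v / 2 \<le> \<bar>b - a\<bar>"
    using mult_left_mono[of "norm v / 2" "\<bar>2 * (u \<bullet> v) + t * (norm v)\<^sup>2\<bar>" "\<bar>t\<bar>"] by simp
  have "sqrt D * (\<bar>t\<bar> * norm v) \<le> 2 * (2 * \<bar>b - a\<bar>)" 
    using mult_mono[OF sD, of "\<bar>t\<bar> * norm v" "2 * \<bar>b - a\<bar>"] ba by simp
  then have "(sqrt D * (\<bar>t\<bar> * norm v)) / (2 * D) \<le> (2 * (2 * \<bar>b - a\<bar>)) / (2 * D)"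
    using D by (intro divide_right_mono) auto
  also have "(sqrt D * (\<bar>t\<bar> * norm v)) / (2 * D) = 2 * (\<bar>t\<bar> * norm v) / sqrt D / 4"
  proof -
    have "(s * X) / (2 * (s * s)) = 2 * X / s / 4" if "s > 0" for s X :: real using that by simp
    from this[OF sDp(1)] show ?thesis unfolding sDp(2) .
  qed
  also have "(2 * (2 * \<bar>b - a\<bar>)) / (2 * D) = \<bar>2 * (b - a) / D\<bar>"
    unfolding abs_divide abs_mult using D by (simp only: abs_of_pos abs_numeral mult_divide_mult_cancel_left_if) simp
  finally show ?thesis unfolding ch p3 .
qed

text \<open>Near the chosen node the strict estimate covers all directions within 60 degrees of the
  radial line, which is the sector that \<open>jacobian_le_strict\<close> asks for. Elsewhere the
  1-Lipschitz property bounds the Jacobian by that of the chart.\<close>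

lemma jacobian_md_hemi_fill:
  fixes \<gamma> :: "real^2 \<Rightarrow> 'a::banach"
  assumes J: "jacobian J" and \<gamma>: "lipschitz_wrt dS1 1 S1 \<gamma>" and ni: "\<not> isometric_embedding_S1 \<gamma>"
  obtains W r where "open W" "W \<noteq> {}" "W \<subseteq> ball 0 1" "0 \<le> r" "r < 1"
    "\<And>u. u \<in> ball 0 1 - {0} \<Longrightarrow> J (md (hemi_fill \<gamma> \<circ> stereo_inv) u) \<le> (conformal u)\<^sup>2"
    "\<And>u. u \<in> W \<Longrightarrow> J (md (hemi_fill \<gamma> \<circ> stereo_inv) u) \<le> (conformal u)\<^sup>2 * r"
proof -
  interpret periodic_lipschitz "\<gamma> \<circ> circ" by (rule periodic_lipschitz_circ[OF \<gamma>])
  let ?f = "hemi_fill \<gamma> \<circ> stereo_inv"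
  obtain \<omega> where \<omega>: "norm ((\<gamma> \<circ> circ) (\<omega> + pi) - (\<gamma> \<circ> circ) \<omega>) < pi" using bad_antipodes[OF \<gamma> ni] .
  obtain \<epsilon> z \<eta> where \<epsilon>: "0 < \<epsilon>" "\<epsilon> < 1" and z: "0 < z" "z \<le> 1 / 16" and \<eta>: "0 < \<eta>"
    and strict: "\<And>p q. p \<in> patch \<omega> z \<eta> \<Longrightarrow> q \<in> patch \<omega> z \<eta> \<Longrightarrow> norm (p - q) / 4 \<le> \<bar>p $ 3 - q $ 3\<bar> \<Longrightarrow>
       norm (fill_int (\<gamma> \<circ> circ) p - fill_int (\<gamma> \<circ> circ) q) \<le> (1 - \<epsilon>) * dH2 p q"
    using fill_int_strict[OF \<omega>] by blast
  obtain r where r: "0 \<le> r" "r < 1" and Jr: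
    "\<And>J s c u. jacobian J \<Longrightarrow> seminorm2 s \<Longrightarrow> 0 \<le> c \<Longrightarrow> (\<And>v. s v \<le> c * norm v) \<Longrightarrow> u \<noteq> 0 \<Longrightarrow>
      (\<And>v. \<bar>u \<bullet> v\<bar> > norm u * norm v / 2 \<Longrightarrow> s v \<le> (1 - \<epsilon>) * (c * norm v)) \<Longrightarrow> J s \<le> c\<^sup>2 * r"
    using jacobian_le_strict[of "1 - \<epsilon>"] \<epsilon> by auto
  define W where "W = {u. norm u < 1 \<and> stereo_inv u \<in> patch \<omega> z \<eta>}"
  have oW: "open W" unfolding W_def by (rule open_stereo_patch)
  have W0: "W \<noteq> {}" using stereo_patch_nonempty[OF z \<eta>] by (auto simp: W_def)
  have sn: "seminorm2 (md ?f u) \<and> (\<forall>v. md ?f u v \<le> conformal u * norm v) \<and> (u \<in> W \<longrightarrow> (\<forall>v. \<bar>u \<bullet> v\<bar> > norm u * norm v / 2 \<longrightarrow> md ?f u v \<le> (1 - \<epsilon>) * (conformal u * norm v)))"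
    if u: "u \<noteq> 0" "norm u < 1" for u
  proof -
    obtain l :: "real^2 \<Rightarrow> 'a" where l: "linear l"
      "\<And>v. ((\<lambda>t. dist (?f (u + t *\<^sub>R v)) (?f u) / \<bar>t\<bar>) \<longlongrightarrow> norm (l v)) (at 0)"
      by (rule hemi_fill_stereo_derivative[OF \<gamma> u]) blast
    have md: "md ?f u v = norm (l v)" for v
      unfolding md_def by (rule tendsto_Lim[OF trivial_limit_at l(2)])
    have ul: "((\<lambda>t. u + t *\<^sub>R v) \<longlongrightarrow> u) (at 0)" for v
    proof -
      have "((\<lambda>t. u + t *\<^sub>R v) \<longlongrightarrow> u + 0 *\<^sub>R v) (at 0)" by (intro tendsto_intros)
      then show ?thesis by simp
    qed
    have "seminorm2 (md ?f u)"
      unfolding seminorm2_def md using l(1) by (simp add: linear_add linear_cmul norm_triangle_ineq)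
    moreover have "md ?f u v \<le> 1 * (conformal u * norm v)" for v
      unfolding md
    proof (rule stereo_speed[OF _ l(2)])
      have "eventually (\<lambda>t. norm (u + t *\<^sub>R v) < 1) (at 0)"
        using order_tendstoD(2)[OF tendsto_norm[OF ul[of v]] u(2)] .
      then show "eventually (\<lambda>t. dist (?f (u + t *\<^sub>R v)) (?f u) \<le> 1 * dH2 (stereo_inv (u + t *\<^sub>R v)) (stereo_inv u)) (at 0)"
        by eventually_elim (use hemi_fill_lipschitz[OF \<gamma>] stereo_in_H2 u in \<open>auto simp: lipschitz_wrt_def\<close>)
    qed simp
    moreover have "md ?f u v \<le> (1 - \<epsilon>) * (conformal u * norm v)" if uW: "u \<in> W" and v: "\<bar>u \<bullet> v\<bar> > norm u * norm v / 2" for v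
      unfolding md
    proof (rule stereo_speed[OF _ l(2)])
      \<comment> \<open>A height below \<open>1 / 16\<close> forces \<open>u\<close> towards the
        rim, which gives the threshold \<open>3 / 4\<close> of
        \<open>stereo_height_diff\<close>.\<close>
      have "stereo_inv u $ 3 < 1 / 16" using uW z by (auto simp: W_def patch_def)
      then have 9: "9 / 16 \<le> (norm u)\<^sup>2" unfolding stereo_3 by (simp add: divide_less_eq add_pos_nonneg)
      have "(3 / 4 :: real)\<^sup>2 = 9 / 16" by (simp add: power2_eq_square)
      then have "(3 / 4)\<^sup>2 \<le> (norm u)\<^sup>2" using 9 by (simp only:)
      then have nu: "3 / 4 \<le> norm u" by (rule power2_le_imp_le) simp
      have "eventually (\<lambda>t. u + t *\<^sub>R v \<in> W) (at 0)" using topological_tendstoD[OF ul oW uW] .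
      moreover have "eventually (\<lambda>t. \<bar>t\<bar> * norm v \<le> 1 / 4) (at 0)"
      proof -
        have "((\<lambda>t. \<bar>t\<bar> * norm v) \<longlongrightarrow> \<bar>0\<bar> * norm v) (at 0)" by (intro tendsto_intros)
        from order_tendstoD(2)[OF this, of "1 / 4"] show ?thesis by (auto elim: eventually_mono)
      qed
      ultimately show "eventually (\<lambda>t. dist (?f (u + t *\<^sub>R v)) (?f u) \<le> (1 - \<epsilon>) * dH2 (stereo_inv (u + t *\<^sub>R v)) (stereo_inv u)) (at 0)"
      proof eventually_elim
        case (elim t)
        then have w: "norm (u + t *\<^sub>R v) < 1" "stereo_inv (u + t *\<^sub>R v) \<in> patch \<omega> z \<eta>" by (auto simp: W_def)
        have up: "stereo_inv u \<in> patch \<omega> z \<eta>" using uW by (simp add: W_def)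
        have "norm (fill_int (\<gamma> \<circ> circ) (stereo_inv (u + t *\<^sub>R v)) - fill_int (\<gamma> \<circ> circ) (stereo_inv u))
            \<le> (1 - \<epsilon>) * dH2 (stereo_inv (u + t *\<^sub>R v)) (stereo_inv u)"
          by (rule strict[OF w(2) up stereo_height_diff[OF u(2) w(1) nu refl v elim(2)]])
        then show ?case using stereo_3_pos[OF w(1)] stereo_3_pos[OF u(2)] by (simp add: hemi_fill_def dist_norm)
      qed
    qed (use \<epsilon> in simp)
    ultimately show ?thesis by simp
  qed
  show ?thesis
  proof (rule that[OF oW W0 _ r])
    show "W \<subseteq> ball 0 1" by (auto simp: W_def)
    show "J (md ?f u) \<le> (conformal u)\<^sup>2" if "u \<in> ball 0 1 - {0}" for u
      using sn[of u] that conformal_pos[of u] by (intro jacobian_le[OF J]) auto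
    show "J (md ?f u) \<le> (conformal u)\<^sup>2 * r" if uW: "u \<in> W" for u
    proof -
      have "stereo_inv u $ 3 < 1" using uW z by (auto simp: W_def patch_def)
      then have u: "u \<noteq> 0" "norm u < 1" using uW by (auto simp: stereo_3 W_def)
      show ?thesis using sn[OF u] uW u conformal_pos[of u] by (intro Jr[OF J, where u = u]) auto
    qed
  qed
qed

text \<open>Comparison with the area \<open>2 * pi\<close> of the hemisphere: on the nonempty open
  set \<open>W\<close>, which carries positive finite area, the integrand loses a factor
  \<open>r < 1\<close>.\<close>

lemma area_hemi_fill:
  assumes J: "jacobian J" and \<gamma>: "lipschitz_wrt dS1 1 S1 \<gamma>" and ni: "\<not> isometric_embedding_S1 \<gamma>"
  shows "area J (hemi_fill \<gamma> \<circ> stereo_inv) (ball 0 1) < ennreal (2 * pi)"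
proof -
  let ?f = "hemi_fill \<gamma> \<circ> stereo_inv"
  obtain W r where W: "open W" "W \<noteq> {}" "W \<subseteq> ball 0 1" and r: "0 \<le> r" "r < 1"
    and le: "\<And>u. u \<in> ball 0 1 - {0} \<Longrightarrow> J (md ?f u) \<le> (conformal u)\<^sup>2"
    and leW: "\<And>u. u \<in> W \<Longrightarrow> J (md ?f u) \<le> (conformal u)\<^sup>2 * r"
    using jacobian_md_hemi_fill[OF assms] by blast
  define c where "c u = ennreal ((conformal u)\<^sup>2)" for u
  have cm [measurable]: "c \<in> borel_measurable borel" unfolding c_def by measurable
  have Wm [measurable]: "W \<in> sets borel" using W(1) by simp
  have Bm [measurable]: "ball (0::real^2) 1 \<in> sets borel" by simp
  define I R where "I = (\<integral>\<^sup>+u. c u * indicator W u \<partial>lborel)" and "R = (\<integral>\<^sup>+u. c u * indicator (ball 0 1 - W) u \<partial>lborel)"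
  have "R + I = (\<integral>\<^sup>+u. c u * indicator (ball 0 1 - W) u + c u * indicator W u \<partial>lborel)"
    unfolding I_def R_def by (intro nn_integral_add[symmetric]) measurable
  also have "\<dots> = (\<integral>\<^sup>+u\<in>ball 0 1. c u \<partial>lborel)"
    using W(3) by (intro nn_integral_cong) (auto simp: indicator_def)
  finally have sum: "R + I = ennreal (2 * pi)" unfolding c_def nn_integral_conformal_sq .
  have "area J ?f (ball 0 1) \<le> (\<integral>\<^sup>+u. c u * indicator (ball 0 1 - W) u + ennreal r * (c u * indicator W u) \<partial>lborel)"
    unfolding area_def
  proof (rule nn_integral_mono_AE, rule AE_I[where N = "{0}"])
    have "ennreal (J (md ?f u)) * indicator (ball 0 1) u \<le> c u * indicator (ball 0 1 - W) u + ennreal r * (c u * indicator W u)"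
      if "u \<noteq> 0" for u
    proof (cases "u \<in> W")
      case True
      have "ennreal (J (md ?f u)) \<le> ennreal ((conformal u)\<^sup>2 * r)" by (rule ennreal_leI[OF leW[OF True]])
      also have "\<dots> = ennreal r * c u" using r by (simp add: c_def ennreal_mult mult.commute)
      finally show ?thesis using True W(3) by (auto simp: indicator_def)
    next
      case False
      then show ?thesis using le[of u] that by (auto simp: indicator_def c_def intro: ennreal_leI)
    qed
    then show "{u \<in> space lborel. \<not> ennreal (J (md ?f u)) * indicator (ball 0 1) u \<le>
        c u * indicator (ball 0 1 - W) u + ennreal r * (c u * indicator W u)} \<subseteq> {0}" by blast
  qed simp_all
  also have "\<dots> = R + ennreal r * I"
    unfolding I_def R_def by (subst nn_integral_add) (auto simp: nn_integral_cmult)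
  also have "\<dots> < R + I"
  proof -
    have "R \<le> R + I" "I \<le> R + I" by simp_all
    then have fin: "R < top" "I < top" unfolding sum by (auto intro: le_less_trans[OF _ ennreal_less_top])
    have "I > 0"
    proof -
      have "emeasure lborel W \<le> I"
      proof -
        have "emeasure lborel W = (\<integral>\<^sup>+u. indicator W u \<partial>lborel)" by simp
        also have "\<dots> \<le> I" unfolding I_def
        proof (rule nn_integral_mono)
          fix u :: "real^2"
          show "indicator W u \<le> c u * indicator W u"
          proof (cases "u \<in> W")
            case True
            then have "(norm u)\<^sup>2 \<le> 1" using W(3) by (auto simp: power_le_one)
            then have "1 \<le> conformal u" by (simp add: conformal_def add_pos_nonneg)
            then have "1 \<le> (conformal u)\<^sup>2" by simp
            then show ?thesis using True by (simp add: c_def)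
          qed simp
        qed
        finally show ?thesis .
      qed
      moreover have "emeasure lborel W > 0"
      proof -
        obtain x where "x \<in> W" using W(2) by blast
        then obtain e where e: "e > 0" "ball x e \<subseteq> W" using W(1) open_contains_ball by blast
        have "0 < emeasure lborel (ball x e)" using e by (simp add: emeasure_ball unit_ball_vol_2)
        also have "\<dots> \<le> emeasure lborel W" by (rule emeasure_mono[OF e(2)]) simp
        finally show ?thesis .
      qed
      ultimately show ?thesis by (rule less_le_trans[rotated])
    qed
    obtain i where i: "I = ennreal i" "i \<ge> 0" using fin(2) by (cases I) auto
    have "i > 0" using \<open>I > 0\<close> i by simp
    then have "ennreal r * I < I" using r i by (simp add: ennreal_mult[symmetric] ennreal_less_iff)
    then show ?thesis using fin(1) by (simp add: ennreal_add_left_cancel_less less_top)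
  qed
  also have "R + I = ennreal (2 * pi)" by (rule sum)
  finally show ?thesis .
qed

theorem theorem1p2:
  fixes J :: "(real^2 \<Rightarrow> real) \<Rightarrow> real"
    and \<gamma> :: "real^2 \<Rightarrow> 'a::banach"
  assumes "jacobian J"
    and "lipschitz_wrt dS1 1 S1 \<gamma>"
    and "\<not> isometric_embedding_S1 \<gamma>"
  shows "(\<exists>m :: real^3 \<Rightarrow> 'a. lipschitz_wrt dH2 1 H2 m \<and> (\<forall>x\<in>S1. m (equator x) = \<gamma> x)
            \<and> area_H2 J m < ennreal (2 * pi))
         \<and> fill_area J \<gamma> < ennreal (2 * pi)"
proof
  have a: "area J (hemi_fill \<gamma> \<circ> stereo_inv) (ball 0 1) < ennreal (2 * pi)"
    by (rule area_hemi_fill[OF assms])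
  show "\<exists>m :: real^3 \<Rightarrow> 'a. lipschitz_wrt dH2 1 H2 m \<and> (\<forall>x\<in>S1. m (equator x) = \<gamma> x) \<and> area_H2 J m < ennreal (2 * pi)"
    using hemi_fill_lipschitz[OF assms(2)] hemi_fill_equator[of \<gamma>] a unfolding area_H2_def by blast
  have "4-lipschitz_on (cball 0 1) (hemi_fill \<gamma> \<circ> stereo_inv)"
  proof (rule lipschitz_onI)
    fix x y :: "real^2" assume "x \<in> cball 0 1" "y \<in> cball 0 1"
    then have H: "stereo_inv x \<in> H2" "stereo_inv y \<in> H2" by (auto intro: stereo_in_H2)
    have "dist ((hemi_fill \<gamma> \<circ> stereo_inv) x) ((hemi_fill \<gamma> \<circ> stereo_inv) y) \<le> dH2 (stereo_inv x) (stereo_inv y)"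
      using hemi_fill_lipschitz[OF assms(2)] H by (simp add: lipschitz_wrt_def)
    \<comment> \<open>Arcs are at most twice their chords, and the chart at most doubles
      distances.\<close>
    also have "\<dots> \<le> 2 * (2 * norm (x - y))" using dH2_le_2_chord[OF norm_stereo norm_stereo, of x y] stereo_lipschitz[of x y] by linarith
    finally show "dist ((hemi_fill \<gamma> \<circ> stereo_inv) x) ((hemi_fill \<gamma> \<circ> stereo_inv) y) \<le> 4 * dist x y" by (simp add: dist_norm)
  qed simp
  moreover have "(hemi_fill \<gamma> \<circ> stereo_inv) x = \<gamma> x" if "x \<in> S1" for x
  proof -
    have "stereo_inv x = equator x" using that by (simp add: stereo_inv_def equator_def S1_def)
    then show ?thesis by (simp add: hemi_fill_equator)
  qed
  ultimately have "fill_area J \<gamma> \<le> area J (hemi_fill \<gamma> \<circ> stereo_inv) (ball 0 1)"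
    unfolding fill_area_def by (intro Inf_lower) blast
  then show "fill_area J \<gamma> < ennreal (2 * pi)" using a by (rule le_less_trans)
qed

end
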